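(* Let $\eta\in(1/2,1)$, let $x\in C^\eta([0,1])$ be real-valued, and let $\sigma:X\to X$ satisfy: (a) $\sigma$ is Gâteaux differentiable, with bounded and locally Lipschitz continuous Gâteaux derivative $\sigma'$ (i.e. $\sigma':X\to\mathscr{L}(X)$ is bounded and, for every $R>0$, Lipschitz continuous on $\{z\in X:\|z\|_X\le R\}$); (b) there exists $\alpha\in(0,1)$ with $\eta+\alpha>1$ such that the restriction of $\sigma$ to $X_\alpha$ maps $X_\alpha$ into itself and is Lipschitz continuous as a map from $X_\alpha$ into itself. Then, for every $\psi\in X_\theta$ with $\theta\ge 0$, $\alpha\ge\theta$ and $\eta>2\alpha-\theta$, there exists a unique mild solution $y$ to the problem $$dy(t)=Ay(t)\,dt+\sigma(y(t))\,dx(t),\quad t\in(0,1],\qquad y(0)=\psi,$$ which belongs to $Y^\alpha_{\theta-\alpha}(0,1)$.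
   Context: Standing assumptions. $X$ is a Banach space and $A:D(A)\subset X\to X$ is the generator of a semigroup $(S(t))_{t\ge0}$ of bounded linear operators on $X$ ($S(0)=I$, $S(t+s)=S(t)S(s)$; continuity of $t\mapsto S(t)x$ at $t=0$ is not required). For every $\lambda\in[0,2)$ there is a Banach space $X_\lambda$, with $X_0=X$ and $X_1=D(A)$, such that $X_\lambda$ is continuously embedded in $X_\beta$ whenever $\beta<\lambda$. For every $T>0$, every $0\le\zeta\le\lambda<2$ and every $\mu,\nu\in[0,1]$ with $\mu>\nu$ there are constants $L_{\zeta,\lambda,T},C_{\mu,\nu,T}>0$ with $\|S(t)\|_{\mathscr{L}(X_\zeta,X_\lambda)}\le L_{\zeta,\lambda,T}t^{-\lambda+\zeta}$ and $\|S(t)-I\|_{\mathscr{L}(X_\mu,X_\nu)}\le C_{\mu,\nu,T}t^{\mu-\nu}$ for every $t\in(0,T]$. Each $S(t)$, $t\ge0$, is injective. Notation. $[a,b]^n_<=\{a\le t_1\le\dots\le t_n\le b\}$, $(a,b]^n_<=\{a<t_1\le\dots\le t_n\le b\}$; $(\hat\delta_1f)(s,t)=f(t)-S(t-s)f(s)$. For $\beta,\gamma\ge0$: $\mathscr{C}^\beta([a,b]^2_<;X_\lambda)$ is the set of continuous $f:[a,b]^2_<\to X_\lambda$ with $f(s,s)=0$ for all $s$ and $\sup_{a\le s<t\le b}\|f(s,t)\|_{X_\lambda}(t-s)^{-\beta}<\infty$; $\mathscr{C}_{-\gamma}((a,b];X_\lambda)$ is the set of continuous $f:(a,b]\to X_\lambda$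 with $\sup_{t\in(a,b]}(t-a)^\gamma\|f(t)\|_{X_\lambda}<\infty$, and $C_b((a,b];X_\lambda)=\mathscr{C}_0((a,b];X_\lambda)$; $\mathscr{C}^\beta_{-\gamma}((a,b]^2_<;X_\lambda)$ is the set of continuous $f:(a,b]^2_<\to X_\lambda$ with $f(s,s)=0$ for all $s$ and $\sup_{a<s<t\le b}(s-a)^\gamma\|f(s,t)\|_{X_\lambda}(t-s)^{-\beta}<\infty$; the suprema are the norms. For $\alpha>0$, $\gamma\ge0$, $Y^\alpha_{-\gamma}(0,1)$ is the set of functions $f:[0,1]\to X$ whose restriction to $(0,1]$ belongs to $\mathscr{C}_{-\gamma}((0,1];X_\alpha)\cap C_b((0,1];X)$ and such that $\hat\delta_1f\in\mathscr{C}^\alpha([0,1]^2_<;X_\alpha)$; its norm is the sum of the three corresponding norms. Thus $Y^\alpha_{\theta-\alpha}(0,1)$ is this space with $\gamma=\alpha-\theta$. Convolution integral. Let $x\in C^\eta([a,b])$ and $\varphi:(a,b]\to X$. The convolution integral $\mathscr{I}_{S,\varphi}$ is well defined if there are $\alpha',\beta'\in[0,2)$ with $0\le\alpha'-\beta'<1$, $\rho\in(1-\eta,1)$ and $\gamma'\in[0,\eta\wedge(\rho+\eta+\beta'-\alpha'))$ with $\varphi\in\mathscr{C}_{-\gamma'}((a,b];X_{\alpha'})$ and $\hat\delta_1\varphi\in\mathscr{C}^\rho_{-\gamma'}((a,b]^2_<;X_{\beta'})$. In this case there is a unique $M:(a,b]^2_<\to X$ that belongs to $\mathscr{C}^{\eta+\rho}([a+\vartheta,b]^2_<;X_{\beta'})$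 for every $\vartheta\in(0,b-a)$ and satisfies $M(r,t)-M(s,t)-S(t-s)M(r,s)=-(x(t)-x(s))S(t-s)(\hat\delta_1\varphi)(r,s)$ on $(a,b]^3_<$; one sets $\mathscr{I}_{S,\varphi}(s,t)=\int_s^tS(t-r)\varphi(r)\,dx(r):=(x(t)-x(s))S(t-s)\varphi(s)-M(s,t)$ on $(a,b]^2_<$, extended by continuity (in $X$) to $[a,b]^2_<$. Mild solution. A mild solution on $[0,1]$ is a function $y:[0,1]\to X$ such that $\mathscr{I}_{S,\sigma\circ y}$ is well defined on $[0,1]^2_<$ and $y(t)=S(t)\psi+\mathscr{I}_{S,\sigma\circ y}(0,t)$ for every $t\in[0,1]$. *)

theory Defs
  imports "HOL-Analysis.Analysis"
begin

section \<open>Banach spaces carried by a subspace, and scales of them\<close>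

text \<open>
  A Banach space continuously embedded in an ambient space is represented by its underlying set
  \<open>V\<close> and its norm \<open>n\<close>. The values of \<open>n\<close> outside \<open>V\<close> are irrelevant.
\<close>

definition banach_on :: "'a::real_vector set \<Rightarrow> ('a \<Rightarrow> real) \<Rightarrow> bool" where
  "banach_on V n \<longleftrightarrow>
     subspace V \<and>
     (\<forall>u\<in>V. 0 \<le> n u \<and> (n u = 0 \<longleftrightarrow> u = 0)) \<and>
     (\<forall>u\<in>V. \<forall>c. n (c *\<^sub>R u) = \<bar>c\<bar> * n u) \<and>
     (\<forall>u\<in>V. \<forall>v\<in>V. n (u + v) \<le> n u + n v) \<and>
     (\<forall>f::nat \<Rightarrow> 'a. (\<forall>k. f k \<in> V) \<and> (\<forall>e>0. \<exists>m. \<forall>i\<ge>m. \<forall>j\<ge>m. n (f i - f j) < e)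
        \<longrightarrow> (\<exists>l\<in>V. (\<lambda>k. n (f k - l)) \<longlonglongrightarrow> 0))"

definition continuous_on_into ::
    "'p::topological_space set \<Rightarrow> 'a::real_vector set \<Rightarrow> ('a \<Rightarrow> real) \<Rightarrow> ('p \<Rightarrow> 'a) \<Rightarrow> bool" where
  "continuous_on_into P V n f \<longleftrightarrow>
     (\<forall>p\<in>P. f p \<in> V \<and> ((\<lambda>q. n (f q - f p)) \<longlongrightarrow> 0) (at p within P))"

text \<open>
  The semigroup need not be strongly continuous at \<open>0\<close>, so its generator is understood through the
  Laplace transform: \<open>(l - A)\<^sup>-\<^sup>1 f = \<integral>\<^sub>0\<^sup>\<infinity> e\<^sup>-\<^sup>l\<^sup>t S(t) f dt\<close> for all large \<open>l\<close>. For strongly continuous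
  semigroups this is the usual infinitesimal generator. The set \<open>D\<close> is the domain of \<open>A\<close>;
  the values of \<open>A\<close> outside \<open>D\<close> are irrelevant.
\<close>

definition is_generator ::
    "(real \<Rightarrow> 'a::banach \<Rightarrow>\<^sub>L 'a) \<Rightarrow> 'a set \<Rightarrow> ('a \<Rightarrow> 'a) \<Rightarrow> bool" where
  "is_generator S D A \<longleftrightarrow>
     (\<exists>\<omega>::real. \<forall>l>\<omega>. bij_betw (\<lambda>u. l *\<^sub>R u - A u) D UNIV \<and>
        (\<forall>u\<in>D. ((\<lambda>t. exp (- l * t) *\<^sub>R S t (l *\<^sub>R u - A u)) has_integral u) {0..}))"

text \<open>
  \<open>X l\<close> and \<open>N l\<close> are the set and the norm of the intermediate space \<open>X\<^sub>l\<close>, for \<open>0 \<le> l < 2\<close>.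
  The identity \<open>X\<^sub>1 = D(A)\<close> is understood up to equivalence with the graph norm.
\<close>

locale semigroup_scale =
  fixes S :: "real \<Rightarrow> 'a::banach \<Rightarrow>\<^sub>L 'a"
    and D :: "'a set" and A :: "'a \<Rightarrow> 'a"
    and X :: "real \<Rightarrow> 'a set" and N :: "real \<Rightarrow> 'a \<Rightarrow> real"
  assumes S_zero: "S 0 = id_blinfun"
    and S_add: "\<And>s t. 0 \<le> s \<Longrightarrow> 0 \<le> t \<Longrightarrow> S (t + s) = S t o\<^sub>L S s"
    and S_inj: "\<And>t. 0 \<le> t \<Longrightarrow> inj (blinfun_apply (S t))"
    and generator: "is_generator S D A"
    and X_banach: "\<And>l. 0 \<le> l \<Longrightarrow> l < 2 \<Longrightarrow> banach_on (X l) (N l)"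
    and X_0: "X 0 = UNIV" "\<And>u. N 0 u = norm u"
    and X_1: "X 1 = D"
      "\<exists>c>0. \<exists>C. \<forall>u\<in>D. c * (norm u + norm (A u)) \<le> N 1 u \<and> N 1 u \<le> C * (norm u + norm (A u))"
    and X_embed: "\<And>b l. 0 \<le> b \<Longrightarrow> b < l \<Longrightarrow> l < 2 \<Longrightarrow>
      X l \<subseteq> X b \<and> (\<exists>K. \<forall>u\<in>X l. N b u \<le> K * N l u)"
    and S_smoothing: "\<And>T z l. 0 < T \<Longrightarrow> 0 \<le> z \<Longrightarrow> z \<le> l \<Longrightarrow> l < 2 \<Longrightarrow>
      \<exists>L>0. \<forall>t\<in>{0<..T}. \<forall>u\<in>X z. S t u \<in> X l \<and> N l (S t u) \<le> L * t powr (- l + z) * N z u"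
    and S_minus_id: "\<And>T m n. 0 < T \<Longrightarrow> 0 \<le> n \<Longrightarrow> n < m \<Longrightarrow> m \<le> 1 \<Longrightarrow>
      \<exists>C>0. \<forall>t\<in>{0<..T}. \<forall>u\<in>X m. S t u - u \<in> X n \<and> N n (S t u - u) \<le> C * t powr (m - n) * N m u"


section \<open>Function spaces\<close>

text \<open>
  The spaces below depend on the target space \<open>X\<^sub>l\<close> through its set \<open>V\<close> and its norm \<open>n\<close>. Functions on
  an interval or on a simplex are total functions of which only the values there matter.
\<close>

definition holder_on :: "real \<Rightarrow> real set \<Rightarrow> (real \<Rightarrow> real) \<Rightarrow> bool" where
  "holder_on \<eta> I x \<longleftrightarrow> (\<exists>C. \<forall>s\<in>I. \<forall>t\<in>I. \<bar>x t - x s\<bar> \<le> C * \<bar>t - s\<bar> powr \<eta>)"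

text \<open>The simplices \<open>[a,b]\<^sup>2\<^sub><\<close> and \<open>(a,b]\<^sup>2\<^sub><\<close>; both contain the diagonal.\<close>

definition simplex_cc :: "real \<Rightarrow> real \<Rightarrow> (real \<times> real) set" where
  "simplex_cc a b = {(s, t). a \<le> s \<and> s \<le> t \<and> t \<le> b}"

definition simplex_oc :: "real \<Rightarrow> real \<Rightarrow> (real \<times> real) set" where
  "simplex_oc a b = {(s, t). a < s \<and> s \<le> t \<and> t \<le> b}"

definition delta1 ::
    "(real \<Rightarrow> 'a::real_normed_vector \<Rightarrow>\<^sub>L 'a) \<Rightarrow> (real \<Rightarrow> 'a) \<Rightarrow> real \<Rightarrow> real \<Rightarrow> 'a" where
  "delta1 S f s t = f t - S (t - s) (f s)"

text \<open>\<open>\<C>\<^sup>\<beta>([a,b]\<^sup>2\<^sub><; V)\<close>\<close>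

definition C2 ::
    "real \<Rightarrow> real \<Rightarrow> real \<Rightarrow> 'a::real_vector set \<Rightarrow> ('a \<Rightarrow> real) \<Rightarrow> (real \<Rightarrow> real \<Rightarrow> 'a) set" where
  "C2 \<beta> a b V n = {f.
     continuous_on_into (simplex_cc a b) V n (\<lambda>(s, t). f s t) \<and>
     (\<forall>s\<in>{a..b}. f s s = 0) \<and>
     (\<exists>K. \<forall>s t. a \<le> s \<and> s < t \<and> t \<le> b \<longrightarrow> n (f s t) * (t - s) powr (- \<beta>) \<le> K)}"

text \<open>\<open>\<C>\<^sub>-\<^sub>\<gamma>((a,b]; V)\<close>\<close>

definition C1_weighted ::
    "real \<Rightarrow> real \<Rightarrow> real \<Rightarrow> 'a::real_vector set \<Rightarrow> ('a \<Rightarrow> real) \<Rightarrow> (real \<Rightarrow> 'a) set" where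
  "C1_weighted \<gamma> a b V n = {f.
     continuous_on_into {a<..b} V n f \<and>
     (\<exists>K. \<forall>t\<in>{a<..b}. (t - a) powr \<gamma> * n (f t) \<le> K)}"

text \<open>\<open>\<C>\<^sup>\<beta>\<^sub>-\<^sub>\<gamma>((a,b]\<^sup>2\<^sub><; V)\<close>\<close>

definition C2_weighted ::
    "real \<Rightarrow> real \<Rightarrow> real \<Rightarrow> real \<Rightarrow> 'a::real_vector set \<Rightarrow> ('a \<Rightarrow> real) \<Rightarrow> (real \<Rightarrow> real \<Rightarrow> 'a) set" where
  "C2_weighted \<beta> \<gamma> a b V n = {f.
     continuous_on_into (simplex_oc a b) V n (\<lambda>(s, t). f s t) \<and>
     (\<forall>s\<in>{a<..b}. f s s = 0) \<and>
     (\<exists>K. \<forall>s t. a < s \<and> s < t \<and> t \<le> b \<longrightarrow>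
        (s - a) powr \<gamma> * n (f s t) * (t - s) powr (- \<beta>) \<le> K)}"

text \<open>\<open>Y\<^sup>\<alpha>\<^sub>-\<^sub>\<gamma>(0,1)\<close>\<close>

definition Y_space ::
    "(real \<Rightarrow> 'a::banach \<Rightarrow>\<^sub>L 'a) \<Rightarrow> (real \<Rightarrow> 'a set) \<Rightarrow> (real \<Rightarrow> 'a \<Rightarrow> real) \<Rightarrow>
     real \<Rightarrow> real \<Rightarrow> (real \<Rightarrow> 'a) set" where
  "Y_space S X N \<alpha> \<gamma> = {f.
     f \<in> C1_weighted \<gamma> 0 1 (X \<alpha>) (N \<alpha>) \<and>
     f \<in> C1_weighted 0 0 1 (X 0) (N 0) \<and>
     delta1 S f \<in> C2 \<alpha> 0 1 (X \<alpha>) (N \<alpha>)}"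


section \<open>Convolution integral and mild solutions\<close>

definition conv_admissible ::
    "(real \<Rightarrow> 'a::banach \<Rightarrow>\<^sub>L 'a) \<Rightarrow> (real \<Rightarrow> 'a set) \<Rightarrow> (real \<Rightarrow> 'a \<Rightarrow> real) \<Rightarrow>
     real \<Rightarrow> real \<Rightarrow> real \<Rightarrow> (real \<Rightarrow> 'a) \<Rightarrow> real \<Rightarrow> real \<Rightarrow> real \<Rightarrow> real \<Rightarrow> bool" where
  "conv_admissible S X N \<eta> a b \<phi> \<alpha>' \<beta>' \<rho> \<gamma>' \<longleftrightarrow>
     \<alpha>' \<in> {0..<2} \<and> \<beta>' \<in> {0..<2} \<and> 0 \<le> \<alpha>' - \<beta>' \<and> \<alpha>' - \<beta>' < 1 \<and>
     \<rho> \<in> {1 - \<eta><..<1} \<and> \<gamma>' \<in> {0..<min \<eta> (\<rho> + \<eta> + \<beta>' - \<alpha>')} \<and>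
     \<phi> \<in> C1_weighted \<gamma>' a b (X \<alpha>') (N \<alpha>') \<and>
     delta1 S \<phi> \<in> C2_weighted \<rho> \<gamma>' a b (X \<beta>') (N \<beta>')"

definition conv_well_defined ::
    "(real \<Rightarrow> 'a::banach \<Rightarrow>\<^sub>L 'a) \<Rightarrow> (real \<Rightarrow> 'a set) \<Rightarrow> (real \<Rightarrow> 'a \<Rightarrow> real) \<Rightarrow>
     real \<Rightarrow> real \<Rightarrow> real \<Rightarrow> (real \<Rightarrow> 'a) \<Rightarrow> bool" where
  "conv_well_defined S X N \<eta> a b \<phi> \<longleftrightarrow>
     (\<exists>\<alpha>' \<beta>' \<rho> \<gamma>'. conv_admissible S X N \<eta> a b \<phi> \<alpha>' \<beta>' \<rho> \<gamma>')"

definition conv_remainder ::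
    "(real \<Rightarrow> 'a::banach \<Rightarrow>\<^sub>L 'a) \<Rightarrow> (real \<Rightarrow> 'a set) \<Rightarrow> (real \<Rightarrow> 'a \<Rightarrow> real) \<Rightarrow>
     real \<Rightarrow> (real \<Rightarrow> real) \<Rightarrow> real \<Rightarrow> real \<Rightarrow> (real \<Rightarrow> 'a) \<Rightarrow> real \<Rightarrow> real \<Rightarrow>
     (real \<Rightarrow> real \<Rightarrow> 'a) \<Rightarrow> bool" where
  "conv_remainder S X N \<eta> x a b \<phi> \<beta>' \<rho> M \<longleftrightarrow>
     (\<forall>\<theta>\<in>{0<..<b - a}. M \<in> C2 (\<eta> + \<rho>) (a + \<theta>) b (X \<beta>') (N \<beta>')) \<and>
     (\<forall>r s t. a < r \<and> r \<le> s \<and> s \<le> t \<and> t \<le> b \<longrightarrow>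
        M r t - M s t - S (t - s) (M r s)
          = - ((x t - x s) *\<^sub>R S (t - s) (delta1 S \<phi> r s)))"

text \<open>
  \<open>has_conv_integral S X N \<eta> x a b \<phi> J\<close> says that \<open>J\<close> is the convolution integral of \<open>\<phi>\<close> against \<open>x\<close>
  on \<open>[a,b]\<^sup>2\<^sub><\<close>. The continuity clause expresses the extension from \<open>(a,b]\<^sup>2\<^sub><\<close>, which is dense
  in \<open>[a,b]\<^sup>2\<^sub><\<close>, by continuity with respect to the norm of the ambient space.
\<close>

definition has_conv_integral ::
    "(real \<Rightarrow> 'a::banach \<Rightarrow>\<^sub>L 'a) \<Rightarrow> (real \<Rightarrow> 'a set) \<Rightarrow> (real \<Rightarrow> 'a \<Rightarrow> real) \<Rightarrow>
     real \<Rightarrow> (real \<Rightarrow> real) \<Rightarrow> real \<Rightarrow> real \<Rightarrow> (real \<Rightarrow> 'a) \<Rightarrow> (real \<Rightarrow> real \<Rightarrow> 'a) \<Rightarrow> bool" where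
  "has_conv_integral S X N \<eta> x a b \<phi> J \<longleftrightarrow>
     (\<exists>\<alpha>' \<beta>' \<rho> \<gamma>' M.
        conv_admissible S X N \<eta> a b \<phi> \<alpha>' \<beta>' \<rho> \<gamma>' \<and>
        conv_remainder S X N \<eta> x a b \<phi> \<beta>' \<rho> M \<and>
        (\<forall>(s, t)\<in>simplex_oc a b. J s t = (x t - x s) *\<^sub>R S (t - s) (\<phi> s) - M s t)) \<and>
     continuous_on (simplex_cc a b) (\<lambda>(s, t). J s t)"

definition mild_solution ::
    "(real \<Rightarrow> 'a::banach \<Rightarrow>\<^sub>L 'a) \<Rightarrow> (real \<Rightarrow> 'a set) \<Rightarrow> (real \<Rightarrow> 'a \<Rightarrow> real) \<Rightarrow>
     real \<Rightarrow> (real \<Rightarrow> real) \<Rightarrow> ('a \<Rightarrow> 'a) \<Rightarrow> 'a \<Rightarrow> (real \<Rightarrow> 'a) \<Rightarrow> bool" where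
  "mild_solution S X N \<eta> x \<sigma> \<psi> y \<longleftrightarrow>
     conv_well_defined S X N \<eta> 0 1 (\<sigma> \<circ> y) \<and>
     (\<exists>J. has_conv_integral S X N \<eta> x 0 1 (\<sigma> \<circ> y) J \<and>
        (\<forall>t\<in>{0..1}. y t = S t \<psi> + J 0 t))"


section \<open>Gateaux derivative\<close>

definition has_gateaux_derivative ::
    "('a::real_normed_vector \<Rightarrow> 'b::real_normed_vector) \<Rightarrow> ('a \<Rightarrow>\<^sub>L 'b) \<Rightarrow> 'a \<Rightarrow> bool" where
  "has_gateaux_derivative f L u \<longleftrightarrow>
     (\<forall>h. ((\<lambda>\<epsilon>. (f (u + \<epsilon> *\<^sub>R h) - f u) /\<^sub>R \<epsilon>) \<longlongrightarrow> L h) (at 0))"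

end

theory Submission
  imports Defs
begin

text \<open>
  Write \<open>\<gamma> = \<alpha> - \<theta>\<close>. The convolution integral \<open>I(s, t)\<close> is the unique functional with
  \<open>I(r, t) = I(s, t) + S(t - s) I(r, s)\<close> that agrees with \<open>(x(t) - x(s)) S(t - s) \<phi>(s)\<close> up to a
  superlinear error. Bisection turns any such error bound into the quantitative one
  \<open>s powr -\<gamma> * (t - s) powr (\<eta> + \<alpha>)\<close> in the norm of \<open>X\<close>. This gives uniqueness, and also existence:
  for mollified paths the integral is an ordinary one, and the bound applied to differences (with a
  slightly smaller Hoelder exponent) makes these integrals a Cauchy sequence. Splitting \<open>[s, t]\<close>
  geometrically towards \<open>t\<close> trades time regularity for space regularity, and splitting towards \<open>s\<close>
  absorbs the singularity at \<open>0\<close>; the result is \<open>\<parallel>I(s, t)\<parallel>\<^sub>\<alpha> \<le> C (t - s) powr (\<eta> - \<gamma>)\<close>.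
  As \<open>\<eta> - \<gamma> > \<alpha>\<close>, a short step gains a small factor in the \<open>\<alpha>\<close>-Hoelder seminorm. The composition
  with \<open>\<sigma>\<close> grows linearly in that seminorm, so the Picard iterates are bounded on all of \<open>[0, 1]\<close>, and on
  bounded sets it is Lipschitz, so they converge; both follow step by step along a fixed grid, with
  no continuation of local solutions.
\<close>

lemma powr_halves:
  fixes h e :: real
  assumes "0 \<le> h"
  shows "(h / 2 ^ k) powr e = h powr e * (2 powr (- e)) ^ k"
proof -
  have "(h / 2 ^ k) powr e = h powr e / (2 ^ k) powr e"
    using assms by (simp add: powr_divide)
  also have "(2 ^ k :: real) powr e = (2 powr e) ^ k"
    by (simp add: powr_realpow[symmetric] powr_powr mult.commute)
  finally show ?thesis
    by (simp add: powr_minus field_simps)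
qed

lemma two_powr_minus_less_one: "0 < e \<Longrightarrow> (2::real) powr (- e) < 1"
  by (simp add: powr_minus field_simps)

lemma twice_half_powr:
  fixes u r :: real
  assumes "0 \<le> u"
  shows "2 * ((u / 2) powr r) = 2 powr (1 - r) * u powr r"
proof -
  have "(u / 2) powr r = u powr r / 2 powr r"
    by (rule powr_divide)
  moreover have "(2::real) powr (1 - r) = 2 / 2 powr r"
    by (subst powr_diff) simp
  ultimately show ?thesis by simp
qed

context semigroup_scale
begin

lemma
  assumes "0 \<le> l" "l < 2"
  shows N_nonneg: "u \<in> X l \<Longrightarrow> 0 \<le> N l u"
    and N_zero: "N l 0 = 0"
    and N_scale: "u \<in> X l \<Longrightarrow> N l (c *\<^sub>R u) = \<bar>c\<bar> * N l u"
    and N_add_le: "u \<in> X l \<Longrightarrow> v \<in> X l \<Longrightarrow> N l (u + v) \<le> N l u + N l v"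
    and X_diff: "u \<in> X l \<Longrightarrow> v \<in> X l \<Longrightarrow> u - v \<in> X l"
    and X_add: "u \<in> X l \<Longrightarrow> v \<in> X l \<Longrightarrow> u + v \<in> X l"
    and X_scale: "u \<in> X l \<Longrightarrow> c *\<^sub>R u \<in> X l"
    and X_zero: "0 \<in> X l"
    and N_diff_le: "u \<in> X l \<Longrightarrow> v \<in> X l \<Longrightarrow> N l (u - v) \<le> N l u + N l v"
    and N_minus_commute: "u \<in> X l \<Longrightarrow> v \<in> X l \<Longrightarrow> N l (u - v) = N l (v - u)"
proof -
  have *: "subspace (X l)" and B: "\<forall>u\<in>X l. 0 \<le> N l u \<and> (N l u = 0 \<longleftrightarrow> u = 0)"
    "\<forall>u\<in>X l. \<forall>c. N l (c *\<^sub>R u) = \<bar>c\<bar> * N l u" "\<forall>u\<in>X l. \<forall>v\<in>X l. N l (u + v) \<le> N l u + N l v"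
    using X_banach[OF assms] unfolding banach_on_def by simp_all
  show X0: "0 \<in> X l" using * by (simp add: subspace_0)
  show "u \<in> X l \<Longrightarrow> 0 \<le> N l u" using B by blast
  show "N l 0 = 0" using X0 B by auto
  show sc: "u \<in> X l \<Longrightarrow> N l (c *\<^sub>R u) = \<bar>c\<bar> * N l u" for u c using B by blast
  show tr: "u \<in> X l \<Longrightarrow> v \<in> X l \<Longrightarrow> N l (u + v) \<le> N l u + N l v" for u v using B by blast
  show df: "u \<in> X l \<Longrightarrow> v \<in> X l \<Longrightarrow> u - v \<in> X l" for u v using * by (rule subspace_diff)
  show "u \<in> X l \<Longrightarrow> v \<in> X l \<Longrightarrow> u + v \<in> X l" using * by (rule subspace_add)
  show xs: "u \<in> X l \<Longrightarrow> c *\<^sub>R u \<in> X l" for u c using * by (rule subspace_scale)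
  show "u \<in> X l \<Longrightarrow> v \<in> X l \<Longrightarrow> N l (u - v) \<le> N l u + N l v"
    using tr[of u "(- 1) *\<^sub>R v"] xs[of v "- 1"] sc[of v "- 1"] by simp
  show "u \<in> X l \<Longrightarrow> v \<in> X l \<Longrightarrow> N l (u - v) = N l (v - u)"
    using sc[of "u - v" "- 1"] df[of u v] by simp
qed

lemma N_sum_le:
  assumes l: "0 \<le> l" "l < 2" and "finite I" and f: "\<And>i. i \<in> I \<Longrightarrow> f i \<in> X l"
  shows "sum f I \<in> X l \<and> N l (sum f I) \<le> (\<Sum>i\<in>I. N l (f i))"
  using \<open>finite I\<close> f
proof (induction I rule: finite_induct)
  case (insert i I)
  then have "sum f I \<in> X l" "N l (sum f I) \<le> (\<Sum>i\<in>I. N l (f i))" "f i \<in> X l" by auto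
  then show ?case
    using insert N_add_le[OF l, of "f i" "sum f I"] X_add[OF l, of "f i" "sum f I"] by auto
qed (simp add: X_zero[OF l] N_zero[OF l])

lemma X_embed_norm:
  assumes "0 \<le> l" "l < 2"
  obtains K where "0 < K" "\<And>u. u \<in> X l \<Longrightarrow> norm u \<le> K * N l u"
proof (cases "l = 0")
  case True
  then show ?thesis using that[of 1] X_0 by auto
next
  case False
  then obtain K where K: "\<forall>u\<in>X l. N 0 u \<le> K * N l u"
    using X_embed[of 0 l] assms by auto
  have "norm u \<le> (\<bar>K\<bar> + 1) * N l u" if "u \<in> X l" for u
  proof -
    have "norm u \<le> K * N l u" using K that X_0 by auto
    also have "\<dots> \<le> (\<bar>K\<bar> + 1) * N l u"
      by (intro mult_right_mono N_nonneg assms that) auto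
    finally show ?thesis .
  qed
  then show ?thesis using that[of "\<bar>K\<bar> + 1"] by auto
qed

lemma N_limit:
  assumes l: "0 \<le> l" "l < 2" and f: "\<And>k. f k \<in> X l"
    and e: "\<And>k. N l (f (Suc k) - f k) \<le> e k" "summable e" and lim: "f \<longlonglongrightarrow> u"
  shows "u \<in> X l" "(\<lambda>k. N l (f k - u)) \<longlonglongrightarrow> 0"
proof -
  have tel: "N l (f (i + j) - f i) \<le> sum e {i..<i + j}" for i j
  proof (induction j)
    case (Suc j)
    have "N l ((f (i + Suc j) - f (i + j)) + (f (i + j) - f i))
        \<le> N l (f (i + Suc j) - f (i + j)) + N l (f (i + j) - f i)"
      by (intro N_add_le l X_diff f)
    then show ?case using Suc e(1)[of "i + j"] by simp
  qed (simp add: N_zero[OF l])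
  have "\<exists>m. \<forall>i\<ge>m. \<forall>j\<ge>m. N l (f i - f j) < d" if "0 < d" for d
  proof -
    obtain m where m: "\<And>i j. i \<ge> m \<Longrightarrow> norm (sum e {i..<j}) < d"
      using e(2) \<open>0 < d\<close> unfolding summable_Cauchy by blast
    have A: "N l (f j - f i) < d" if "i \<ge> m" "j \<ge> i" for i j
      using tel[of i "j - i"] m[of i j] that by auto
    have "N l (f i - f j) < d" if "i \<ge> m" "j \<ge> m" for i j
      using A[of i j] A[of j i] N_minus_commute[OF l f f, of i j] that by (cases "i \<le> j") auto
    then show ?thesis by blast
  qed
  then obtain v where v: "v \<in> X l" "(\<lambda>k. N l (f k - v)) \<longlonglongrightarrow> 0"
    using X_banach[OF l] f unfolding banach_on_def by (elim conjE) (drule spec[of _ f], auto)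
  obtain K where K: "\<And>u. u \<in> X l \<Longrightarrow> norm u \<le> K * N l u"
    using X_embed_norm[OF l] by blast
  have "(\<lambda>k. f k - v) \<longlonglongrightarrow> 0"
  proof (rule Lim_null_comparison)
    show "\<forall>\<^sub>F k in sequentially. norm (f k - v) \<le> K * N l (f k - v)"
      using K X_diff[OF l f v(1)] by simp
    show "(\<lambda>k. K * N l (f k - v)) \<longlonglongrightarrow> 0"
      using tendsto_mult_right_zero[OF v(2)] .
  qed
  then have "f \<longlonglongrightarrow> v" by (rule LIM_zero_cancel)
  then have "v = u" using lim LIMSEQ_unique by blast
  then show "u \<in> X l" "(\<lambda>k. N l (f k - u)) \<longlonglongrightarrow> 0" using v by auto
qed

lemma N_limit_le:
  assumes l: "0 \<le> l" "l < 2" and f: "\<And>k. f k \<in> X l" "u \<in> X l"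
    and lim: "(\<lambda>k. N l (f k - u)) \<longlonglongrightarrow> 0" and b: "\<And>k. N l (f k) \<le> c"
  shows "N l u \<le> c"
proof -
  have "N l u \<le> c + N l (f k - u)" for k
    using N_diff_le[OF l f(1) X_diff[OF l f], of k k] b[of k] by simp
  moreover have "(\<lambda>k. c + N l (f k - u)) \<longlonglongrightarrow> c + 0"
    by (intro tendsto_intros lim)
  ultimately show ?thesis
    using LIMSEQ_le_const[of "\<lambda>k. c + N l (f k - u)" "c + 0" "N l u"] by auto
qed

lemma N_sums:
  assumes l: "0 \<le> l" "l < 2" and a: "\<And>k. a k \<in> X l" "\<And>k. N l (a k) \<le> c * q ^ k"
    and q: "0 \<le> q" "q < 1" and lim: "a sums u"
  shows "u \<in> X l \<and> N l u \<le> c / (1 - q)"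
proof -
  define f where "f k = sum a {..<k}" for k
  have f: "f k \<in> X l" for k
    unfolding f_def using N_sum_le[OF l] a(1) by blast
  have sm: "(\<lambda>k. c * q ^ k) sums (c * (1 / (1 - q)))"
    using q by (intro sums_mult geometric_sums) auto
  have c: "0 \<le> c" using a[of 0] N_nonneg[OF l, of "a 0"] by simp
  have lim': "f \<longlonglongrightarrow> u" using lim unfolding sums_def f_def .
  have inc: "N l (f (Suc k) - f k) \<le> c * q ^ k" for k using a(2) by (simp add: f_def)
  note L = N_limit[OF l f inc sums_summable[OF sm] lim']
  have "N l (f k) \<le> c / (1 - q)" for k
  proof -
    have "N l (f k) \<le> (\<Sum>i<k. N l (a i))"
      unfolding f_def using N_sum_le[OF l] a(1) by blast
    also have "\<dots> \<le> (\<Sum>i<k. c * q ^ i)" by (intro sum_mono a)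
    also have "\<dots> \<le> c / (1 - q)"
      using sum_le_suminf[OF sums_summable[OF sm], of "{..<k}"] sums_unique[OF sm] c q by simp
    finally show ?thesis .
  qed
  then show ?thesis using N_limit_le[OF l f L(1) L(2)] L(1) by blast
qed

end

section \<open>Sewing in the ambient space\<close>

text \<open>
  The parameter \<open>\<gamma>\<close> stands for \<open>\<alpha> - \<theta>\<close> and \<open>L\<close> bounds all constants of the scale at once. As
  \<open>S\<close> need not be strongly continuous at \<open>0\<close> on \<open>X \<alpha>\<close>, continuity in \<open>X \<alpha>\<close> is obtained from bounds
  in a slightly smaller space \<open>X \<kappa>\<close>.
\<close>

locale young_scale = semigroup_scale S D A X N
  for S :: "real \<Rightarrow> 'a::banach \<Rightarrow>\<^sub>L 'a" and D A X N +
  fixes \<eta> \<alpha> \<gamma> \<kappa> L H :: real and x :: "real \<Rightarrow> real"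
  assumes exps: "0 < \<eta>" "\<eta> < 1" "0 < \<alpha>" "\<alpha> < \<kappa>" "\<kappa> < 1" "1 < \<eta> + \<alpha>" "0 \<le> \<gamma>"
      "\<kappa> + \<gamma> < \<eta> + \<alpha>" "\<gamma> + \<alpha> < \<eta>"
    and L_ge: "1 \<le> L" and H_nonneg: "0 \<le> H"
    and x_holder: "\<And>s t. 0 \<le> s \<Longrightarrow> s \<le> t \<Longrightarrow> t \<le> 1 \<Longrightarrow> \<bar>x t - x s\<bar> \<le> H * (t - s) powr \<eta>"
    and S_bdd: "\<And>t u. 0 \<le> t \<Longrightarrow> t \<le> 1 \<Longrightarrow> norm (S t u) \<le> L * norm u"
    and S_bdd_X: "\<And>l t u. l \<in> {\<alpha>, \<kappa>} \<Longrightarrow> 0 \<le> t \<Longrightarrow> t \<le> 1 \<Longrightarrow> u \<in> X l \<Longrightarrow>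
      S t u \<in> X l \<and> N l (S t u) \<le> L * N l u"
    and S_smooth: "\<And>l t u. l \<in> {\<alpha>, \<kappa>} \<Longrightarrow> 0 < t \<Longrightarrow> t \<le> 1 \<Longrightarrow>
      S t u \<in> X l \<and> N l (S t u) \<le> L * t powr (- l) * norm u"
    and S_smooth_X: "\<And>l t u. l \<in> {\<alpha>, \<kappa>} \<Longrightarrow> 0 < t \<Longrightarrow> t \<le> 1 \<Longrightarrow> u \<in> X \<alpha> \<Longrightarrow>
      N l (S t u) \<le> L * t powr (\<alpha> - l) * N \<alpha> u"
    and S_near_id: "\<And>t u. 0 \<le> t \<Longrightarrow> t \<le> 1 \<Longrightarrow> u \<in> X \<alpha> \<Longrightarrow> norm (S t u - u) \<le> L * t powr \<alpha> * N \<alpha> u"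
    and S_near_id_X: "\<And>t u. 0 \<le> t \<Longrightarrow> t \<le> 1 \<Longrightarrow> u \<in> X \<kappa> \<Longrightarrow>
      u \<in> X \<alpha> \<and> N \<alpha> (S t u - u) \<le> L * t powr (\<kappa> - \<alpha>) * N \<kappa> u"
    and embed: "\<And>u. u \<in> X \<alpha> \<Longrightarrow> norm u \<le> L * N \<alpha> u"
begin

lemma l_range: "l \<in> {\<alpha>, \<kappa>} \<Longrightarrow> 0 \<le> l \<and> l < 2 \<and> \<alpha> \<le> l \<and> l < 1 \<and> l + \<gamma> < \<eta> + \<alpha>"
  using exps by auto

lemma \<alpha>_range: "0 \<le> \<alpha>" "\<alpha> < 2" using exps by auto

lemma S_S: "0 \<le> s \<Longrightarrow> 0 \<le> t \<Longrightarrow> S t (S s u) = S (t + s) u"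
  by (simp add: S_add)

definition germ :: "(real \<Rightarrow> real) \<Rightarrow> (real \<Rightarrow> 'a) \<Rightarrow> real \<Rightarrow> real \<Rightarrow> 'a" where
  "germ z \<phi> s t = (z t - z s) *\<^sub>R S (t - s) (\<phi> s)"

definition chasles :: "real \<Rightarrow> (real \<Rightarrow> real \<Rightarrow> 'a) \<Rightarrow> bool" where
  "chasles T J \<longleftrightarrow> (\<forall>r s t. 0 < r \<and> r \<le> s \<and> s \<le> t \<and> t \<le> T \<longrightarrow> J r t = J s t + S (t - s) (J r s))"

text \<open>
  Neither \<open>K\<close> nor \<open>\<rho>\<close> is controlled, so that the remainder of the convolution integral qualifies
  whatever the admissible parameters that were chosen for it.
\<close>

definition near_germ :: "real \<Rightarrow> (real \<Rightarrow> real) \<Rightarrow> (real \<Rightarrow> 'a) \<Rightarrow> (real \<Rightarrow> real \<Rightarrow> 'a) \<Rightarrow> bool" where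
  "near_germ T z \<phi> J \<longleftrightarrow> (\<forall>a. 0 < a \<and> a \<le> T \<longrightarrow> (\<exists>K \<rho>. 1 < \<rho> \<and>
     (\<forall>s t. a \<le> s \<and> s \<le> t \<and> t \<le> T \<longrightarrow> norm (J s t - germ z \<phi> s t) \<le> K * (t - s) powr \<rho>)))"

text \<open>
  The factor \<open>S w\<close> is carried through the bisection because composing the bounds of \<open>S\<close> at each
  level would cost a factor \<open>L\<close> every time.
\<close>

lemma sewing_bound:
  assumes \<rho>: "1 < \<rho>" "1 < \<rho>'" and B: "0 \<le> B" and ab: "0 \<le> a" "b \<le> 1"
    and small: "\<And>s t. a \<le> s \<Longrightarrow> s \<le> t \<Longrightarrow> t \<le> b \<Longrightarrow> norm (G s t) \<le> K * (t - s) powr \<rho>'"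
    and defect: "\<And>s t w. a \<le> s \<Longrightarrow> s \<le> t \<Longrightarrow> t \<le> b \<Longrightarrow> 0 \<le> w \<Longrightarrow> w + t \<le> 1 \<Longrightarrow>
      norm (S w (G s t - G ((s + t) / 2) t - S ((t - s) / 2) (G s ((s + t) / 2)))) \<le> B * (t - s) powr \<rho>"
    and st: "a \<le> s" "s \<le> t" "t \<le> b"
  shows "norm (G s t) \<le> B / (1 - 2 powr (1 - \<rho>)) * (t - s) powr \<rho>"
proof -
  define q where "q = (2::real) powr (1 - \<rho>)"
  define q' where "q' = (2::real) powr (1 - \<rho>')"
  have q: "0 < q" "q < 1" "0 < q'" "q' < 1"
    using two_powr_minus_less_one[of "\<rho> - 1"] two_powr_minus_less_one[of "\<rho>' - 1"] \<rho>
    by (auto simp: q_def q'_def)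
  have half: "2 * ((u / 2) powr \<rho>) = q * u powr \<rho>" "2 * ((u / 2) powr \<rho>') = q' * u powr \<rho>'"
    if "0 \<le> u" for u
    unfolding q_def q'_def using that by (rule twice_half_powr)+
  have main: "norm (S w (G s t))
      \<le> B * (t - s) powr \<rho> * (\<Sum>i<n. q ^ i) + L * K * (t - s) powr \<rho>' * q' ^ n"
    if "a \<le> s" "s \<le> t" "t \<le> b" "0 \<le> w" "w + t \<le> 1" for s t w n
    using that
  proof (induction n arbitrary: s t w)
    case 0
    have "norm (S w (G s t)) \<le> L * norm (G s t)"
      using 0 ab by (intro S_bdd) auto
    also have "\<dots> \<le> L * (K * (t - s) powr \<rho>')"
      using 0 L_ge by (intro mult_left_mono small) auto
    finally show ?case by (simp add: mult_ac)
  next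
    case (Suc n)
    define m where "m = (s + t) / 2"
    have m: "s \<le> m" "m \<le> t" "(t - s) / 2 = t - m" "t - m = (t - s) / 2" "m - s = (t - s) / 2"
      using Suc.prems by (auto simp: m_def field_simps)
    let ?R = "\<lambda>u. B * u powr \<rho> * (\<Sum>i<n. q ^ i) + L * K * u powr \<rho>' * q' ^ n"
    have eq: "S w (G s t) = S w (G s t - G m t - S (t - m) (G s m)) + S w (G m t) + S (w + (t - m)) (G s m)"
      using m(1,2) Suc.prems by (simp add: blinfun.diff_right S_S)
    have "norm (S w (G s t - G m t - S (t - m) (G s m))) \<le> B * (t - s) powr \<rho>"
      using defect[of s t w] Suc.prems m(1,2) unfolding m_def[symmetric] m(3) by simp
    moreover have "norm (S w (G m t)) \<le> ?R ((t - s) / 2)"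
      using Suc.IH[of m t w] Suc.prems m(1,2) unfolding m(4) by simp
    moreover have "norm (S (w + (t - m)) (G s m)) \<le> ?R ((t - s) / 2)"
      using Suc.IH[of s m "w + (t - m)"] Suc.prems m(1,2) unfolding m(5) by simp
    ultimately have "norm (S w (G s t)) \<le> B * (t - s) powr \<rho> + 2 * ?R ((t - s) / 2)"
      unfolding eq by (smt (verit) norm_triangle_ineq)
    also have "2 * ?R ((t - s) / 2) = B * (2 * ((t - s) / 2) powr \<rho>) * (\<Sum>i<n. q ^ i)
        + L * K * (2 * ((t - s) / 2) powr \<rho>') * q' ^ n"
      by (simp add: algebra_simps)
    also have "B * (t - s) powr \<rho> + \<dots> = B * (t - s) powr \<rho> * (\<Sum>i<Suc n. q ^ i)
        + L * K * (t - s) powr \<rho>' * q' ^ Suc n"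
      unfolding sum.lessThan_Suc_shift half(1)[of "t - s", OF diff_ge_0_iff_ge[THEN iffD2, OF Suc.prems(2)]]
        half(2)[of "t - s", OF diff_ge_0_iff_ge[THEN iffD2, OF Suc.prems(2)]]
      by (simp add: sum_distrib_left[symmetric] distrib_left mult_ac)
    finally show ?case .
  qed
  have bnd: "norm (G s t) \<le> B / (1 - q) * (t - s) powr \<rho> + L * K * (t - s) powr \<rho>' * q' ^ n" for n
  proof -
    have "(\<Sum>i<n. q ^ i) \<le> 1 / (1 - q)"
      using sum_le_suminf[of "\<lambda>i. q ^ i" "{..<n}"] q suminf_geometric[of q] by (simp add: summable_geometric)
    then have "B * (t - s) powr \<rho> * (\<Sum>i<n. q ^ i) \<le> B * (t - s) powr \<rho> * (1 / (1 - q))"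
      using B by (intro mult_left_mono) auto
    then show ?thesis using main[of s t 0 n] st ab S_zero by simp
  qed
  have "(\<lambda>n. B / (1 - q) * (t - s) powr \<rho> + L * K * (t - s) powr \<rho>' * q' ^ n)
      \<longlonglongrightarrow> B / (1 - q) * (t - s) powr \<rho> + L * K * (t - s) powr \<rho>' * 0"
    using q by (intro tendsto_intros LIMSEQ_realpow_zero) auto
  then have "norm (G s t) \<le> B / (1 - q) * (t - s) powr \<rho> + L * K * (t - s) powr \<rho>' * 0"
    by (rule LIMSEQ_le_const) (use bnd in auto)
  then show ?thesis by (simp add: q_def)
qed

lemma germ_bound:
  assumes T: "T \<le> 1" and J: "chasles T J" "near_germ T z \<phi> J"
    and z: "\<And>s t. 0 < s \<Longrightarrow> s \<le> t \<Longrightarrow> t \<le> T \<Longrightarrow> \<bar>z t - z s\<bar> \<le> h * (t - s) powr e" and e: "1 < e + \<alpha>"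
    and h: "0 \<le> h" and P: "0 \<le> P"
    and \<phi>: "\<And>s t. 0 < s \<Longrightarrow> s \<le> t \<Longrightarrow> t \<le> T \<Longrightarrow> norm (delta1 S \<phi> s t) \<le> P * s powr (- \<gamma>) * (t - s) powr \<alpha>"
    and st: "0 < s" "s \<le> t" "t \<le> T"
  shows "norm (J s t - germ z \<phi> s t)
    \<le> L / (1 - 2 powr (1 - (e + \<alpha>))) * h * P * s powr (- \<gamma>) * (t - s) powr (e + \<alpha>)"
proof -
  obtain K \<rho> where K: "1 < \<rho>"
    "\<And>u v. s \<le> u \<Longrightarrow> u \<le> v \<Longrightarrow> v \<le> T \<Longrightarrow> norm (J u v - germ z \<phi> u v) \<le> K * (v - u) powr \<rho>"
    using J(2) st unfolding near_germ_def by (meson order_trans)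
  define G where "G u v = J u v - germ z \<phi> u v" for u v
  define B where "B = L * h * P * s powr (- \<gamma>)"
  have "norm (G s t) \<le> B / (1 - 2 powr (1 - (e + \<alpha>))) * (t - s) powr (e + \<alpha>)"
  proof (rule sewing_bound[OF e K(1), where a = s and b = T and K = K])
    show "0 \<le> B" using L_ge h P by (simp add: B_def)
    fix u v w assume uv: "s \<le> u" "u \<le> v" "v \<le> T" and w: "0 \<le> w" "w + v \<le> 1"
    define m where "m = (u + v) / 2"
    have m: "u \<le> m" "m \<le> v" "m \<le> T" "(v - u) / 2 = v - m" "v - m = (v - u) / 2" "m - u = (v - u) / 2"
      using uv by (auto simp: m_def field_simps)
    have Juv: "J u v = J m v + S (v - m) (J u m)"
      using J(1) m(1,2) uv st unfolding chasles_def by auto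
    have "G u v - G m v - S (v - m) (G u m) = (z v - z m) *\<^sub>R S (v - m) (delta1 S \<phi> u m)"
      using m(1,2) by (simp add: G_def Juv germ_def delta1_def blinfun.diff_right blinfun.add_right
          blinfun.scaleR_right S_S algebra_simps)
    then have "norm (S w (G u v - G m v - S (v - m) (G u m)))
        = \<bar>z v - z m\<bar> * norm (S (w + (v - m)) (delta1 S \<phi> u m))"
      using m(1,2) w by (simp add: blinfun.scaleR_right S_S)
    also have "\<dots> \<le> (h * (v - m) powr e) * (L * (P * s powr (- \<gamma>) * (m - u) powr \<alpha>))"
    proof (intro mult_mono)
      show "\<bar>z v - z m\<bar> \<le> h * (v - m) powr e" using z m(1,2) uv st by auto
      have "norm (S (w + (v - m)) (delta1 S \<phi> u m)) \<le> L * norm (delta1 S \<phi> u m)"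
        using m(1,2) w uv st T by (intro S_bdd) auto
      also have "norm (delta1 S \<phi> u m) \<le> P * u powr (- \<gamma>) * (m - u) powr \<alpha>"
        using \<phi> m(1,2) uv st by auto
      also have "\<dots> \<le> P * s powr (- \<gamma>) * (m - u) powr \<alpha>"
        using uv st exps P by (intro mult_right_mono mult_left_mono powr_mono2') auto
      finally show "norm (S (w + (v - m)) (delta1 S \<phi> u m)) \<le> L * (P * s powr (- \<gamma>) * (m - u) powr \<alpha>)"
        using L_ge by (simp add: mult_left_mono)
    qed (use h in auto)
    also have "\<dots> = B * ((v - u) / 2) powr (e + \<alpha>)"
      unfolding m(5,6) by (simp add: B_def powr_add)
    also have "\<dots> \<le> B * (v - u) powr (e + \<alpha>)"
      using uv e exps L_ge h P by (intro mult_left_mono powr_mono2) (auto simp: B_def)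
    finally show "norm (S w (G u v - G ((u + v) / 2) v - S ((v - u) / 2) (G u ((u + v) / 2))))
        \<le> B * (v - u) powr (e + \<alpha>)"
      unfolding m_def[symmetric] m(4) .
  qed (use K T st in \<open>auto simp: G_def\<close>)
  then show ?thesis by (simp add: G_def B_def mult_ac)
qed

definition tame :: "real \<Rightarrow> real \<Rightarrow> (real \<Rightarrow> 'a) \<Rightarrow> bool" where
  "tame T P \<phi> \<longleftrightarrow>
     (\<forall>t. 0 < t \<and> t \<le> T \<longrightarrow> \<phi> t \<in> X \<alpha> \<and> N \<alpha> (\<phi> t) \<le> P * t powr (- \<gamma>)) \<and>
     (\<forall>s t. 0 < s \<and> s \<le> t \<and> t \<le> T \<longrightarrow>
        norm (delta1 S \<phi> s t) \<le> P * s powr (- \<gamma>) * (t - s) powr \<alpha>)"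

lemma tame_nonneg:
  assumes "tame T P \<phi>" "0 < T"
  shows "0 \<le> P"
proof -
  have "0 \<le> N \<alpha> (\<phi> T)" "N \<alpha> (\<phi> T) \<le> P * T powr (- \<gamma>)"
    using assms N_nonneg[OF \<alpha>_range] unfolding tame_def by auto
  then show ?thesis using assms(2) by (smt (verit) powr_gt_zero zero_le_mult_iff)
qed

definition C_germ :: real where
  "C_germ = L / (1 - 2 powr (1 - (\<eta> + \<alpha>))) * H"

definition C_in :: real where
  "C_in = (L * H + L * C_germ) / (1 - 2 powr (- (\<eta> + \<alpha> - \<kappa>)))"

definition C_open :: real where
  "C_open = L * C_in / (1 - 2 powr (- (\<eta> + \<alpha> - \<gamma> - \<kappa>)))"

lemma C_nonneg: "0 \<le> C_germ" "0 \<le> C_in" "0 \<le> C_open"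
proof -
  have "(2::real) powr (1 - (\<eta> + \<alpha>)) < 1" "2 powr (- (\<eta> + \<alpha> - \<kappa>)) < (1::real)"
    "2 powr (- (\<eta> + \<alpha> - \<gamma> - \<kappa>)) < (1::real)"
    using two_powr_minus_less_one[of "\<eta> + \<alpha> - 1"] two_powr_minus_less_one[of "\<eta> + \<alpha> - \<kappa>"]
      two_powr_minus_less_one[of "\<eta> + \<alpha> - \<gamma> - \<kappa>"] exps by auto
  then show "0 \<le> C_germ" "0 \<le> C_in" "0 \<le> C_open"
    using L_ge H_nonneg unfolding C_germ_def C_in_def C_open_def
    by (auto intro!: divide_nonneg_nonneg mult_nonneg_nonneg add_nonneg_nonneg)
qed

lemma tame_germ_bound:
  assumes "T \<le> 1" "chasles T J" "near_germ T x \<phi> J" "tame T P \<phi>" "0 < s" "s \<le> t" "t \<le> T"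
  shows "norm (J s t - germ x \<phi> s t) \<le> C_germ * P * s powr (- \<gamma>) * (t - s) powr (\<eta> + \<alpha>)"
  unfolding C_germ_def using assms x_holder H_nonneg tame_nonneg[OF assms(4)] exps unfolding tame_def
  by (intro germ_bound[of T J x \<phi> H \<eta> P]) auto

end

section \<open>Regularity of additive functionals in the scale\<close>

lemma tendsto_powr_halves:
  fixes d e :: real
  assumes "0 \<le> d" "0 < e"
  shows "(\<lambda>k. (d / 2 ^ k) powr e) \<longlonglongrightarrow> 0"
proof -
  have "(\<lambda>k. d powr e * (2 powr (- e)) ^ k) \<longlonglongrightarrow> d powr e * 0"
    using two_powr_minus_less_one[OF assms(2)] by (intro tendsto_intros LIMSEQ_realpow_zero) auto
  then show ?thesis using powr_halves[OF assms(1)] by simp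
qed

context young_scale
begin

lemma chasles_self: "chasles T J \<Longrightarrow> 0 < s \<Longrightarrow> s \<le> T \<Longrightarrow> J s s = 0"
  unfolding chasles_def using S_zero by (metis add_cancel_right_left cancel_comm_monoid_add_class.diff_cancel id_blinfun.rep_eq id_apply order_refl)

lemma tame_norm: "tame T P \<phi> \<Longrightarrow> 0 < t \<Longrightarrow> t \<le> T \<Longrightarrow> norm (\<phi> t) \<le> L * (P * t powr (- \<gamma>))"
  using embed[of "\<phi> t"] L_ge unfolding tame_def by (smt (verit) mult_left_mono)

lemma germ_norm:
  assumes "tame T P \<phi>" "0 < s" "s \<le> t" "t \<le> T" "T \<le> 1"
  shows "norm (germ x \<phi> s t) \<le> H * L * L * P * s powr (- \<gamma>) * (t - s) powr \<eta>"
proof -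
  have "norm (germ x \<phi> s t) = \<bar>x t - x s\<bar> * norm (S (t - s) (\<phi> s))" by (simp add: germ_def)
  also have "\<dots> \<le> (H * (t - s) powr \<eta>) * (L * (L * (P * s powr (- \<gamma>))))"
  proof (intro mult_mono)
    have "norm (S (t - s) (\<phi> s)) \<le> L * norm (\<phi> s)" using assms by (intro S_bdd) auto
    also have "\<dots> \<le> L * (L * (P * s powr (- \<gamma>)))"
      using assms L_ge by (intro mult_left_mono tame_norm[of T]) auto
    finally show "norm (S (t - s) (\<phi> s)) \<le> L * (L * (P * s powr (- \<gamma>)))" .
  qed (use x_holder assms H_nonneg in auto)
  finally show ?thesis by (simp add: mult_ac)
qed

text \<open>
  The interval is split at points that accumulate geometrically at \<open>t\<close>.
\<close>

lemma regularity_away_from_zero: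
  assumes l: "l \<in> {\<alpha>, \<kappa>}" and *: "T \<le> 1" "chasles T J" "near_germ T x \<phi> J" "tame T P \<phi>"
    and st: "0 < s" "s < t" "t \<le> T"
  shows "J s t \<in> X l \<and> N l (J s t) \<le> C_in * P * s powr (- \<gamma>) * (t - s) powr (\<eta> + \<alpha> - l)"
proof -
  define q where "q = (2::real) powr (- (\<eta> + \<alpha> - \<kappa>))"
  have q: "0 < q" "q < 1"
    using two_powr_minus_less_one[of "\<eta> + \<alpha> - \<kappa>"] exps by (auto simp: q_def)
  note lr = l_range[OF l]
  have l02: "0 \<le> l" "l < 2" using lr by auto
  have P: "0 \<le> P" using tame_nonneg[OF *(4)] st by simp
  define e where "e = \<eta> + \<alpha> - l"
  have e: "\<eta> + \<alpha> - \<kappa> \<le> e" "0 < e" using l exps lr by (auto simp: e_def)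
  define h where "h k = (t - s) / 2 ^ Suc k" for k
  define \<tau> where "\<tau> k = t - (t - s) / 2 ^ k" for k
  have h: "0 < h k" "2 * h k = t - \<tau> k" "h k = \<tau> (Suc k) - \<tau> k" "\<tau> (Suc k) = t - h k"
    "s \<le> \<tau> k" "\<tau> k < t" "h k \<le> (t - s) / 2 ^ k" "\<tau> k \<le> \<tau> (Suc k)" "h k \<le> 1" "2 * h k \<le> 1" for k
  proof -
    define u where "u = (t - s) / 2 ^ k"
    have p: "0 < u" "u \<le> t - s"
      using st divide_left_mono[of 1 "2 ^ k" "t - s"] by (auto simp: u_def)
    have eqs: "h k = u / 2" "\<tau> (Suc k) = t - u / 2" "\<tau> k = t - u"
      by (simp_all add: h_def \<tau>_def u_def)
    show "0 < h k" "2 * h k = t - \<tau> k" "h k = \<tau> (Suc k) - \<tau> k" "\<tau> (Suc k) = t - h k"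
      "s \<le> \<tau> k" "\<tau> k < t" "h k \<le> (t - s) / 2 ^ k" "\<tau> k \<le> \<tau> (Suc k)" "h k \<le> 1" "2 * h k \<le> 1"
      using p st *(1) unfolding eqs u_def[symmetric] by simp_all
  qed
  define a where "a k = S (h k) (J (\<tau> k) (\<tau> (Suc k)))" for k
  have a: "a k \<in> X l \<and> N l (a k) \<le> (L * H + L * C_germ) * P * s powr (- \<gamma>) * (t - s) powr e * q ^ k" for k
  proof -
    have pw: "h k powr (- l) * h k powr (\<eta> + \<alpha>) = h k powr e" "h k powr \<eta> * h k powr (\<alpha> - l) = h k powr e"
      by (simp_all add: e_def add_diff_eq flip: powr_add)
    define G where "G = J (\<tau> k) (\<tau> (Suc k)) - germ x \<phi> (\<tau> k) (\<tau> (Suc k))"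
    define d where "d = x (\<tau> (Suc k)) - x (\<tau> k)"
    have dec: "s powr (- \<gamma>) \<ge> \<tau> k powr (- \<gamma>)"
      using h(5)[of k] st exps by (intro powr_mono2') auto
    have \<phi>k: "\<phi> (\<tau> k) \<in> X \<alpha>" "N \<alpha> (\<phi> (\<tau> k)) \<le> P * s powr (- \<gamma>)"
      using *(4) h(5,6)[of k] st mult_left_mono[OF dec P] unfolding tame_def
      by (auto intro: order_trans[OF _ mult_left_mono[OF dec P]])
    have G: "norm G \<le> C_germ * P * s powr (- \<gamma>) * h k powr (\<eta> + \<alpha>)"
    proof -
      have "norm G \<le> C_germ * P * \<tau> k powr (- \<gamma>) * (\<tau> (Suc k) - \<tau> k) powr (\<eta> + \<alpha>)"
        unfolding G_def using h(5,6,8)[of k] h(6)[of "Suc k"] st * by (intro tame_germ_bound[of T]) auto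
      also have "\<dots> \<le> C_germ * P * s powr (- \<gamma>) * h k powr (\<eta> + \<alpha>)"
        unfolding h(3)[symmetric] using C_nonneg P dec by (intro mult_mono) auto
      finally show ?thesis .
    qed
    have d: "\<bar>d\<bar> \<le> H * h k powr \<eta>"
      unfolding d_def h(3) using h(5,6,8)[of k] h(6)[of "Suc k"] st * by (intro x_holder) auto
    have eq: "a k = d *\<^sub>R S (2 * h k) (\<phi> (\<tau> k)) + S (h k) G"
      using h(1)[of k] unfolding a_def G_def germ_def d_def h(3)[symmetric]
      by (simp add: blinfun.diff_right blinfun.scaleR_right S_S)
    have Sk: "S (2 * h k) (\<phi> (\<tau> k)) \<in> X l" "S (h k) G \<in> X l"
      using S_smooth[OF l] h(1,9,10)[of k] by auto
    have "N l (S (2 * h k) (\<phi> (\<tau> k))) \<le> L * (2 * h k) powr (\<alpha> - l) * N \<alpha> (\<phi> (\<tau> k))"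
      using S_smooth_X[OF l] h(1,10)[of k] \<phi>k by auto
    also have "\<dots> \<le> L * h k powr (\<alpha> - l) * (P * s powr (- \<gamma>))"
      using L_ge h(1)[of k] lr \<phi>k N_nonneg[OF \<alpha>_range]
      by (intro mult_mono powr_mono2') auto
    finally have 1: "N l (S (2 * h k) (\<phi> (\<tau> k))) \<le> L * h k powr (\<alpha> - l) * (P * s powr (- \<gamma>))" .
    have "N l (S (h k) G) \<le> L * h k powr (- l) * norm G"
      using S_smooth[OF l] h(1,9)[of k] by auto
    also have "\<dots> \<le> L * h k powr (- l) * (C_germ * P * s powr (- \<gamma>) * h k powr (\<eta> + \<alpha>))"
      using L_ge by (intro mult_left_mono G) auto
    also have "\<dots> = L * C_germ * P * s powr (- \<gamma>) * h k powr e"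
      by (simp add: pw(1)[symmetric] mult_ac)
    finally have 2: "N l (S (h k) G) \<le> L * C_germ * P * s powr (- \<gamma>) * h k powr e" .
    have "N l (d *\<^sub>R S (2 * h k) (\<phi> (\<tau> k))) = \<bar>d\<bar> * N l (S (2 * h k) (\<phi> (\<tau> k)))"
      by (intro N_scale l02 Sk)
    also have "\<dots> \<le> (H * h k powr \<eta>) * (L * h k powr (\<alpha> - l) * (P * s powr (- \<gamma>)))"
      using d 1 N_nonneg[OF l02 Sk(1)] H_nonneg by (intro mult_mono) auto
    also have "\<dots> = L * H * P * s powr (- \<gamma>) * h k powr e"
      by (simp add: pw(2)[symmetric] mult_ac)
    finally have "N l (a k) \<le> L * H * P * s powr (- \<gamma>) * h k powr e + L * C_germ * P * s powr (- \<gamma>) * h k powr e"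
      unfolding eq using 2 N_add_le[OF l02 X_scale[OF l02 Sk(1), of d] Sk(2)] by linarith
    also have "\<dots> = (L * H + L * C_germ) * P * s powr (- \<gamma>) * h k powr e" by (simp add: algebra_simps)
    also have "\<dots> \<le> (L * H + L * C_germ) * P * s powr (- \<gamma>) * ((t - s) powr e * q ^ k)"
    proof (intro mult_left_mono)
      have "h k powr e \<le> ((t - s) / 2 ^ k) powr e" using h(1,7)[of k] e by (intro powr_mono2) auto
      also have "\<dots> = (t - s) powr e * (2 powr (- e)) ^ k" using st by (intro powr_halves) auto
      also have "\<dots> \<le> (t - s) powr e * q ^ k"
        unfolding q_def using e by (intro mult_left_mono power_mono powr_mono) auto
      finally show "h k powr e \<le> (t - s) powr e * q ^ k" .
    qed (use L_ge H_nonneg C_nonneg P in auto)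
    finally show ?thesis
      unfolding eq using X_add[OF l02 X_scale[OF l02 Sk(1), of d] Sk(2)] by (simp add: mult_ac)
  qed
  have part: "(\<Sum>i<k. a i) = J s t - J (\<tau> k) t" for k
  proof (induction k)
    case (Suc k)
    have "J (\<tau> k) t = J (\<tau> (Suc k)) t + S (t - \<tau> (Suc k)) (J (\<tau> k) (\<tau> (Suc k)))"
      using *(2) h(5,6,8)[of k] h(6)[of "Suc k"] st unfolding chasles_def by auto
    then show ?case using Suc by (simp add: a_def h(4))
  qed (simp add: \<tau>_def)
  have "(\<lambda>k. J (\<tau> k) t) \<longlonglongrightarrow> 0"
  proof (rule Lim_null_comparison)
    let ?R = "\<lambda>k. H * L * L * P * s powr (- \<gamma>) * ((t - s) / 2 ^ k) powr \<eta>
       + C_germ * P * s powr (- \<gamma>) * ((t - s) / 2 ^ k) powr (\<eta> + \<alpha>)"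
    have "norm (J (\<tau> k) t) \<le> ?R k" for k
    proof -
      have dec: "s powr (- \<gamma>) \<ge> \<tau> k powr (- \<gamma>)"
        using h(5)[of k] st exps by (intro powr_mono2') auto
      have "norm (J (\<tau> k) t) \<le> norm (germ x \<phi> (\<tau> k) t) + norm (J (\<tau> k) t - germ x \<phi> (\<tau> k) t)"
        using norm_triangle_sub by blast
      also have "\<dots> \<le> H * L * L * P * \<tau> k powr (- \<gamma>) * (t - \<tau> k) powr \<eta>
          + C_germ * P * \<tau> k powr (- \<gamma>) * (t - \<tau> k) powr (\<eta> + \<alpha>)"
        using h(5,6)[of k] st * by (intro add_mono germ_norm[of T] tame_germ_bound[of T]) auto
      also have "\<dots> \<le> H * L * L * P * s powr (- \<gamma>) * (t - \<tau> k) powr \<eta>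
          + C_germ * P * s powr (- \<gamma>) * (t - \<tau> k) powr (\<eta> + \<alpha>)"
        using dec H_nonneg L_ge P C_nonneg by (intro add_mono mult_right_mono mult_left_mono) auto
      finally show ?thesis by (simp add: \<tau>_def)
    qed
    then show "\<forall>\<^sub>F k in sequentially. norm (J (\<tau> k) t) \<le> ?R k" by simp
    have "?R \<longlonglongrightarrow> H * L * L * P * s powr (- \<gamma>) * 0 + C_germ * P * s powr (- \<gamma>) * 0"
      using st exps by (intro tendsto_intros tendsto_powr_halves) auto
    then show "?R \<longlonglongrightarrow> 0" by simp
  qed
  then have "(\<lambda>k. J s t - J (\<tau> k) t) \<longlonglongrightarrow> J s t - 0" by (intro tendsto_intros)
  then have "a sums (J s t)" unfolding sums_def part by simp
  then show "J s t \<in> X l \<and> N l (J s t) \<le> C_in * P * s powr (- \<gamma>) * (t - s) powr (\<eta> + \<alpha> - l)"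
    using N_sums[OF l02, of a "(L * H + L * C_germ) * P * s powr (- \<gamma>) * (t - s) powr e" q "J s t"] a q
    unfolding e_def C_in_def q_def[symmetric] by (simp add: mult_ac)
qed

text \<open>
  The interval is split at points that accumulate geometrically at \<open>s\<close>.
\<close>

lemma regularity_open:
  assumes l: "l \<in> {\<alpha>, \<kappa>}" and *: "T \<le> 1" "chasles T J" "near_germ T x \<phi> J" "tame T P \<phi>"
    and st: "0 < s" "s < t" "t \<le> T"
  shows "J s t \<in> X l \<and> N l (J s t) \<le> C_open * P * (t - s) powr (\<eta> + \<alpha> - \<gamma> - l)"
proof -
  define q where "q = (2::real) powr (- (\<eta> + \<alpha> - \<gamma> - \<kappa>))"
  have q: "0 < q" "q < 1"
    using two_powr_minus_less_one[of "\<eta> + \<alpha> - \<gamma> - \<kappa>"] exps by (auto simp: q_def)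
  note lr = l_range[OF l]
  have l02: "0 \<le> l" "l < 2" using lr by auto
  have P: "0 \<le> P" using tame_nonneg[OF *(4)] st by simp
  define e where "e = \<eta> + \<alpha> - \<gamma> - l"
  have e: "\<eta> + \<alpha> - \<gamma> - \<kappa> \<le> e" "0 < e" using l exps lr by (auto simp: e_def)
  define h where "h k = (t - s) / 2 ^ Suc k" for k
  define \<tau> where "\<tau> k = s + (t - s) / 2 ^ k" for k
  have h: "0 < h k" "h k = \<tau> k - \<tau> (Suc k)" "h k \<le> \<tau> (Suc k)"
    "\<tau> k \<le> t" "s < \<tau> k" "h k \<le> (t - s) / 2 ^ k" "\<tau> (Suc k) < \<tau> k" for k
  proof -
    define u where "u = (t - s) / 2 ^ k"
    have p: "0 < u" "u \<le> t - s"
      using st divide_left_mono[of 1 "2 ^ k" "t - s"] by (auto simp: u_def)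
    have eqs: "h k = u / 2" "\<tau> (Suc k) = s + u / 2" "\<tau> k = s + u"
      by (simp_all add: h_def \<tau>_def u_def)
    show "0 < h k" "h k = \<tau> k - \<tau> (Suc k)" "h k \<le> \<tau> (Suc k)"
    "\<tau> k \<le> t" "s < \<tau> k" "h k \<le> (t - s) / 2 ^ k" "\<tau> (Suc k) < \<tau> k"
      using p st *(1) unfolding eqs u_def[symmetric] by simp_all
  qed
  define a where "a k = S (t - \<tau> k) (J (\<tau> (Suc k)) (\<tau> k))" for k
  have a: "a k \<in> X l \<and> N l (a k) \<le> L * C_in * P * (t - s) powr e * q ^ k" for k
  proof -
    have pw: "h k powr (- \<gamma>) * h k powr (\<eta> + \<alpha> - l) = h k powr e"
      by (simp add: e_def add.commute add_diff_eq flip: powr_add)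
    have Jk: "J (\<tau> (Suc k)) (\<tau> k) \<in> X l"
      "N l (J (\<tau> (Suc k)) (\<tau> k)) \<le> C_in * P * \<tau> (Suc k) powr (- \<gamma>) * h k powr (\<eta> + \<alpha> - l)"
      using regularity_away_from_zero[OF l *, of "\<tau> (Suc k)" "\<tau> k"] h(4,7)[of k] h(5)[of "Suc k"] st unfolding h(2)[of k] by auto
    have "N l (a k) \<le> L * N l (J (\<tau> (Suc k)) (\<tau> k))" "a k \<in> X l"
      unfolding a_def using S_bdd_X[OF l _ _ Jk(1), of "t - \<tau> k"] h(4,5)[of k] st *(1) by auto
    note this(1)
    also have "L * N l (J (\<tau> (Suc k)) (\<tau> k)) \<le> L * (C_in * P * \<tau> (Suc k) powr (- \<gamma>) * h k powr (\<eta> + \<alpha> - l))"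
      using L_ge Jk by (intro mult_left_mono) auto
    also have "\<dots> \<le> L * (C_in * P * h k powr (- \<gamma>) * h k powr (\<eta> + \<alpha> - l))"
      using L_ge C_nonneg P h(1,3)[of k] exps by (intro mult_left_mono mult_right_mono powr_mono2') auto
    also have "\<dots> = L * C_in * P * h k powr e"
      by (simp add: pw[symmetric] mult_ac)
    also have "\<dots> \<le> L * C_in * P * ((t - s) powr e * q ^ k)"
    proof (intro mult_left_mono)
      have "h k powr e \<le> ((t - s) / 2 ^ k) powr e" using h(1,6)[of k] e by (intro powr_mono2) auto
      also have "\<dots> = (t - s) powr e * (2 powr (- e)) ^ k" using st by (intro powr_halves) auto
      also have "\<dots> \<le> (t - s) powr e * q ^ k"
        unfolding q_def using e by (intro mult_left_mono power_mono powr_mono) auto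
      finally show "h k powr e \<le> (t - s) powr e * q ^ k" .
    qed (use L_ge C_nonneg P in auto)
    finally show ?thesis using \<open>a k \<in> X l\<close> by (simp add: mult_ac)
  qed
  have part: "(\<Sum>i<k. a i) = J (\<tau> k) t" for k
  proof (induction k)
    case 0
    then show ?case using chasles_self[OF *(2), of t] st by (simp add: \<tau>_def)
  next
    case (Suc k)
    have "J (\<tau> (Suc k)) t = J (\<tau> k) t + S (t - \<tau> k) (J (\<tau> (Suc k)) (\<tau> k))"
      using *(2) h(4,5,7)[of k] h(5)[of "Suc k"] st unfolding chasles_def by auto
    then show ?case using Suc by (simp add: a_def)
  qed
  have "(\<lambda>k. J (\<tau> k) t - J s t) \<longlonglongrightarrow> 0"
  proof (rule Lim_null_comparison)
    let ?R = "\<lambda>k. L * (L * (C_in * P * s powr (- \<gamma>))) * ((t - s) / 2 ^ k) powr \<eta>"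
    have "norm (J (\<tau> k) t - J s t) \<le> ?R k" for k
    proof -
      have "J s t = J (\<tau> k) t + S (t - \<tau> k) (J s (\<tau> k))"
        using *(2) h(4,5)[of k] st unfolding chasles_def by auto
      then have "norm (J (\<tau> k) t - J s t) = norm (S (t - \<tau> k) (J s (\<tau> k)))" by simp
      also have "\<dots> \<le> L * norm (J s (\<tau> k))"
        using h(4,5)[of k] st *(1) by (intro S_bdd) auto
      also have "norm (J s (\<tau> k)) \<le> L * N \<alpha> (J s (\<tau> k))"
        using regularity_away_from_zero[of \<alpha>, OF _ *, of s "\<tau> k"] h(4,5)[of k] st by (intro embed) auto
      also have "N \<alpha> (J s (\<tau> k)) \<le> C_in * P * s powr (- \<gamma>) * (\<tau> k - s) powr \<eta>"
        using regularity_away_from_zero[of \<alpha>, OF _ *, of s "\<tau> k"] h(4,5)[of k] st by auto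
      finally show ?thesis using L_ge by (simp add: \<tau>_def mult_left_mono mult_ac)
    qed
    then show "\<forall>\<^sub>F k in sequentially. norm (J (\<tau> k) t - J s t) \<le> ?R k" by simp
    have "?R \<longlonglongrightarrow> L * (L * (C_in * P * s powr (- \<gamma>))) * 0"
      using st exps by (intro tendsto_intros tendsto_powr_halves) auto
    then show "?R \<longlonglongrightarrow> 0" by simp
  qed
  then have "(\<lambda>k. J (\<tau> k) t) \<longlonglongrightarrow> J s t" by (rule LIM_zero_cancel)
  then have "a sums (J s t)" unfolding sums_def part by simp
  then show "J s t \<in> X l \<and> N l (J s t) \<le> C_open * P * (t - s) powr (\<eta> + \<alpha> - \<gamma> - l)"
    using N_sums[OF l02, of a "L * C_in * P * (t - s) powr e" q "J s t"] a q
    unfolding e_def C_open_def q_def[symmetric] by (simp add: mult_ac)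
qed

end

section \<open>Integrals against smooth paths\<close>

lemma holder_continuous_on:
  fixes f :: "real \<Rightarrow> 'b::real_normed_vector"
  assumes e: "0 < e" and f: "\<And>s t. s \<in> I \<Longrightarrow> t \<in> I \<Longrightarrow> s \<le> t \<Longrightarrow> norm (f t - f s) \<le> K * (t - s) powr e"
  shows "continuous_on I f"
  unfolding continuous_on_def
proof
  fix t assume t: "t \<in> I"
  have "((\<lambda>s. f s - f t) \<longlongrightarrow> 0) (at t within I)"
  proof (rule Lim_null_comparison)
    have "norm (f s - f t) \<le> K * \<bar>s - t\<bar> powr e" if "s \<in> I" for s
      using f[of s t] f[of t s] t that by (cases "s \<le> t") (auto simp: norm_minus_commute abs_if)
    then show "\<forall>\<^sub>F s in at t within I. norm (f s - f t) \<le> K * \<bar>s - t\<bar> powr e"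
      by (auto simp: eventually_at_filter)
    have "((\<lambda>s. K * \<bar>s - t\<bar> powr e) \<longlongrightarrow> K * \<bar>t - t\<bar> powr e) (at t within I)"
      using e by (intro tendsto_intros) auto
    then show "((\<lambda>s. K * \<bar>s - t\<bar> powr e) \<longlongrightarrow> 0) (at t within I)" by simp
  qed
  then show "(f \<longlongrightarrow> f t) (at t within I)" by (rule LIM_zero_cancel)
qed

text \<open>The mean of \<open>x\<close> over \<open>[t, t + h]\<close>, with \<open>x\<close> frozen beyond the end points.\<close>

lemma holder_mollifier:
  fixes x :: "real \<Rightarrow> real"
  assumes H: "0 \<le> H" and e: "0 < e" and h: "0 < h" "h \<le> 1"
    and x: "\<And>s t. 0 \<le> s \<Longrightarrow> s \<le> t \<Longrightarrow> t \<le> 1 \<Longrightarrow> \<bar>x t - x s\<bar> \<le> H * (t - s) powr e"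
  obtains y y' where "continuous_on {0..1} y'"
    "\<And>s t. 0 \<le> s \<Longrightarrow> s \<le> t \<Longrightarrow> t \<le> 1 \<Longrightarrow> (y' has_integral (y t - y s)) {s..t}"
    "\<And>s t. 0 \<le> s \<Longrightarrow> s \<le> t \<Longrightarrow> t \<le> 1 \<Longrightarrow> \<bar>y t - y s\<bar> \<le> H * (t - s) powr e"
    "\<And>t. 0 \<le> t \<Longrightarrow> t \<le> 1 \<Longrightarrow> \<bar>y t - x t\<bar> \<le> H * h powr e"
proof
  define c where "c r = max 0 (min r 1)" for r :: real
  define X where "X r = x (c r)" for r
  have X: "\<bar>X t - X s\<bar> \<le> H * (t - s) powr e" if "s \<le> t" for s t
  proof -
    have "\<bar>X t - X s\<bar> \<le> H * (c t - c s) powr e"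
      unfolding X_def using that by (intro x) (auto simp: c_def)
    also have "\<dots> \<le> H * (t - s) powr e"
      using that H e by (intro mult_left_mono powr_mono2) (auto simp: c_def)
    finally show ?thesis .
  qed
  have cX: "continuous_on I X" for I
    using X by (intro holder_continuous_on[OF e, of _ _ H]) auto
  have cXs: "continuous_on I (\<lambda>u. X (u + t))" for I t
    by (rule continuous_on_compose2[OF cX]) (auto intro!: continuous_intros)
  define y where "y t = integral {0..h} (\<lambda>u. X (u + t)) / h" for t
  define y' where "y' t = (X (t + h) - X t) / h" for t
  define Q where "Q t = integral {0..t} X" for t
  have dQ: "(Q has_vector_derivative X t) (at t within {0..2})" if "t \<in> {0..2}" for t
    unfolding Q_def by (rule integral_has_vector_derivative[OF cX that])
  have yQ: "y t = (Q (t + h) - Q t) / h" if "0 \<le> t" "t \<le> 1" for t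
  proof -
    have "integral {0..h} (\<lambda>u. X (u + t)) = integral {0 + t..h + t} X"
      using integral_shift[of 0 t h X, OF cX] by (simp add: o_def)
    moreover have "integral {0..t} X + integral {t..t + h} X = integral {0..t + h} X"
      using that h by (intro Henstock_Kurzweil_Integration.integral_combine integrable_continuous_interval cX) auto
    ultimately show ?thesis by (simp add: y_def Q_def add.commute)
  qed
  show "continuous_on {0..1} y'"
    unfolding y'_def using h by (intro continuous_intros cXs cX) auto
  show "(y' has_integral (y t - y s)) {s..t}" if "0 \<le> s" "s \<le> t" "t \<le> 1" for s t
  proof -
    have "((\<lambda>t. (Q (t + h) - Q t) / h) has_vector_derivative y' r) (at r within {s..t})" if r: "r \<in> {s..t}" for r
    proof -
      have 1: "(Q has_vector_derivative X r) (at r within {s..t})"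
        by (rule has_vector_derivative_within_subset[OF dQ]) (use r \<open>0 \<le> s\<close> \<open>t \<le> 1\<close> in auto)
      have "((\<lambda>t. t + h) has_vector_derivative 1) (at r within {s..t})"
        by (auto intro!: derivative_eq_intros simp: has_vector_derivative_def)
      moreover have "(Q has_vector_derivative X (r + h)) (at (r + h) within (\<lambda>t. t + h) ` {s..t})"
        by (rule has_vector_derivative_within_subset[OF dQ])
          (use r \<open>0 \<le> s\<close> \<open>t \<le> 1\<close> h in auto)
      ultimately have 2: "((Q \<circ> (\<lambda>t. t + h)) has_vector_derivative 1 *\<^sub>R X (r + h)) (at r within {s..t})"
        by (rule vector_diff_chain_within)
      have "((\<lambda>t. ((Q \<circ> (\<lambda>t. t + h)) t - Q t) / h) has_vector_derivative (1 *\<^sub>R X (r + h) - X r) / h) (at r within {s..t})"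
        by (intro has_vector_derivative_divide has_vector_derivative_diff 1 2)
      then show ?thesis by (simp add: y'_def o_def)
    qed
    from fundamental_theorem_of_calculus[OF \<open>s \<le> t\<close> this]
    show ?thesis using that by (simp add: yQ)
  qed
  show "\<bar>y t - y s\<bar> \<le> H * (t - s) powr e" if "0 \<le> s" "s \<le> t" "t \<le> 1" for s t
  proof -
    have "y t - y s = integral {0..h} (\<lambda>u. X (u + t) - X (u + s)) / h"
      unfolding y_def diff_divide_distrib[symmetric]
      by (subst integral_diff) (auto intro!: integrable_continuous_interval cXs)
    moreover have "\<bar>X (u + t) - X (u + s)\<bar> \<le> H * (t - s) powr e" for u
      using X[of "u + s" "u + t"] that by simp
    then have "norm (integral {0..h} (\<lambda>u. X (u + t) - X (u + s))) \<le> H * (t - s) powr e * (h - 0)"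
      using h by (intro integral_bound continuous_intros cXs) auto
    ultimately show ?thesis using h by (simp add: divide_le_eq mult_ac)
  qed
  show "\<bar>y t - x t\<bar> \<le> H * h powr e" if "0 \<le> t" "t \<le> 1" for t
  proof -
    have "x t = integral {0..h} (\<lambda>u. X t) / h" using that h by (simp add: X_def c_def)
    then have "y t - x t = integral {0..h} (\<lambda>u. X (u + t) - X t) / h"
      unfolding y_def by (subst integral_diff) (auto intro!: integrable_continuous_interval cXs simp: diff_divide_distrib)
    moreover have "norm (integral {0..h} (\<lambda>u. X (u + t) - X t)) \<le> H * h powr e * (h - 0)"
    proof (intro integral_bound continuous_intros cXs)
      fix u assume u: "u \<in> {0..h}"
      have "\<bar>X (u + t) - X t\<bar> \<le> H * (u + t - t) powr e" using u by (intro X) auto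
      also have "\<dots> \<le> H * h powr e" using u H e by (intro mult_left_mono powr_mono2) auto
      finally show "norm (X (u + t) - X t) \<le> H * h powr e" by simp
    qed (use h in auto)
    ultimately show ?thesis using h by (simp add: divide_le_eq mult_ac)
  qed
qed

context young_scale
begin

lemma chasles_diff: "chasles T J \<Longrightarrow> chasles T J' \<Longrightarrow> chasles T (\<lambda>s t. J s t - J' s t)"
  unfolding chasles_def by (metis (no_types, lifting) add_diff_add blinfun.diff_right)

lemma near_germ_diff:
  assumes "near_germ T z \<phi> J" "near_germ T z' \<phi>' J'" "T \<le> 1"
    and eq: "\<And>s t. germ z'' \<phi>'' s t = germ z \<phi> s t - germ z' \<phi>' s t"
  shows "near_germ T z'' \<phi>'' (\<lambda>s t. J s t - J' s t)"
  unfolding near_germ_def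
proof (intro allI impI)
  fix a assume a: "0 < a \<and> a \<le> T"
  obtain K \<rho> where K: "1 < \<rho>"
    "\<And>s t. a \<le> s \<Longrightarrow> s \<le> t \<Longrightarrow> t \<le> T \<Longrightarrow> norm (J s t - germ z \<phi> s t) \<le> K * (t - s) powr \<rho>"
    using assms(1) a unfolding near_germ_def by meson
  obtain K' \<rho>' where K': "1 < \<rho>'"
    "\<And>s t. a \<le> s \<Longrightarrow> s \<le> t \<Longrightarrow> t \<le> T \<Longrightarrow> norm (J' s t - germ z' \<phi>' s t) \<le> K' * (t - s) powr \<rho>'"
    using assms(2) a unfolding near_germ_def by meson
  have "norm (J s t - J' s t - germ z'' \<phi>'' s t) \<le> (\<bar>K\<bar> + \<bar>K'\<bar>) * (t - s) powr (min \<rho> \<rho>')"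
    if "a \<le> s \<and> s \<le> t \<and> t \<le> T" for s t
  proof -
    have "norm (J s t - J' s t - germ z'' \<phi>'' s t)
      = norm ((J s t - germ z \<phi> s t) - (J' s t - germ z' \<phi>' s t))"
      by (simp add: eq algebra_simps)
    also have "\<dots> \<le> norm (J s t - germ z \<phi> s t) + norm (J' s t - germ z' \<phi>' s t)"
      by (rule norm_triangle_ineq4)
    also have "\<dots> \<le> K * (t - s) powr \<rho> + K' * (t - s) powr \<rho>'"
      using that by (intro add_mono K K') auto
    also have "\<dots> \<le> \<bar>K\<bar> * (t - s) powr (min \<rho> \<rho>') + \<bar>K'\<bar> * (t - s) powr (min \<rho> \<rho>')"
      using that a assms(3) by (intro add_mono mult_mono powr_mono') auto
    finally show ?thesis by (simp add: algebra_simps)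
  qed
  then show "\<exists>K \<rho>. 1 < \<rho> \<and> (\<forall>s t. a \<le> s \<and> s \<le> t \<and> t \<le> T \<longrightarrow>
      norm (J s t - J' s t - germ z'' \<phi>'' s t) \<le> K * (t - s) powr \<rho>)"
    using K(1) K'(1) by (intro exI[of _ "\<bar>K\<bar> + \<bar>K'\<bar>"] exI[of _ "min \<rho> \<rho>'"]) auto
qed

lemma smooth_integral:
  assumes \<phi>: "tame 1 P \<phi>" and y': "continuous_on {0..1} y'"
    and y: "\<And>s t. 0 \<le> s \<Longrightarrow> s \<le> t \<Longrightarrow> t \<le> 1 \<Longrightarrow> (y' has_integral (y t - y s)) {s..t}"
  defines "J \<equiv> \<lambda>s t. integral {s..t} (\<lambda>r. y' r *\<^sub>R S (t - r) (\<phi> r))"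
  shows "chasles 1 J" "near_germ 1 y \<phi> J"
proof -
  have P: "0 \<le> P" using tame_nonneg[OF \<phi>] by simp
  have eq: "S (t - r') (\<phi> r') - S (t - r) (\<phi> r) = S (t - r') (delta1 S \<phi> r r')"
    if "r \<le> r'" "r' \<le> t" for r r' t
    using that by (simp add: delta1_def blinfun.diff_right S_S)
  have holder: "norm (S (t - r') (\<phi> r') - S (t - r) (\<phi> r)) \<le> L * (P * s powr (- \<gamma>)) * (r' - r) powr \<alpha>"
    if "0 < s" "s \<le> r" "r \<le> r'" "r' \<le> t" "t \<le> 1" for s r r' t
  proof -
    have "norm (S (t - r') (\<phi> r') - S (t - r) (\<phi> r)) \<le> L * norm (delta1 S \<phi> r r')"
      unfolding eq[OF that(3,4)] using that by (intro S_bdd) auto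
    also have "\<dots> \<le> L * (P * r powr (- \<gamma>) * (r' - r) powr \<alpha>)"
      using \<phi> L_ge that unfolding tame_def by (intro mult_left_mono) auto
    also have "\<dots> \<le> L * (P * s powr (- \<gamma>) * (r' - r) powr \<alpha>)"
      using L_ge P that exps by (intro mult_left_mono mult_right_mono powr_mono2') auto
    finally show ?thesis by (simp add: mult_ac)
  qed
  have cont: "continuous_on {s..t'} (\<lambda>r. S (t - r) (\<phi> r))" if "0 < s" "s \<le> t" "t' \<le> t" "t \<le> 1" for s t t'
    using holder[OF that(1)] that exps by (intro holder_continuous_on[where e = \<alpha> and K = "L * (P * s powr (- \<gamma>))"]) auto
  have contJ: "continuous_on {s..t'} (\<lambda>r. y' r *\<^sub>R S (t - r) (\<phi> r))" if "0 < s" "s \<le> t" "t' \<le> t" "t \<le> 1" for s t t'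
    using that by (intro continuous_intros continuous_on_subset[OF y'] cont) auto
  show "chasles 1 J"
    unfolding chasles_def
  proof (intro allI impI)
    fix r s t :: real assume *: "0 < r \<and> r \<le> s \<and> s \<le> t \<and> t \<le> 1"
    have int: "(\<lambda>v. y' v *\<^sub>R S (s - v) (\<phi> v)) integrable_on {r..s}"
      using * by (intro integrable_continuous_interval contJ) auto
    have "S (t - s) (J r s) = integral {r..s} (blinfun_apply (S (t - s)) \<circ> (\<lambda>v. y' v *\<^sub>R S (s - v) (\<phi> v)))"
      unfolding J_def by (rule integral_linear[OF int, symmetric]) (rule blinfun.bounded_linear_right)
    also have "\<dots> = integral {r..s} (\<lambda>v. y' v *\<^sub>R S (t - v) (\<phi> v))"
      using * by (intro integral_cong) (simp add: blinfun.scaleR_right S_S)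
    finally show "J r t = J s t + S (t - s) (J r s)"
      unfolding J_def using * Henstock_Kurzweil_Integration.integral_combine[of r s t "\<lambda>v. y' v *\<^sub>R S (t - v) (\<phi> v)"]
        integrable_continuous_interval[OF contJ[of r t t]] by (simp add: add.commute)
  qed
  obtain Y where Y: "\<And>r. r \<in> {0..1} \<Longrightarrow> norm (y' r) \<le> Y"
    using compact_imp_bounded[OF compact_continuous_image[OF y' compact_Icc]] unfolding bounded_iff by (metis imageI)
  have Y0: "0 \<le> Y" using Y[of 0] norm_ge_zero[of "y' 0"] by (smt (verit) atLeastAtMost_iff)
  show "near_germ 1 y \<phi> J"
    unfolding near_germ_def
  proof (intro allI impI exI conjI)
    fix a s t :: real assume a: "0 < a \<and> a \<le> 1" and st: "a \<le> s \<and> s \<le> t \<and> t \<le> 1"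
    have "((\<lambda>r. y' r *\<^sub>R S (t - s) (\<phi> s)) has_integral germ y \<phi> s t) {s..t}"
      unfolding germ_def using y[of s t] a st
      by (intro has_integral_linear[OF _ bounded_linear_scaleR_left, unfolded o_def]) auto
    moreover have "((\<lambda>r. y' r *\<^sub>R S (t - r) (\<phi> r)) has_integral J s t) {s..t}"
      unfolding J_def using a st by (intro integrable_integral integrable_continuous_interval contJ) auto
    ultimately have "((\<lambda>r. y' r *\<^sub>R S (t - r) (\<phi> r) - y' r *\<^sub>R S (t - s) (\<phi> s)) has_integral J s t - germ y \<phi> s t) {s..t}"
      by (intro has_integral_diff)
    then have I: "J s t - germ y \<phi> s t = integral {s..t} (\<lambda>r. y' r *\<^sub>R S (t - r) (\<phi> r) - y' r *\<^sub>R S (t - s) (\<phi> s))"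
      by (simp add: integral_unique)
    have "norm (J s t - germ y \<phi> s t) \<le> Y * (L * (P * a powr (- \<gamma>)) * (t - s) powr \<alpha>) * (t - s)"
      unfolding I
    proof (rule integral_bound)
      show "continuous_on {s..t} (\<lambda>r. y' r *\<^sub>R S (t - r) (\<phi> r) - y' r *\<^sub>R S (t - s) (\<phi> s))"
        using a st by (intro continuous_intros contJ continuous_on_subset[OF y']) auto
      fix r assume r: "r \<in> {s..t}"
      have "norm (y' r *\<^sub>R S (t - r) (\<phi> r) - y' r *\<^sub>R S (t - s) (\<phi> s))
          = norm (y' r) * norm (S (t - r) (\<phi> r) - S (t - s) (\<phi> s))"
        by (simp add: scaleR_diff_right[symmetric])
      also have "\<dots> \<le> Y * (L * (P * a powr (- \<gamma>)) * (r - s) powr \<alpha>)"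
        using r a st Y0 by (intro mult_mono Y holder[of a]) auto
      also have "\<dots> \<le> Y * (L * (P * a powr (- \<gamma>)) * (t - s) powr \<alpha>)"
        using r Y0 L_ge P exps by (intro mult_left_mono powr_mono2) auto
      finally show "norm (y' r *\<^sub>R S (t - r) (\<phi> r) - y' r *\<^sub>R S (t - s) (\<phi> s))
        \<le> Y * (L * (P * a powr (- \<gamma>)) * (t - s) powr \<alpha>)" .
    qed (use st in auto)
    then show "norm (J s t - germ y \<phi> s t) \<le> (Y * L * P * a powr (- \<gamma>)) * (t - s) powr (1 + \<alpha>)"
      using st by (cases "s = t") (auto simp: powr_add mult_ac)
  qed (use exps in auto)
qed

end

section \<open>Existence of the Young integral\<close>

lemma le_interpolate:
  fixes u v :: real
  assumes "0 \<le> u" "0 \<le> v" "0 \<le> p" "p \<le> 1" "0 \<le> c" "a \<le> c * u" "a \<le> c * v"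
  shows "a \<le> c * (u powr p * v powr (1 - p))"
proof -
  define m where "m = min u v"
  have "m = m powr p * m powr (1 - p)"
    using assms by (simp flip: powr_add add: m_def)
  also have "\<dots> \<le> u powr p * v powr (1 - p)"
    using assms by (intro mult_mono powr_mono2) (auto simp: m_def)
  finally have "c * m \<le> c * (u powr p * v powr (1 - p))" using assms by (intro mult_left_mono)
  moreover have "a \<le> c * m" using assms by (simp add: m_def min_def)
  ultimately show ?thesis by simp
qed

context young_scale
begin

lemma exists_chasles:
  assumes \<phi>: "tame 1 P \<phi>"
  obtains J where "chasles 1 J" "near_germ 1 x \<phi> J"
proof -
  have P: "0 \<le> P" using tame_nonneg[OF \<phi>] by simp
  define r where "r n = (1 / real (Suc n)) powr \<eta>" for n
  have r0: "0 \<le> r n" for n by (simp add: r_def)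
  have r_lim: "r \<longlonglongrightarrow> 0"
  proof -
    have "(\<lambda>n. (1 / real (Suc n)) powr \<eta>) \<longlonglongrightarrow> 0 powr \<eta>"
      using exps LIMSEQ_inverse_real_of_nat by (intro tendsto_intros) (auto simp: inverse_eq_divide)
    then show ?thesis by (simp add: r_def[abs_def])
  qed
  have r_mono: "r n \<le> r m" if "m \<le> n" for m n
    unfolding r_def using that exps by (intro powr_mono2 divide_left_mono) auto
  have "\<exists>y J. (\<forall>s t. 0 \<le> s \<and> s \<le> t \<and> t \<le> 1 \<longrightarrow> \<bar>y t - y s\<bar> \<le> H * (t - s) powr \<eta>) \<and>
     (\<forall>t. 0 \<le> t \<and> t \<le> 1 \<longrightarrow> \<bar>y t - x t\<bar> \<le> H * r n) \<and> chasles 1 J \<and> near_germ 1 y \<phi> J" for n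
  proof -
    have h: "0 < 1 / real (Suc n)" "1 / real (Suc n) \<le> 1" by auto
    show ?thesis
    proof (rule holder_mollifier[OF H_nonneg exps(1) h x_holder])
      fix y y' assume y: "continuous_on {0..1} y'"
      "\<And>s t. 0 \<le> s \<Longrightarrow> s \<le> t \<Longrightarrow> t \<le> 1 \<Longrightarrow> (y' has_integral (y t - y s)) {s..t}"
      "\<And>s t. 0 \<le> s \<Longrightarrow> s \<le> t \<Longrightarrow> t \<le> 1 \<Longrightarrow> \<bar>y t - y s\<bar> \<le> H * (t - s) powr \<eta>"
      "\<And>t. 0 \<le> t \<Longrightarrow> t \<le> 1 \<Longrightarrow> \<bar>y t - x t\<bar> \<le> H * (1 / real (Suc n)) powr \<eta>"
      then show ?thesis using smooth_integral[OF \<phi> y(1,2)] unfolding r_def by blast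
    qed
  qed
  then obtain y J where
    y: "\<And>n s t. 0 \<le> s \<Longrightarrow> s \<le> t \<Longrightarrow> t \<le> 1 \<Longrightarrow> \<bar>y n t - y n s\<bar> \<le> H * (t - s) powr \<eta>"
      "\<And>n t. 0 \<le> t \<Longrightarrow> t \<le> 1 \<Longrightarrow> \<bar>y n t - x t\<bar> \<le> H * r n"
    and J: "\<And>n. chasles 1 (J n)" "\<And>n. near_germ 1 (y n) \<phi> (J n)"
    by metis
  define e where "e = (1 - \<alpha> + \<eta>) / 2"
  have e: "0 < e" "e < \<eta>" "1 < e + \<alpha>" using exps by (auto simp: e_def field_simps)
  define p where "p = 1 - e / \<eta>"
  have p: "0 < p" using e exps by (simp add: p_def)
  have cauchy: "Cauchy (\<lambda>n. J n s t)" if st: "0 < s" "s \<le> t" "t \<le> 1" for s t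
  proof -
    define c where "c = L / (1 - 2 powr (1 - (e + \<alpha>)))"
    have c: "0 \<le> c" using two_powr_minus_less_one[of "e + \<alpha> - 1"] e L_ge by (simp add: c_def)
    define K where "K = 2 * H * (c * P * s powr (- \<gamma>) + L * norm (\<phi> s))"
    have K: "0 \<le> K" using H_nonneg c P L_ge by (simp add: K_def)
    have bnd: "norm (J n s t - J m s t) \<le> K * (r n + r m) powr p" for n m
    proof -
      define z where "z u = y n u - y m u" for u
      define d where "d = r n + r m"
      have d: "0 \<le> d" using r0 by (simp add: d_def)
      have z: "\<bar>z v - z u\<bar> \<le> 2 * H * d powr p * (v - u) powr e" if uv: "0 \<le> u" "u \<le> v" "v \<le> 1" for u v
      proof -
        have "\<bar>z v - z u\<bar> \<le> (2 * H) * (((v - u) powr \<eta>) powr (e / \<eta>) * d powr (1 - e / \<eta>))"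
        proof (rule le_interpolate)
          show "\<bar>z v - z u\<bar> \<le> 2 * H * (v - u) powr \<eta>"
            using y(1)[of u v n] y(1)[of u v m] uv unfolding z_def by linarith
          have "\<bar>z v - z u\<bar> \<le> \<bar>y n v - x v\<bar> + \<bar>y n u - x u\<bar> + (\<bar>y m v - x v\<bar> + \<bar>y m u - x u\<bar>)"
            unfolding z_def by linarith
          also have "\<dots> \<le> H * r n + H * r n + (H * r m + H * r m)"
            using uv by (intro add_mono y) auto
          finally show "\<bar>z v - z u\<bar> \<le> 2 * H * d" by (simp add: d_def algebra_simps)
        qed (use d e exps H_nonneg in auto)
        also have "((v - u) powr \<eta>) powr (e / \<eta>) = (v - u) powr e"
          using exps by (simp add: powr_powr)
        finally show ?thesis by (simp add: p_def mult_ac)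
      qed
      have n: "near_germ 1 z \<phi> (\<lambda>s t. J n s t - J m s t)"
        by (rule near_germ_diff[OF J(2)[of n] J(2)[of m]])
          (simp_all add: germ_def z_def scaleR_diff_left)
      have "norm (J n s t - J m s t - germ z \<phi> s t)
          \<le> c * (2 * H * d powr p) * P * s powr (- \<gamma>) * (t - s) powr (e + \<alpha>)"
        unfolding c_def
        using st e P H_nonneg z \<phi> unfolding tame_def
        by (intro germ_bound[OF _ chasles_diff[OF J(1) J(1)] n]) auto
      also have "\<dots> \<le> c * (2 * H * d powr p) * P * s powr (- \<gamma>) * 1"
        using st e exps c P H_nonneg by (intro mult_left_mono powr_le1) auto
      finally have 1: "norm (J n s t - J m s t - germ z \<phi> s t) \<le> c * (2 * H * d powr p) * P * s powr (- \<gamma>)"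
        by simp
      have "norm (germ z \<phi> s t) = \<bar>z t - z s\<bar> * norm (S (t - s) (\<phi> s))" by (simp add: germ_def)
      also have "\<dots> \<le> (2 * H * d powr p * (t - s) powr e) * (L * norm (\<phi> s))"
        using st z[of s t] H_nonneg by (intro mult_mono S_bdd) auto
      also have "\<dots> \<le> (2 * H * d powr p * 1) * (L * norm (\<phi> s))"
        using st e exps L_ge H_nonneg by (intro mult_left_mono mult_right_mono powr_le1) auto
      finally have 2: "norm (germ z \<phi> s t) \<le> (2 * H * d powr p) * (L * norm (\<phi> s))" by simp
      have "norm (J n s t - J m s t) \<le> norm (J n s t - J m s t - germ z \<phi> s t) + norm (germ z \<phi> s t)"
        by (metis diff_add_cancel norm_triangle_ineq)
      also have "\<dots> \<le> K * d powr p" using 1 2 by (simp add: K_def algebra_simps)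
      finally show ?thesis by (simp add: d_def)
    qed
    have "(\<lambda>n. K * (r n + r n) powr p) \<longlonglongrightarrow> K * (0 + 0) powr p"
      using p r0 by (intro tendsto_intros r_lim) auto
    then have lim: "(\<lambda>n. K * (r n + r n) powr p) \<longlonglongrightarrow> 0" by simp
    show ?thesis
    proof (rule CauchyI)
      fix \<epsilon> :: real assume "0 < \<epsilon>"
      then obtain M where M: "K * (r M + r M) powr p < \<epsilon>"
        using eventually_happens[OF order_tendstoD(2)[OF lim \<open>0 < \<epsilon>\<close>]] by auto
      have "norm (J m s t - J n s t) < \<epsilon>" if "m \<ge> M" "n \<ge> M" for m n
      proof -
        have "norm (J m s t - J n s t) \<le> K * (r m + r n) powr p" by (rule bnd)
        also have "\<dots> \<le> K * (r M + r M) powr p"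
          using K p r0 r_mono that by (intro mult_left_mono powr_mono2 add_mono) auto
        finally show ?thesis using M by simp
      qed
      then show "\<exists>M. \<forall>m\<ge>M. \<forall>n\<ge>M. norm (J m s t - J n s t) < \<epsilon>" by blast
    qed
  qed
  define I where "I s t = lim (\<lambda>n. J n s t)" for s t
  have I: "(\<lambda>n. J n s t) \<longlonglongrightarrow> I s t" if "0 < s" "s \<le> t" "t \<le> 1" for s t
    unfolding I_def using cauchy[OF that] Cauchy_convergent convergent_LIMSEQ_iff by blast
  show thesis
  proof
    show "chasles 1 I"
      unfolding chasles_def
    proof (intro allI impI)
      fix r s t :: real assume *: "0 < r \<and> r \<le> s \<and> s \<le> t \<and> t \<le> 1"
      have "(\<lambda>n. J n s t + S (t - s) (J n r s)) \<longlonglongrightarrow> I s t + S (t - s) (I r s)"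
        using * by (intro tendsto_intros I) auto
      moreover have "(\<lambda>n. J n s t + S (t - s) (J n r s)) = (\<lambda>n. J n r t)"
        using J(1) * unfolding chasles_def by auto
      ultimately show "I r t = I s t + S (t - s) (I r s)"
        using I[of r t] * LIMSEQ_unique by force
    qed
    define c where "c = L / (1 - 2 powr (1 - (\<eta> + \<alpha>)))"
    have c: "0 \<le> c" using two_powr_minus_less_one[of "\<eta> + \<alpha> - 1"] exps L_ge by (simp add: c_def)
    show "near_germ 1 x \<phi> I"
      unfolding near_germ_def
    proof (intro allI impI exI conjI)
      fix a s t :: real assume a: "0 < a \<and> a \<le> 1" and st: "a \<le> s \<and> s \<le> t \<and> t \<le> 1"
      have yx: "(\<lambda>n. y n u) \<longlonglongrightarrow> x u" if "0 \<le> u" "u \<le> 1" for u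
      proof (rule LIM_zero_cancel, rule Lim_null_comparison)
        show "\<forall>\<^sub>F n in sequentially. norm (y n u - x u) \<le> H * r n"
          using y(2) that by simp
        show "(\<lambda>n. H * r n) \<longlonglongrightarrow> 0" using tendsto_mult_right_zero[OF r_lim] .
      qed
      have "(\<lambda>n. norm (J n s t - germ (y n) \<phi> s t)) \<longlonglongrightarrow> norm (I s t - germ x \<phi> s t)"
        unfolding germ_def using a st by (intro tendsto_intros I yx) auto
      moreover have "norm (J n s t - germ (y n) \<phi> s t) \<le> c * H * P * a powr (- \<gamma>) * (t - s) powr (\<eta> + \<alpha>)" for n
      proof -
        have "norm (J n s t - germ (y n) \<phi> s t) \<le> c * H * P * s powr (- \<gamma>) * (t - s) powr (\<eta> + \<alpha>)"
          unfolding c_def using a st exps P H_nonneg y(1) \<phi> unfolding tame_def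
          by (intro germ_bound[OF _ J]) auto
        also have "\<dots> \<le> c * H * P * a powr (- \<gamma>) * (t - s) powr (\<eta> + \<alpha>)"
          using a st exps P H_nonneg c by (intro mult_left_mono mult_right_mono powr_mono2') auto
        finally show ?thesis .
      qed
      ultimately show "norm (I s t - germ x \<phi> s t) \<le> (c * H * P * a powr (- \<gamma>)) * (t - s) powr (\<eta> + \<alpha>)"
        by (intro LIMSEQ_le_const2) auto
    qed (use exps in auto)
  qed
qed

text \<open>
  \<open>F\<close> plays the role of \<open>t \<mapsto> \<I>\<^sub>S\<^sub>,\<^sub>\<phi>(0, t)\<close>; by additivity \<open>\<I>\<^sub>S\<^sub>,\<^sub>\<phi>(s, t)\<close> is then \<open>delta1 S F s t\<close>.
\<close>

definition young_integral :: "(real \<Rightarrow> 'a) \<Rightarrow> (real \<Rightarrow> 'a) \<Rightarrow> bool" where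
  "young_integral \<phi> F \<longleftrightarrow>
     F 0 = 0 \<and> (\<lambda>k. F (1 / 2 ^ k)) \<longlonglongrightarrow> 0 \<and> near_germ 1 x \<phi> (delta1 S F)"

lemma delta1_chasles:
  "0 \<le> r \<Longrightarrow> r \<le> s \<Longrightarrow> s \<le> t \<Longrightarrow> delta1 S F r t = delta1 S F s t + S (t - s) (delta1 S F r s)"
  by (simp add: delta1_def blinfun.diff_right S_S)

lemma delta1_self: "delta1 S F s s = 0"
  by (simp add: delta1_def S_zero)

lemma chasles_delta1: "chasles T (delta1 S F)"
  unfolding chasles_def using delta1_chasles by auto

lemma near_germ_mono: "near_germ T z \<phi> J \<Longrightarrow> T' \<le> T \<Longrightarrow> near_germ T' z \<phi> J"
  unfolding near_germ_def by (meson order_trans)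

lemma young_integral_diff:
  assumes "young_integral \<phi> F" "young_integral \<phi>' F'"
  shows "young_integral (\<lambda>t. \<phi> t - \<phi>' t) (\<lambda>t. F t - F' t)"
proof -
  have "delta1 S (\<lambda>t. F t - F' t) = (\<lambda>s t. delta1 S F s t - delta1 S F' s t)"
    by (simp add: delta1_def fun_eq_iff blinfun.diff_right)
  moreover have "near_germ 1 x (\<lambda>t. \<phi> t - \<phi>' t) (\<lambda>s t. delta1 S F s t - delta1 S F' s t)"
    using assms unfolding young_integral_def
    by (intro near_germ_diff[of 1 x \<phi> _ x \<phi>']) (auto simp: germ_def blinfun.diff_right scaleR_diff_right)
  moreover have "(\<lambda>k. F (1 / 2 ^ k) - F' (1 / 2 ^ k)) \<longlonglongrightarrow> 0 - 0"
    using assms unfolding young_integral_def by (intro tendsto_diff) auto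
  ultimately show ?thesis using assms by (simp add: young_integral_def)
qed

lemma small_dyadic:
  assumes "0 < (t::real)"
  obtains m where "\<And>k. 1 / 2 ^ (k + m) < t"
proof -
  obtain m where m: "(1 / 2) ^ m < t"
    using real_arch_pow_inv[of t "1 / 2"] assms by auto
  have "1 / 2 ^ (k + m) < t" for k
  proof -
    have "(1 / 2 :: real) ^ (k + m) \<le> (1 / 2) ^ m" by (intro power_decreasing) auto
    then show ?thesis using m by (simp add: power_one_over)
  qed
  then show ?thesis using that by blast
qed

lemma exists_young_integral:
  assumes \<phi>: "tame 1 P \<phi>"
  obtains F where "young_integral \<phi> F"
proof -
  have P: "0 \<le> P" using tame_nonneg[OF \<phi>] by simp
  obtain J where J: "chasles 1 J" "near_germ 1 x \<phi> J" using exists_chasles[OF \<phi>] by blast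
  note reg = regularity_open[OF _ order_refl J \<phi>]
  define e where "e = \<eta> - \<gamma>"
  have e: "0 < e" using exps by (simp add: e_def)
  have Jn: "norm (J s t) \<le> L * (C_open * P) * t powr e" if "0 < s" "s < t" "t \<le> 1" for s t
  proof -
    have "norm (J s t) \<le> L * N \<alpha> (J s t)" using reg[of \<alpha> s t] that by (intro embed) auto
    also have "\<dots> \<le> L * (C_open * P * (t - s) powr e)"
      unfolding e_def using reg[of \<alpha> s t] that L_ge by (intro mult_left_mono) auto
    also have "\<dots> \<le> L * (C_open * P * t powr e)"
      using that L_ge C_nonneg P e by (intro mult_left_mono powr_mono2) (auto simp: e_def)
    finally show ?thesis by (simp add: mult_ac)
  qed
  have conv: "convergent (\<lambda>k. J (1 / 2 ^ k) t)" if t: "0 < t" "t \<le> 1" for t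
  proof -
    obtain m where m: "\<And>k. 1 / 2 ^ (k + m) < t" using small_dyadic[OF t(1)] by blast
    define q where "q = (2::real) powr (- e)"
    have q: "0 < q" "q < 1" using two_powr_minus_less_one[OF e] by (auto simp: q_def)
    define f where "f k = J (1 / 2 ^ (k + m)) t" for k
    have inc: "norm (f (Suc k) - f k) \<le> L * (L * (C_open * P)) * (1 / 2 ^ m) powr e * q ^ k" for k
    proof -
      have r: "(1::real) / 2 ^ (Suc k + m) < 1 / 2 ^ (k + m)" "(0::real) < 1 / 2 ^ (Suc k + m)"
        by (auto simp: field_simps)
      have "f (Suc k) - f k = S (t - 1 / 2 ^ (k + m)) (J (1 / 2 ^ (Suc k + m)) (1 / 2 ^ (k + m)))"
        using J(1)[unfolded chasles_def, rule_format, of "1 / 2 ^ (Suc k + m)" "1 / 2 ^ (k + m)" t] r m[of k] t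
        unfolding f_def by simp
      also have "norm \<dots> \<le> L * norm (J (1 / 2 ^ (Suc k + m)) (1 / 2 ^ (k + m)))"
      proof -
        have "(0::real) < 1 / 2 ^ (k + m)" by simp
        then show ?thesis using m[of k] t by (intro S_bdd) linarith+
      qed
      also have "\<dots> \<le> L * (L * (C_open * P) * (1 / 2 ^ (k + m)) powr e)"
        using L_ge r m[of k] t by (intro mult_left_mono Jn) auto
      also have "(1 / 2 ^ (k + m)) powr e = (1 / 2 ^ m) powr e * q ^ k"
        using powr_halves[of "1 / 2 ^ m" k e] by (simp add: q_def power_add mult.commute)
      finally show ?thesis by (simp add: mult_ac)
    qed
    have "summable (\<lambda>k. L * (L * (C_open * P)) * (1 / 2 ^ m) powr e * q ^ k)"
      using q by (intro summable_mult summable_geometric) auto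
    then have "summable (\<lambda>k. f (Suc k) - f k)"
      by (rule summable_comparison_test'[where N = 0]) (rule inc)
    then have "convergent (\<lambda>n. \<Sum>k<n. f (Suc k) - f k)"
      by (simp add: summable_iff_convergent)
    then have "convergent (\<lambda>n. f n - f 0)" by (simp add: sum_lessThan_telescope)
    then have "convergent (\<lambda>n. f n - f 0 + f 0)" by (intro convergent_add convergent_const)
    then have "convergent f" by simp
    then show ?thesis
      unfolding f_def by (rule convergent_ignore_initial_segment[of "\<lambda>k. J (1 / 2 ^ k) t" m, THEN iffD1])
  qed
  define F where "F t = (if t \<le> 0 then 0 else lim (\<lambda>k. J (1 / 2 ^ k) t))" for t
  have F: "(\<lambda>k. J (1 / 2 ^ k) t) \<longlonglongrightarrow> F t" if "0 < t" "t \<le> 1" for t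
    using conv[OF that] that by (simp add: F_def convergent_LIMSEQ_iff)
  have J_eq: "delta1 S F s t = J s t" if st: "0 < s" "s \<le> t" "t \<le> 1" for s t
  proof -
    obtain m where m: "\<And>k. 1 / 2 ^ (k + m) < s" using small_dyadic[OF st(1)] by blast
    have "(\<lambda>k. J (1 / 2 ^ k) t - S (t - s) (J (1 / 2 ^ k) s)) \<longlonglongrightarrow> F t - S (t - s) (F s)"
      using st by (intro tendsto_intros F) auto
    then have "(\<lambda>k. J (1 / 2 ^ (k + m)) t - S (t - s) (J (1 / 2 ^ (k + m)) s)) \<longlonglongrightarrow> F t - S (t - s) (F s)"
      by (rule LIMSEQ_ignore_initial_segment)
    moreover have "J (1 / 2 ^ (k + m)) t - S (t - s) (J (1 / 2 ^ (k + m)) s) = J s t" for k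
    proof -
      have "J (1 / 2 ^ (k + m)) t = J s t + S (t - s) (J (1 / 2 ^ (k + m)) s)"
        using J(1) m[of k] st unfolding chasles_def by auto
      then show ?thesis by simp
    qed
    ultimately show ?thesis
      by (simp add: delta1_def LIMSEQ_const_iff)
  qed
  have Fn: "norm (F t) \<le> L * (C_open * P) * t powr e" if t: "0 < t" "t \<le> 1" for t
  proof -
    obtain m where m: "\<And>k. 1 / 2 ^ (k + m) < t" using small_dyadic[OF t(1)] by blast
    have "(\<lambda>k. norm (J (1 / 2 ^ (k + m)) t)) \<longlonglongrightarrow> norm (F t)"
      using F[OF t] by (intro tendsto_norm LIMSEQ_ignore_initial_segment)
    then show ?thesis
      by (rule LIMSEQ_le_const2) (use Jn m t in auto)
  qed
  have "young_integral \<phi> F"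
    unfolding young_integral_def
  proof (intro conjI)
    show "F 0 = 0" by (simp add: F_def)
    show "(\<lambda>k. F (1 / 2 ^ k)) \<longlonglongrightarrow> 0"
    proof (rule Lim_null_comparison)
      show "\<forall>\<^sub>F k in sequentially. norm (F (1 / 2 ^ k)) \<le> L * (C_open * P) * (1 / 2 ^ k) powr e"
        using Fn[of "1 / 2 ^ _"] by simp
      have "(\<lambda>k. L * (C_open * P) * (1 / 2 ^ k) powr e) \<longlonglongrightarrow> L * (C_open * P) * 0"
        using e by (intro tendsto_mult_left tendsto_powr_halves) auto
      then show "(\<lambda>k. L * (C_open * P) * (1 / 2 ^ k) powr e) \<longlonglongrightarrow> 0" by simp
    qed
    show "near_germ 1 x \<phi> (delta1 S F)"
      using J(2) J_eq unfolding near_germ_def by (smt (verit, ccfv_threshold))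
  qed
  then show thesis using that by blast
qed

end

section \<open>Continuity of the Young integral\<close>

context young_scale
begin

lemma young_integral_regularity:
  assumes l: "l \<in> {\<alpha>, \<kappa>}" and *: "T \<le> 1" "young_integral \<phi> F" "tame T P \<phi>"
    and st: "0 \<le> s" "s < t" "t \<le> T"
  shows "delta1 S F s t \<in> X l \<and> N l (delta1 S F s t) \<le> C_open * P * (t - s) powr (\<eta> + \<alpha> - \<gamma> - l)"
proof -
  have P: "0 \<le> P" using tame_nonneg[OF *(3)] st by simp
  note lr = l_range[OF l]
  have l02: "0 \<le> l" "l < 2" using lr by auto
  define J where "J = delta1 S F"
  define e where "e = \<eta> + \<alpha> - \<gamma> - l"
  have e: "0 < e" using lr by (simp add: e_def)
  have near: "near_germ T x \<phi> J"
    unfolding J_def using * near_germ_mono by (auto simp: young_integral_def)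
  have pos: "J s t \<in> X l \<and> N l (J s t) \<le> C_open * P * (t - s) powr e" if "0 < s" "s < t" "t \<le> T" for s t
    unfolding e_def using regularity_open[OF l *(1) chasles_delta1 near[unfolded J_def] *(3) that] unfolding J_def .
  have "J 0 t \<in> X l \<and> N l (J 0 t) \<le> C_open * P * t powr e"
  proof -
    obtain m where m: "\<And>k. 1 / 2 ^ (k + m) < t" using small_dyadic[of t] st by auto
    define r where "r k = (1::real) / 2 ^ (k + m)" for k
    have r: "0 < r k" "r (Suc k) < r k" "r k < t" "r k - r (Suc k) \<le> (1 / 2 ^ m) / 2 ^ k" for k
      using m[of k] by (auto simp: r_def field_simps power_add)
    define f where "f k = J (r k) t" for k
    have f: "f k \<in> X l" "N l (f k) \<le> C_open * P * t powr e" for k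
    proof -
      have "f k \<in> X l" "N l (f k) \<le> C_open * P * (t - r k) powr e"
        using pos[of "r k" t] r(1,3)[of k] st unfolding f_def by auto
      moreover have "C_open * P * (t - r k) powr e \<le> C_open * P * t powr e"
        using r(1,3)[of k] e C_nonneg P by (intro mult_left_mono powr_mono2) auto
      ultimately show "f k \<in> X l" "N l (f k) \<le> C_open * P * t powr e" by auto
    qed
    define q where "q = (2::real) powr (- e)"
    have q: "0 < q" "q < 1" using two_powr_minus_less_one[OF e] by (auto simp: q_def)
    have inc: "N l (f (Suc k) - f k) \<le> L * (C_open * P * (1 / 2 ^ m) powr e) * q ^ k" for k
    proof -
      have "f (Suc k) - f k = S (t - r k) (J (r (Suc k)) (r k))"
        unfolding f_def J_def using delta1_chasles[of "r (Suc k)" "r k" t F] r[of k] r[of "Suc k"] by simp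
      also have "N l \<dots> \<le> L * N l (J (r (Suc k)) (r k))"
        using S_bdd_X[OF l] pos[of "r (Suc k)" "r k"] r[of k] r[of "Suc k"] st * by auto
      also have "\<dots> \<le> L * (C_open * P * (r k - r (Suc k)) powr e)"
        using L_ge pos[of "r (Suc k)" "r k"] r[of k] r[of "Suc k"] st by (intro mult_left_mono) auto
      also have "\<dots> \<le> L * (C_open * P * ((1 / 2 ^ m) / 2 ^ k) powr e)"
        using L_ge C_nonneg P r(2,4)[of k] e by (intro mult_left_mono powr_mono2) auto
      also have "((1 / 2 ^ m) / 2 ^ k) powr e = (1 / 2 ^ m) powr e * q ^ k"
        unfolding q_def by (rule powr_halves) auto
      finally show ?thesis by (simp add: mult_ac)
    qed
    have sm: "summable (\<lambda>k. L * (C_open * P * (1 / 2 ^ m) powr e) * q ^ k)"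
      using q by (intro summable_mult summable_geometric) auto
    have "(\<lambda>k. f k - J 0 t) \<longlonglongrightarrow> 0"
    proof (rule Lim_null_comparison)
      have eq: "f k - J 0 t = - S (t - r k) (F (r k))" for k
        using * S_zero unfolding f_def J_def young_integral_def by (simp add: delta1_def)
      show "\<forall>\<^sub>F k in sequentially. norm (f k - J 0 t) \<le> L * norm (F (r k))"
      proof (intro always_eventually allI)
        fix k show "norm (f k - J 0 t) \<le> L * norm (F (r k))"
          unfolding eq norm_minus_cancel using r(1,3)[of k] st *(1) by (intro S_bdd) auto
      qed
      have "(\<lambda>k. F (r k)) \<longlonglongrightarrow> 0"
        unfolding r_def using * by (intro LIMSEQ_ignore_initial_segment[of "\<lambda>k. F (1 / 2 ^ k)"])
          (auto simp: young_integral_def)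
      then show "(\<lambda>k. L * norm (F (r k))) \<longlonglongrightarrow> 0"
        by (intro tendsto_mult_right_zero tendsto_norm_zero)
    qed
    then have lim: "f \<longlonglongrightarrow> J 0 t" by (rule LIM_zero_cancel)
    note Nl = N_limit[OF l02 f(1) inc sm lim]
    show ?thesis using Nl N_limit_le[OF l02 f(1) Nl f(2)] by auto
  qed
  then have "J s t \<in> X l \<and> N l (J s t) \<le> C_open * P * (t - s) powr e"
    using pos[of s t] st by (cases "s = 0") auto
  then show "delta1 S F s t \<in> X l \<and> N l (delta1 S F s t) \<le> C_open * P * (t - s) powr (\<eta> + \<alpha> - \<gamma> - l)"
    by (simp add: J_def e_def)
qed

lemma young_integral_increment:
  assumes *: "young_integral \<phi> F" "tame T P \<phi>" "T \<le> 1" and st: "0 \<le> s" "s \<le> t" "t \<le> T" "t - s \<le> h"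
  shows "delta1 S F s t \<in> X \<alpha> \<and>
    N \<alpha> (delta1 S F s t) \<le> C_open * P * h powr (\<eta> - \<gamma> - \<alpha>) * (t - s) powr \<alpha>"
proof (cases "s = t")
  case False
  have e: "\<eta> + \<alpha> - \<gamma> - \<alpha> = (\<eta> - \<gamma> - \<alpha>) + \<alpha>" by simp
  have "delta1 S F s t \<in> X \<alpha>" "N \<alpha> (delta1 S F s t) \<le> C_open * P * (t - s) powr ((\<eta> - \<gamma> - \<alpha>) + \<alpha>)"
    using young_integral_regularity[of \<alpha> T \<phi> F P s t] * st False unfolding e by auto
  moreover have "C_open * P * (t - s) powr ((\<eta> - \<gamma> - \<alpha>) + \<alpha>) \<le> C_open * P * (h powr (\<eta> - \<gamma> - \<alpha>) * (t - s) powr \<alpha>)"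
    unfolding powr_add using st exps C_nonneg tame_nonneg[OF *(2)] False
    by (intro mult_left_mono mult_right_mono powr_mono2) auto
  ultimately show ?thesis by (simp add: mult_ac)
qed (simp add: delta1_self X_zero[OF \<alpha>_range] N_zero[OF \<alpha>_range])

lemma young_integral_holder:
  assumes "young_integral \<phi> F" "tame 1 P \<phi>" "0 \<le> s" "s \<le> t" "t \<le> 1"
  shows "delta1 S F s t \<in> X \<alpha> \<and> N \<alpha> (delta1 S F s t) \<le> C_open * P * (t - s) powr \<alpha>"
  using young_integral_increment[OF assms(1,2) order_refl assms(3-5), of 1] assms by simp

lemma continuous_on_into_comparison:
  assumes "\<And>p. p \<in> I \<Longrightarrow> f p \<in> X \<alpha>"
    and "\<And>p. p \<in> I \<Longrightarrow> (g p \<longlongrightarrow> 0) (at p within I)"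
    and "\<And>p. p \<in> I \<Longrightarrow> \<forall>\<^sub>F q in at p within I. q \<in> I \<longrightarrow> N \<alpha> (f q - f p) \<le> g p q"
  shows "continuous_on_into I (X \<alpha>) (N \<alpha>) f"
  unfolding continuous_on_into_def
proof (intro ballI conjI)
  fix p assume p: "p \<in> I"
  then show "f p \<in> X \<alpha>" by (rule assms)
  show "((\<lambda>q. N \<alpha> (f q - f p)) \<longlongrightarrow> 0) (at p within I)"
  proof (rule Lim_null_comparison[OF _ assms(2)[OF p]])
    have "\<forall>\<^sub>F q in at p within I. q \<in> I" by (simp add: eventually_at_filter)
    then show "\<forall>\<^sub>F q in at p within I. norm (N \<alpha> (f q - f p)) \<le> g p q"
      using assms(3)[OF p]
      by eventually_elim (use N_nonneg[OF \<alpha>_range] X_diff[OF \<alpha>_range] assms(1) p in auto)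
  qed
qed

lemma continuous_on_into_imp_norm:
  assumes "continuous_on_into I (X \<alpha>) (N \<alpha>) f"
  shows "continuous_on I f"
  unfolding continuous_on_def
proof
  fix p assume p: "p \<in> I"
  have f: "f q \<in> X \<alpha>" if "q \<in> I" for q using assms that unfolding continuous_on_into_def by auto
  have lim: "((\<lambda>q. N \<alpha> (f q - f p)) \<longlongrightarrow> 0) (at p within I)"
    using assms p unfolding continuous_on_into_def by auto
  have "((\<lambda>q. f q - f p) \<longlongrightarrow> 0) (at p within I)"
  proof (rule Lim_null_comparison[OF _ tendsto_mult_right_zero[OF lim]])
    show "\<forall>\<^sub>F q in at p within I. norm (f q - f p) \<le> L * N \<alpha> (f q - f p)"
      using embed X_diff[OF \<alpha>_range] f p by (auto simp: eventually_at_filter)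
  qed
  then show "(f \<longlongrightarrow> f p) (at p within I)" by (rule LIM_zero_cancel)
qed

lemma S_increment:
  assumes u: "0 \<le> u" "u \<le> 1" "0 \<le> u'" "u' \<le> 1" and v: "S (min u u') v \<in> X \<kappa>" "N \<kappa> (S (min u u') v) \<le> B"
  shows "S u' v - S u v \<in> X \<alpha> \<and> N \<alpha> (S u' v - S u v) \<le> L * B * \<bar>u' - u\<bar> powr (\<kappa> - \<alpha>)"
proof -
  have *: "S u' v - S u v \<in> X \<alpha> \<and> N \<alpha> (S u' v - S u v) \<le> L * B * (u' - u) powr (\<kappa> - \<alpha>)"
    if "0 \<le> u" "u \<le> u'" "u' \<le> 1" and v: "S u v \<in> X \<kappa>" "N \<kappa> (S u v) \<le> B" for u u'
  proof -
    have mem: "S u v \<in> X \<alpha>" "S (u' - u) (S u v) \<in> X \<alpha>"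
      using S_near_id_X[of 0 "S u v"] S_bdd_X[of \<alpha> "u' - u" "S u v"] that by auto
    have eq: "S u' v - S u v = S (u' - u) (S u v) - S u v"
      using that by (simp add: S_S)
    also have "N \<alpha> \<dots> \<le> L * (u' - u) powr (\<kappa> - \<alpha>) * N \<kappa> (S u v)"
      using S_near_id_X[of "u' - u" "S u v"] that by auto
    also have "\<dots> \<le> L * (u' - u) powr (\<kappa> - \<alpha>) * B"
      using L_ge v by (intro mult_left_mono) auto
    finally show ?thesis using X_diff[OF \<alpha>_range mem(2,1)] unfolding eq by (simp add: mult_ac)
  qed
  show ?thesis
  proof (cases "u \<le> u'")
    case False
    then have "S u v - S u' v \<in> X \<alpha> \<and> N \<alpha> (S u v - S u' v) \<le> L * B * (u - u') powr (\<kappa> - \<alpha>)"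
      using *[of u' u] u v by (simp add: min_def)
    then show ?thesis
      using False X_scale[OF \<alpha>_range, of "S u v - S u' v" "- 1"] N_scale[OF \<alpha>_range, of "S u v - S u' v" "- 1"] by simp
  qed (use *[of u u'] u v in simp)
qed

lemma orbit_continuous: "continuous_on_into {0<..1} (X \<alpha>) (N \<alpha>) (\<lambda>t. S t v)"
proof (rule continuous_on_into_comparison)
  let ?g = "\<lambda>p q. L * (L * (p / 2) powr (- \<kappa>) * norm v) * \<bar>q - p\<bar> powr (\<kappa> - \<alpha>)"
  fix p :: real assume p: "p \<in> {0<..1}"
  show "S p v \<in> X \<alpha>" using S_smooth[of \<alpha> p v] p by auto
  have "(?g p \<longlongrightarrow> L * (L * (p / 2) powr (- \<kappa>) * norm v) * \<bar>p - p\<bar> powr (\<kappa> - \<alpha>)) (at p within {0<..1})"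
    using exps p by (intro tendsto_intros) auto
  then show "(?g p \<longlongrightarrow> 0) (at p within {0<..1})" by simp
  have bound: "N \<alpha> (S q v - S p v) \<le> ?g p q" if q: "p / 2 < q" "q \<in> {0<..1}" for q
  proof -
    have "N \<kappa> (S (min p q) v) \<le> L * min p q powr (- \<kappa>) * norm v"
      using S_smooth[of \<kappa> "min p q" v] p q by auto
    also have "\<dots> \<le> L * (p / 2) powr (- \<kappa>) * norm v"
      using L_ge p q exps by (intro mult_left_mono mult_right_mono powr_mono2') auto
    finally show ?thesis using S_increment[of p q] S_smooth[of \<kappa> "min p q" v] p q by auto
  qed
  have "\<forall>\<^sub>F q in at p within {0<..1}. p / 2 < q"
    using p by (intro order_tendstoD(1)[OF tendsto_ident_at]) auto
  then show "\<forall>\<^sub>F q in at p within {0<..1}. q \<in> {0<..1} \<longrightarrow> N \<alpha> (S q v - S p v) \<le> ?g p q"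
    by eventually_elim (use bound in blast)
qed

lemma S_continuous_norm:
  assumes f: "continuous_on_into I (X \<alpha>) (N \<alpha>) f" and I: "I \<subseteq> {0..1}"
    and P: "\<And>s t. (s, t) \<in> P \<Longrightarrow> s \<in> I \<and> s \<le> t \<and> t \<le> 1"
  shows "continuous_on P (\<lambda>(s, t). S (t - s) (f s))"
  unfolding continuous_on_def
proof
  fix p assume pP: "p \<in> P"
  then obtain s0 t0 where p: "p = (s0, t0)" "s0 \<in> I" "s0 \<le> t0" "t0 \<le> 1" using P by (cases p) auto
  have fX: "f s \<in> X \<alpha>" if "s \<in> I" for s using f that by (simp add: continuous_on_into_def)
  have S_diff: "norm (S u' v - S u v) \<le> L * (L * \<bar>u' - u\<bar> powr \<alpha> * N \<alpha> v)"
    if "0 \<le> u" "u \<le> 1" "0 \<le> u'" "u' \<le> 1" "v \<in> X \<alpha>" for u u' v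
  proof -
    have *: "norm (S u' v - S u v) \<le> L * (L * (u' - u) powr \<alpha> * N \<alpha> v)"
      if "0 \<le> u" "u \<le> u'" "u' \<le> 1" for u u'
    proof -
      have "S u' v - S u v = S u (S (u' - u) v - v)" using that by (simp add: S_S blinfun.diff_right)
      also have "norm \<dots> \<le> L * norm (S (u' - u) v - v)" using that by (intro S_bdd) auto
      also have "\<dots> \<le> L * (L * (u' - u) powr \<alpha> * N \<alpha> v)"
        using that L_ge \<open>v \<in> X \<alpha>\<close> by (intro mult_left_mono S_near_id) auto
      finally show ?thesis .
    qed
    show ?thesis using *[of u u'] *[of u' u] that
      by (cases "u \<le> u'") (auto simp: abs_if norm_minus_commute)
  qed
  let ?g = "\<lambda>q. L * norm (f (fst q) - f s0) + L * (L * \<bar>snd q - fst q - (t0 - s0)\<bar> powr \<alpha> * N \<alpha> (f s0))"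
  have "((\<lambda>q. (case q of (s, t) \<Rightarrow> S (t - s) (f s)) - S (t0 - s0) (f s0)) \<longlongrightarrow> 0) (at p within P)"
  proof (rule Lim_null_comparison)
    have "norm (S (t - s) (f s) - S (t0 - s0) (f s0)) \<le> ?g (s, t)" if "(s, t) \<in> P" for s t
    proof -
      have r: "0 \<le> s" "0 \<le> s0" using P[OF that] p I by auto
      have "S (t - s) (f s) - S (t0 - s0) (f s0)
          = S (t - s) (f s - f s0) + (S (t - s) (f s0) - S (t0 - s0) (f s0))"
        by (simp add: blinfun.diff_right)
      also have "norm \<dots> \<le> norm (S (t - s) (f s - f s0)) + norm (S (t - s) (f s0) - S (t0 - s0) (f s0))"
        by (rule norm_triangle_ineq)
      also have "\<dots> \<le> ?g (s, t)"
        unfolding fst_conv snd_conv using P[OF that] p r fX by (intro add_mono S_bdd S_diff) auto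
      finally show ?thesis .
    qed
    then show "\<forall>\<^sub>F q in at p within P. norm ((case q of (s, t) \<Rightarrow> S (t - s) (f s)) - S (t0 - s0) (f s0)) \<le> ?g q"
      by (auto simp: eventually_at_filter intro!: always_eventually)
    have F: "((\<lambda>q. f (fst q)) \<longlongrightarrow> f s0) (at p within P)"
    proof -
      have "continuous_on P (\<lambda>q. f (fst q))"
        by (rule continuous_on_compose2[OF continuous_on_into_imp_norm[OF f]]) (use P in \<open>auto intro!: continuous_intros\<close>)
      then show ?thesis using p pP unfolding continuous_on_def by force
    qed
    have "(?g \<longlongrightarrow> L * norm (f s0 - f s0) + L * (L * \<bar>snd p - fst p - (t0 - s0)\<bar> powr \<alpha> * N \<alpha> (f s0))) (at p within P)"
      using exps by (intro tendsto_intros F) (auto intro!: tendsto_fst tendsto_snd)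
    then show "(?g \<longlongrightarrow> 0) (at p within P)" using p by simp
  qed
  then show "((\<lambda>(s, t). S (t - s) (f s)) \<longlongrightarrow> (case p of (s, t) \<Rightarrow> S (t - s) (f s))) (at p within P)"
    unfolding p(1) by (simp add: LIM_zero_cancel)
qed

lemma young_integral_continuous:
  assumes F: "young_integral \<phi> F" and \<phi>: "tame 1 P \<phi>"
  shows "continuous_on_into {0..1} (X \<alpha>) (N \<alpha>) F"
    and "continuous_on_into (simplex_cc 0 1) (X \<alpha>) (N \<alpha>) (\<lambda>(s, t). delta1 S F s t)"
proof -
  have P: "0 \<le> P" using tame_nonneg[OF \<phi>] by simp
  have \<kappa>02: "0 \<le> \<kappa>" "\<kappa> < 2" using exps by auto
  have F0: "F 0 = 0" using F by (simp add: young_integral_def)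
  have Fmem: "F t \<in> X \<kappa> \<and> N \<kappa> (F t) \<le> C_open * P" if "0 \<le> t" "t \<le> 1" for t
  proof (cases "t = 0")
    case True
    then show ?thesis using F0 C_nonneg P X_zero[OF \<kappa>02] N_zero[OF \<kappa>02] by simp
  next
    case False
    then have "F t \<in> X \<kappa>" "N \<kappa> (F t) \<le> C_open * P * t powr (\<eta> + \<alpha> - \<gamma> - \<kappa>)"
      using young_integral_regularity[OF _ order_refl F \<phi>, of \<kappa> 0 t] that F0 by (auto simp: delta1_def)
    moreover have "C_open * P * t powr (\<eta> + \<alpha> - \<gamma> - \<kappa>) \<le> C_open * P * 1"
      using that exps C_nonneg P by (intro mult_left_mono powr_le1) auto
    ultimately show ?thesis by simp
  qed
  have Fmem': "F t \<in> X \<alpha>" if "0 \<le> t" "t \<le> 1" for t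
    using Fmem[OF that] S_near_id_X[of 0 "F t"] by simp
  define m where "m = min \<alpha> (\<kappa> - \<alpha>)"
  have m: "0 < m" "m \<le> \<alpha>" "m \<le> \<kappa> - \<alpha>" using exps by (auto simp: m_def)
  define K where "K = C_open * P + L * (C_open * P)"
  note dmem = young_integral_holder[OF F \<phi>]
  have inc: "N \<alpha> (F t - F s) \<le> K * (t - s) powr m" if "0 \<le> s" "s \<le> t" "t \<le> 1" for s t
  proof -
    have SF: "S (t - s) (F s) - F s \<in> X \<alpha>"
      using that Fmem' S_bdd_X[of \<alpha> "t - s" "F s"] by (intro X_diff[OF \<alpha>_range]) auto
    have "N \<alpha> (F t - F s) = N \<alpha> (delta1 S F s t + (S (t - s) (F s) - F s))"
      by (simp add: delta1_def)
    also have "\<dots> \<le> N \<alpha> (delta1 S F s t) + N \<alpha> (S (t - s) (F s) - F s)"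
      using dmem[OF that] SF by (intro N_add_le[OF \<alpha>_range]) auto
    also have "\<dots> \<le> C_open * P * (t - s) powr \<alpha> + L * (t - s) powr (\<kappa> - \<alpha>) * N \<kappa> (F s)"
      using dmem[OF that] S_near_id_X[of "t - s" "F s"] Fmem[of s] that by (intro add_mono) auto
    also have "\<dots> \<le> C_open * P * (t - s) powr m + L * (t - s) powr m * (C_open * P)"
      using that C_nonneg P L_ge m Fmem[of s] N_nonneg[OF \<kappa>02, of "F s"]
      by (intro add_mono mult_mono powr_mono') auto
    finally show ?thesis by (simp add: K_def algebra_simps)
  qed
  have inc': "F t - F s \<in> X \<alpha> \<and> N \<alpha> (F t - F s) \<le> K * \<bar>t - s\<bar> powr m"
    if "s \<in> {0..1}" "t \<in> {0..1}" for s t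
    using inc[of s t] inc[of t s] N_minus_commute[OF \<alpha>_range Fmem' Fmem', of s t] that
      X_diff[OF \<alpha>_range Fmem' Fmem', of t s] by (cases "s \<le> t") (auto simp: abs_if)
  show "continuous_on_into {0..1} (X \<alpha>) (N \<alpha>) F"
  proof (rule continuous_on_into_comparison)
    fix p :: real assume p: "p \<in> {0..1}"
    then show "F p \<in> X \<alpha>" using Fmem' by auto
    have "((\<lambda>q. K * \<bar>q - p\<bar> powr m) \<longlongrightarrow> K * \<bar>p - p\<bar> powr m) (at p within {0..1})"
      using m by (intro tendsto_intros) auto
    then show "((\<lambda>q. K * \<bar>q - p\<bar> powr m) \<longlongrightarrow> 0) (at p within {0..1})" by simp
    show "\<forall>\<^sub>F q in at p within {0..1}. q \<in> {0..1} \<longrightarrow> N \<alpha> (F q - F p) \<le> K * \<bar>q - p\<bar> powr m"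
      using inc'[OF p] by simp
  qed
  show "continuous_on_into (simplex_cc 0 1) (X \<alpha>) (N \<alpha>) (\<lambda>(s, t). delta1 S F s t)"
  proof (rule continuous_on_into_comparison)
    let ?g = "\<lambda>p q. K * \<bar>snd q - snd p\<bar> powr m + (L * (K * \<bar>fst q - fst p\<bar> powr m) +
        L * (L * (C_open * P)) * \<bar>(snd q - fst q) - (snd p - fst p)\<bar> powr (\<kappa> - \<alpha>))"
    fix p :: "real \<times> real" assume pD: "p \<in> simplex_cc 0 1"
    then obtain s0 t0 where p: "p = (s0, t0)" "0 \<le> s0" "s0 \<le> t0" "t0 \<le> 1"
      by (auto simp: simplex_cc_def)
    show "(case p of (s, t) \<Rightarrow> delta1 S F s t) \<in> X \<alpha>" using p dmem by auto
    have "(?g p \<longlongrightarrow> ?g p p) (at p within simplex_cc 0 1)"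
      using m exps by (intro tendsto_intros) (auto intro!: tendsto_fst tendsto_snd)
    then show "(?g p \<longlongrightarrow> 0) (at p within simplex_cc 0 1)" by simp
    have "N \<alpha> (delta1 S F s t - delta1 S F s0 t0) \<le> ?g p (s, t)" if st: "0 \<le> s" "s \<le> t" "t \<le> 1" for s t
    proof -
      define A where "A = S (t - s) (F s - F s0)"
      define B where "B = S (t - s) (F s0) - S (t0 - s0) (F s0)"
      have dt: "F t - F t0 \<in> X \<alpha>" "N \<alpha> (F t - F t0) \<le> K * \<bar>t - t0\<bar> powr m"
        and ds: "F s - F s0 \<in> X \<alpha>" "N \<alpha> (F s - F s0) \<le> K * \<bar>s - s0\<bar> powr m"
        using inc' p st by auto
      have A: "A \<in> X \<alpha>" "N \<alpha> A \<le> L * (K * \<bar>s - s0\<bar> powr m)"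
        using S_bdd_X[of \<alpha> "t - s", OF _ _ _ ds(1)] st L_ge
        unfolding A_def by (auto intro: order_trans[OF _ mult_left_mono[OF ds(2)]])
      have "N \<kappa> (S u (F s0)) \<le> L * (C_open * P)" "S u (F s0) \<in> X \<kappa>" if "0 \<le> u" "u \<le> 1" for u
        using S_bdd_X[of \<kappa> u "F s0"] Fmem[of s0] p that L_ge
        by (auto intro: order_trans[OF _ mult_left_mono[of "N \<kappa> (F s0)" "C_open * P" L]])
      then have B: "B \<in> X \<alpha>" "N \<alpha> B \<le> L * (L * (C_open * P)) * \<bar>(t - s) - (t0 - s0)\<bar> powr (\<kappa> - \<alpha>)"
        using S_increment[of "t0 - s0" "t - s" "F s0" "L * (C_open * P)"] p st unfolding B_def by (auto simp: min_def)
      have "delta1 S F s t - delta1 S F s0 t0 = (F t - F t0) - (A + B)"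
        by (simp add: A_def B_def delta1_def blinfun.diff_right)
      then show ?thesis
        using N_diff_le[OF \<alpha>_range dt(1) X_add[OF \<alpha>_range A(1) B(1)]] N_add_le[OF \<alpha>_range A(1) B(1)]
          dt(2) A(2) B(2) p by simp
    qed
    then show "\<forall>\<^sub>F q in at p within simplex_cc 0 1. q \<in> simplex_cc 0 1 \<longrightarrow>
        N \<alpha> ((case q of (s, t) \<Rightarrow> delta1 S F s t) - (case p of (s, t) \<Rightarrow> delta1 S F s t)) \<le> ?g p q"
      unfolding p(1) by (intro always_eventually) (auto simp: simplex_cc_def)
  qed
qed

end

section \<open>Composition with the nonlinearity\<close>

locale young_equation = young_scale S D A X N \<eta> \<alpha> \<gamma> \<kappa> L H x
  for S :: "real \<Rightarrow> 'a::banach \<Rightarrow>\<^sub>L 'a" and D A X N \<eta> \<alpha> \<gamma> \<kappa> L H x +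
  fixes \<sigma> :: "'a \<Rightarrow> 'a" and K :: "real \<Rightarrow> real" and \<psi> :: 'a
  assumes sigma_X: "\<And>u. u \<in> X \<alpha> \<Longrightarrow> \<sigma> u \<in> X \<alpha>"
    and sigma_lip_X: "\<And>u v. u \<in> X \<alpha> \<Longrightarrow> v \<in> X \<alpha> \<Longrightarrow> N \<alpha> (\<sigma> u - \<sigma> v) \<le> L * N \<alpha> (u - v)"
    and sigma_lip: "\<And>u v. norm (\<sigma> u - \<sigma> v) \<le> L * norm (u - v)"
    and K_nonneg: "\<And>R. 0 \<le> K R"
    and sigma_second: "\<And>R u u' v v'. norm u \<le> R \<Longrightarrow> norm u' \<le> R \<Longrightarrow> norm v \<le> R \<Longrightarrow> norm v' \<le> R \<Longrightarrow>
      norm ((\<sigma> u' - \<sigma> u) - (\<sigma> v' - \<sigma> v))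
        \<le> L * norm ((u' - u) - (v' - v)) + K R * (norm (u - v) + norm (u' - v')) * norm (v' - v)"
    and psi: "\<And>t. 0 < t \<Longrightarrow> t \<le> 1 \<Longrightarrow> N \<alpha> (S t \<psi>) \<le> L * t powr (- \<gamma>)"
begin

definition mild_holder :: "real \<Rightarrow> real \<Rightarrow> (real \<Rightarrow> 'a) \<Rightarrow> bool" where
  "mild_holder T Q y \<longleftrightarrow> (\<forall>s t. 0 \<le> s \<and> s \<le> t \<and> t \<le> T \<longrightarrow>
     delta1 S y s t \<in> X \<alpha> \<and> N \<alpha> (delta1 S y s t) \<le> Q * (t - s) powr \<alpha>)"

lemma mild_holderD:
  assumes "mild_holder T Q y" "0 \<le> s" "s \<le> t" "t \<le> T"
  shows "delta1 S y s t \<in> X \<alpha>" "N \<alpha> (delta1 S y s t) \<le> Q * (t - s) powr \<alpha>"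
  using assms unfolding mild_holder_def by auto

lemma mild_holder_mono: "mild_holder T Q y \<Longrightarrow> T' \<le> T \<Longrightarrow> Q \<le> Q' \<Longrightarrow> mild_holder T' Q' y"
  unfolding mild_holder_def by (meson mult_right_mono order_trans powr_ge_zero)

lemma powr_minus_ge_one: "0 < t \<Longrightarrow> t \<le> 1 \<Longrightarrow> 1 \<le> t powr (- \<gamma>)"
  using powr_mono2'[of "- \<gamma>" t 1] exps by simp

lemma holder_le_one: "0 \<le> Q \<Longrightarrow> 0 \<le> u \<Longrightarrow> u \<le> 1 \<Longrightarrow> Q * u powr \<alpha> \<le> Q"
  using mult_left_mono[OF powr_le1, of \<alpha> u Q] exps by simp

lemma delta1_from_zero: "delta1 S y 0 t = y t - S t (y 0)"
  by (simp add: delta1_def)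

lemma vanishing_start_bound:
  assumes d: "mild_holder T Q d" "d 0 = 0" and Q: "0 \<le> Q" and t: "0 \<le> t" "t \<le> T" "T \<le> 1"
  shows "d t \<in> X \<alpha>" "N \<alpha> (d t) \<le> Q" "norm (d t) \<le> L * Q"
proof -
  have *: "d t \<in> X \<alpha>" "N \<alpha> (d t) \<le> Q * t powr \<alpha>"
    using mild_holderD[OF d(1), of 0 t] t d(2) by (simp_all add: delta1_from_zero)
  then show "d t \<in> X \<alpha>" "N \<alpha> (d t) \<le> Q" using holder_le_one[OF Q, of t] t by auto
  then show "norm (d t) \<le> L * Q" using embed[of "d t"] L_ge by (smt (verit) mult_left_mono)
qed

lemma solution_bound:
  assumes y: "mild_holder T Q y" "y 0 = \<psi>" and Q: "0 \<le> Q" and t: "0 < t" "t \<le> T" "T \<le> 1"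
  shows "y t \<in> X \<alpha>" "N \<alpha> (y t) \<le> L * L * (1 + Q) * t powr (- \<gamma>)"
proof -
  have *: "delta1 S y 0 t \<in> X \<alpha>" "N \<alpha> (delta1 S y 0 t) \<le> Q"
    using mild_holderD[OF y(1), of 0 t] holder_le_one[OF Q, of t] t by auto
  have S: "S t \<psi> \<in> X \<alpha>" "N \<alpha> (S t \<psi>) \<le> L * t powr (- \<gamma>)"
    using S_smooth[of \<alpha> t \<psi>] psi[of t] t by auto
  have eq: "y t = delta1 S y 0 t + S t \<psi>" using y(2) by (simp add: delta1_from_zero)
  show "y t \<in> X \<alpha>" unfolding eq by (rule X_add[OF \<alpha>_range *(1) S(1)])
  have p: "1 \<le> t powr (- \<gamma>)" using t by (intro powr_minus_ge_one) auto
  have "N \<alpha> (y t) \<le> Q + L * t powr (- \<gamma>)"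
    unfolding eq using N_add_le[OF \<alpha>_range *(1) S(1)] * S by linarith
  also have "\<dots> \<le> Q * t powr (- \<gamma>) + L * t powr (- \<gamma>)"
    using mult_left_mono[OF p Q] by simp
  also have "\<dots> = (Q + L) * t powr (- \<gamma>)" by (simp add: algebra_simps)
  also have "\<dots> \<le> L * L * (1 + Q) * t powr (- \<gamma>)"
  proof (intro mult_right_mono)
    have LL: "L * 1 \<le> L * L" using L_ge by (intro mult_left_mono) auto
    then have "1 \<le> L * L" using L_ge by linarith
    then have "1 * Q \<le> (L * L) * Q" using Q by (intro mult_right_mono)
    then show "Q + L \<le> L * L * (1 + Q)" using LL by (simp add: algebra_simps)
  qed auto
  finally show "N \<alpha> (y t) \<le> L * L * (1 + Q) * t powr (- \<gamma>)" .
qed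

lemma increment_bound:
  assumes y: "mild_holder T Q y" and Q: "0 \<le> Q" and st: "0 < s" "s \<le> t" "t \<le> T" "T \<le> 1"
    and b: "y s \<in> X \<alpha>" "N \<alpha> (y s) \<le> B * s powr (- \<gamma>)"
  shows "norm (y t - y s) \<le> L * (Q + B) * s powr (- \<gamma>) * (t - s) powr \<alpha>"
proof -
  have "y t - y s = delta1 S y s t + (S (t - s) (y s) - y s)" by (simp add: delta1_def)
  also have "norm \<dots> \<le> norm (delta1 S y s t) + norm (S (t - s) (y s) - y s)"
    by (rule norm_triangle_ineq)
  also have "\<dots> \<le> L * (Q * (t - s) powr \<alpha>) + L * (t - s) powr \<alpha> * (B * s powr (- \<gamma>))"
  proof (intro add_mono)
    show "norm (delta1 S y s t) \<le> L * (Q * (t - s) powr \<alpha>)"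
      using embed[of "delta1 S y s t"] mild_holderD[OF y, of s t] st L_ge
      by (smt (verit) mult_left_mono)
    have "norm (S (t - s) (y s) - y s) \<le> L * (t - s) powr \<alpha> * N \<alpha> (y s)"
      using st b by (intro S_near_id) auto
    also have "\<dots> \<le> L * (t - s) powr \<alpha> * (B * s powr (- \<gamma>))"
      using L_ge b by (intro mult_left_mono) auto
    finally show "norm (S (t - s) (y s) - y s) \<le> L * (t - s) powr \<alpha> * (B * s powr (- \<gamma>))" .
  qed
  also have "L * (Q * (t - s) powr \<alpha>) \<le> L * (Q * (t - s) powr \<alpha>) * s powr (- \<gamma>)"
    using mult_left_mono[OF powr_minus_ge_one[of s], of "L * (Q * (t - s) powr \<alpha>)"] st L_ge Q by simp
  finally show ?thesis by (simp add: algebra_simps)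
qed

definition C_comp :: real where
  "C_comp = L * (L * (1 + L * L)) + L * (N \<alpha> (\<sigma> 0) + L * (L * L))"

lemma C_comp_nonneg: "0 \<le> C_comp"
  unfolding C_comp_def using L_ge N_nonneg[OF \<alpha>_range sigma_X[OF X_zero[OF \<alpha>_range]]]
  by (intro add_nonneg_nonneg mult_nonneg_nonneg) auto

lemma tame_composition:
  assumes *: "T \<le> 1" "0 \<le> Q" "y 0 = \<psi>" "mild_holder T Q y"
  shows "tame T (C_comp * (1 + Q)) (\<sigma> \<circ> y)"
proof -
  define c where "c = N \<alpha> (\<sigma> 0)"
  have c: "0 \<le> c" unfolding c_def by (intro N_nonneg[OF \<alpha>_range] sigma_X X_zero[OF \<alpha>_range])
  define a where "a = c + L * (L * L)"
  have C_comp: "C_comp = L * (L * (1 + L * L)) + L * a" by (simp add: C_comp_def a_def c_def)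
  have a: "0 \<le> a" "a \<le> C_comp"
  proof -
    show a0: "0 \<le> a" using c L_ge by (simp add: a_def)
    have "1 * a \<le> L * a" using L_ge a0 by (intro mult_right_mono) auto
    moreover have "0 \<le> L * (L * (1 + L * L))" using L_ge by simp
    ultimately show "a \<le> C_comp" by (simp add: C_comp)
  qed
  have \<phi>: "(\<sigma> \<circ> y) t \<in> X \<alpha>" "N \<alpha> ((\<sigma> \<circ> y) t) \<le> a * (1 + Q) * t powr (- \<gamma>)" if t: "0 < t" "t \<le> T" for t
  proof -
    note yt = solution_bound[OF *(4,3,2) t *(1)]
    show "(\<sigma> \<circ> y) t \<in> X \<alpha>" using yt sigma_X by simp
    have "N \<alpha> ((\<sigma> (y t) - \<sigma> 0) + \<sigma> 0) \<le> N \<alpha> (\<sigma> (y t) - \<sigma> 0) + c"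
      unfolding c_def using yt by (intro N_add_le[OF \<alpha>_range] X_diff[OF \<alpha>_range] sigma_X X_zero[OF \<alpha>_range])
    also have "\<dots> \<le> L * N \<alpha> (y t - 0) + c"
      using yt by (intro add_mono sigma_lip_X X_zero[OF \<alpha>_range]) auto
    also have "\<dots> \<le> L * (L * L * (1 + Q) * t powr (- \<gamma>)) + c * ((1 + Q) * t powr (- \<gamma>))"
    proof (intro add_mono)
      show "L * N \<alpha> (y t - 0) \<le> L * (L * L * (1 + Q) * t powr (- \<gamma>))"
        using yt L_ge by (intro mult_left_mono) auto
      have "1 * 1 \<le> (1 + Q) * t powr (- \<gamma>)"
        using powr_minus_ge_one[of t] t * by (intro mult_mono) auto
      then show "c \<le> c * ((1 + Q) * t powr (- \<gamma>))"
        using mult_left_mono[of 1 "(1 + Q) * t powr (- \<gamma>)" c] c by simp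
    qed
    finally show "N \<alpha> ((\<sigma> \<circ> y) t) \<le> a * (1 + Q) * t powr (- \<gamma>)"
      by (simp add: a_def algebra_simps)
  qed
  show ?thesis
    unfolding tame_def
  proof (intro conjI allI impI)
    fix t assume t: "0 < t \<and> t \<le> T"
    show "(\<sigma> \<circ> y) t \<in> X \<alpha>" using \<phi> t by blast
    have "N \<alpha> ((\<sigma> \<circ> y) t) \<le> a * (1 + Q) * t powr (- \<gamma>)" using \<phi> t by blast
    also have "\<dots> \<le> C_comp * (1 + Q) * t powr (- \<gamma>)"
      using a * by (intro mult_right_mono) auto
    finally show "N \<alpha> ((\<sigma> \<circ> y) t) \<le> C_comp * (1 + Q) * t powr (- \<gamma>)" .
  next
    fix s t assume st: "0 < s \<and> s \<le> t \<and> t \<le> T"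
    let ?w = "s powr (- \<gamma>) * (t - s) powr \<alpha>"
    have ys: "y s \<in> X \<alpha>" "N \<alpha> (y s) \<le> L * L * (1 + Q) * s powr (- \<gamma>)"
      using solution_bound[OF *(4,3,2) _ _ *(1), of s] st by auto
    have "delta1 S (\<sigma> \<circ> y) s t = (\<sigma> (y t) - \<sigma> (y s)) - (S (t - s) ((\<sigma> \<circ> y) s) - (\<sigma> \<circ> y) s)"
      by (simp add: delta1_def)
    also have "norm \<dots> \<le> norm (\<sigma> (y t) - \<sigma> (y s)) + norm (S (t - s) ((\<sigma> \<circ> y) s) - (\<sigma> \<circ> y) s)"
      by (rule norm_triangle_ineq4)
    also have "\<dots> \<le> L * (L * ((1 + L * L) * (1 + Q)) * ?w) + L * (t - s) powr \<alpha> * (a * (1 + Q) * s powr (- \<gamma>))"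
    proof (intro add_mono)
      have "norm (\<sigma> (y t) - \<sigma> (y s)) \<le> L * norm (y t - y s)" by (rule sigma_lip)
      also have "\<dots> \<le> L * (L * (Q + L * L * (1 + Q)) * s powr (- \<gamma>) * (t - s) powr \<alpha>)"
        using L_ge st ys * by (intro mult_left_mono increment_bound[of T Q y]) auto
      also have "\<dots> \<le> L * (L * ((1 + L * L) * (1 + Q)) * s powr (- \<gamma>) * (t - s) powr \<alpha>)"
        using L_ge by (intro mult_left_mono mult_right_mono) (auto simp: algebra_simps)
      finally show "norm (\<sigma> (y t) - \<sigma> (y s)) \<le> L * (L * ((1 + L * L) * (1 + Q)) * ?w)"
        by (simp add: mult_ac)
      have "norm (S (t - s) ((\<sigma> \<circ> y) s) - (\<sigma> \<circ> y) s) \<le> L * (t - s) powr \<alpha> * N \<alpha> ((\<sigma> \<circ> y) s)"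
        using st * \<phi>[of s] by (intro S_near_id) auto
      also have "\<dots> \<le> L * (t - s) powr \<alpha> * (a * (1 + Q) * s powr (- \<gamma>))"
        using st L_ge \<phi>[of s] by (intro mult_left_mono) auto
      finally show "norm (S (t - s) ((\<sigma> \<circ> y) s) - (\<sigma> \<circ> y) s) \<le> L * (t - s) powr \<alpha> * (a * (1 + Q) * s powr (- \<gamma>))" .
    qed
    also have "\<dots> = C_comp * (1 + Q) * s powr (- \<gamma>) * (t - s) powr \<alpha>"
      by (simp add: C_comp algebra_simps)
    finally show "norm (delta1 S (\<sigma> \<circ> y) s t) \<le> C_comp * (1 + Q) * s powr (- \<gamma>) * (t - s) powr \<alpha>" .
  qed
qed

definition C_diff :: "real \<Rightarrow> real" where
  "C_diff R = L * (L * 2) + K (L * R + L * norm \<psi>) * (2 * L) * (L * (R + L * L * (1 + R))) + L * L"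

lemma L_le_C_diff: "0 \<le> R \<Longrightarrow> L \<le> C_diff R"
  unfolding C_diff_def using L_ge K_nonneg mult_mono[of 1 L L L]
  by (smt (verit, best) mult_nonneg_nonneg add_nonneg_nonneg)

lemma C_diff_nonneg: "0 \<le> R \<Longrightarrow> 0 \<le> C_diff R"
  using L_le_C_diff[of R] L_ge by linarith

lemma tame_composition_diff:
  assumes R: "0 \<le> R" and *: "T \<le> 1" "0 \<le> Q" "y 0 = \<psi>" "z 0 = \<psi>" "mild_holder T R y" "mild_holder T R z"
    and d: "mild_holder T Q (\<lambda>t. y t - z t)"
  shows "tame T (C_diff R * Q) (\<lambda>t. (\<sigma> \<circ> y) t - (\<sigma> \<circ> z) t)"
proof -
  define R' where "R' = L * R + L * norm \<psi>"
  define B where "B = L * (R + L * L * (1 + R))"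
  have B: "0 \<le> B" using L_ge R by (simp add: B_def)
  have C_diff: "C_diff R = L * (L * 2) + K R' * (2 * L) * B + L * L" by (simp add: C_diff_def R'_def B_def)
  note LC = L_le_C_diff[OF R] C_diff_nonneg[OF R]
  define \<phi> where "\<phi> t = (\<sigma> \<circ> y) t - (\<sigma> \<circ> z) t" for t
  note dt = vanishing_start_bound[OF d _ *(2) _ _ *(1), simplified *(3,4), simplified]
  have bounded: "norm (w t) \<le> R'" if "w 0 = \<psi>" "mild_holder T R w" "0 \<le> t" "t \<le> T" for w t
  proof -
    have m: "delta1 S w 0 t \<in> X \<alpha>" "N \<alpha> (delta1 S w 0 t) \<le> R"
      using mild_holderD[OF that(2), of 0 t] holder_le_one[OF R, of t] that * by auto
    have "norm (w t) \<le> norm (delta1 S w 0 t) + norm (S t \<psi>)"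
      using that(1) norm_triangle_ineq[of "delta1 S w 0 t" "S t \<psi>"] by (simp add: delta1_from_zero)
    also have "\<dots> \<le> L * N \<alpha> (delta1 S w 0 t) + L * norm \<psi>"
      using that * m by (intro add_mono embed S_bdd) auto
    also have "\<dots> \<le> R'" unfolding R'_def using m L_ge by (intro add_mono mult_left_mono) auto
    finally show ?thesis .
  qed
  have \<phi>: "\<phi> t \<in> X \<alpha>" "N \<alpha> (\<phi> t) \<le> L * Q" if t: "0 < t" "t \<le> T" for t
  proof -
    have m: "y t \<in> X \<alpha>" "z t \<in> X \<alpha>"
      using solution_bound(1)[OF *(5,3) R t *(1)] solution_bound(1)[OF *(6,4) R t *(1)] by auto
    show "\<phi> t \<in> X \<alpha>" unfolding \<phi>_def using m by (auto intro!: X_diff[OF \<alpha>_range] sigma_X)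
    have "N \<alpha> (\<phi> t) \<le> L * N \<alpha> (y t - z t)" unfolding \<phi>_def using sigma_lip_X[OF m] by simp
    also have "\<dots> \<le> L * Q" using dt[of t] t L_ge by (intro mult_left_mono) auto
    finally show "N \<alpha> (\<phi> t) \<le> L * Q" .
  qed
  show ?thesis
    unfolding tame_def \<phi>_def[symmetric]
  proof (intro conjI allI impI)
    fix t assume t: "0 < t \<and> t \<le> T"
    show "\<phi> t \<in> X \<alpha>" using \<phi> t by blast
    have "N \<alpha> (\<phi> t) \<le> L * Q" using \<phi> t by blast
    also have "\<dots> \<le> C_diff R * Q" using LC * by (intro mult_right_mono) auto
    also have "\<dots> \<le> C_diff R * Q * t powr (- \<gamma>)"
      using mult_left_mono[OF powr_minus_ge_one[of t], of "C_diff R * Q"] t * LC by simp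
    finally show "N \<alpha> (\<phi> t) \<le> C_diff R * Q * t powr (- \<gamma>)" .
  next
    fix s t assume st: "0 < s \<and> s \<le> t \<and> t \<le> T"
    let ?w = "s powr (- \<gamma>) * (t - s) powr \<alpha>"
    have w: "(t - s) powr \<alpha> \<le> ?w"
      using mult_right_mono[OF powr_minus_ge_one[of s], of "(t - s) powr \<alpha>"] st * by simp
    have d1: "norm ((y t - z t) - (y s - z s)) \<le> L * (Q + Q) * s powr (- \<gamma>) * (t - s) powr \<alpha>"
    proof (rule increment_bound[OF d])
      show "N \<alpha> (y s - z s) \<le> Q * s powr (- \<gamma>)"
        using dt(2)[of s] mult_left_mono[OF powr_minus_ge_one[of s], of Q] st * by simp
    qed (use st * dt[of s] in auto)
    have z1: "norm (z t - z s) \<le> B * s powr (- \<gamma>) * (t - s) powr \<alpha>"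
      unfolding B_def using st * R solution_bound[OF *(6,4) R _ _ *(1), of s]
      by (intro increment_bound[of T R z]) auto
    have swap: "(y t - y s) - (z t - z s) = (y t - z t) - (y s - z s)" by simp
    have "norm (\<phi> t - \<phi> s) = norm ((\<sigma> (y t) - \<sigma> (y s)) - (\<sigma> (z t) - \<sigma> (z s)))"
      by (simp add: \<phi>_def algebra_simps)
    also have "\<dots> \<le> L * norm ((y t - y s) - (z t - z s)) + K R' * (norm (y s - z s) + norm (y t - z t)) * norm (z t - z s)"
      using st * by (intro sigma_second bounded) auto
    also have "\<dots> \<le> L * (L * (Q + Q) * s powr (- \<gamma>) * (t - s) powr \<alpha>) + K R' * (L * Q + L * Q) * (B * s powr (- \<gamma>) * (t - s) powr \<alpha>)"
      unfolding swap using st * L_ge K_nonneg B z1 d1 dt(3)[of s] dt(3)[of t]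
      by (intro add_mono mult_mono mult_left_mono) auto
    finally have 1: "norm (\<phi> t - \<phi> s) \<le> (L * (L * 2) + K R' * (2 * L) * B) * Q * ?w"
      by (simp add: algebra_simps)
    have "norm (S (t - s) (\<phi> s) - \<phi> s) \<le> L * (t - s) powr \<alpha> * N \<alpha> (\<phi> s)"
      using st * \<phi>[of s] by (intro S_near_id) auto
    also have "\<dots> \<le> L * ?w * (L * Q)"
      using \<phi>[of s] st L_ge w N_nonneg[OF \<alpha>_range, of "\<phi> s"] by (intro mult_mono mult_left_mono) auto
    finally have 2: "norm (S (t - s) (\<phi> s) - \<phi> s) \<le> L * L * Q * ?w" by (simp add: mult_ac)
    have "norm (delta1 S \<phi> s t) = norm ((\<phi> t - \<phi> s) - (S (t - s) (\<phi> s) - \<phi> s))"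
      by (simp add: delta1_def)
    also have "\<dots> \<le> norm (\<phi> t - \<phi> s) + norm (S (t - s) (\<phi> s) - \<phi> s)"
      by (rule norm_triangle_ineq4)
    also have "\<dots> \<le> C_diff R * Q * s powr (- \<gamma>) * (t - s) powr \<alpha>"
      using 1 2 by (simp add: C_diff algebra_simps)
    finally show "norm (delta1 S \<phi> s t) \<le> C_diff R * Q * s powr (- \<gamma>) * (t - s) powr \<alpha>" .
  qed
qed

end

section \<open>Mild solutions as solutions of an integral equation\<close>

lemma continuous_on_into_subset:
  "continuous_on_into P V n f \<Longrightarrow> Q \<subseteq> P \<Longrightarrow> continuous_on_into Q V n f"
  unfolding continuous_on_into_def by (blast intro: tendsto_within_subset)

lemma continuous_on_into_cong:
  assumes "continuous_on_into P V n f" "\<And>p. p \<in> P \<Longrightarrow> f p = g p"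
  shows "continuous_on_into P V n g"
  unfolding continuous_on_into_def
proof (intro ballI conjI)
  fix p assume p: "p \<in> P"
  show "g p \<in> V" using assms p unfolding continuous_on_into_def by auto
  have "((\<lambda>q. n (f q - f p)) \<longlongrightarrow> 0) (at p within P)"
    using assms p unfolding continuous_on_into_def by auto
  moreover have "\<forall>\<^sub>F q in at p within P. n (f q - f p) = n (g q - g p)"
    using assms(2) p by (auto simp: eventually_at_filter)
  ultimately show "((\<lambda>q. n (g q - g p)) \<longlongrightarrow> 0) (at p within P)"
    using tendsto_cong by fast
qed

lemma C2D:
  assumes "f \<in> C2 \<beta> a b V n"
  obtains K where "0 \<le> K" "\<And>s t. a \<le> s \<Longrightarrow> s \<le> t \<Longrightarrow> t \<le> b \<Longrightarrow>
    f s t \<in> V \<and> (s < t \<longrightarrow> n (f s t) \<le> K * (t - s) powr \<beta>)"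
proof -
  obtain K where K: "\<And>s t. a \<le> s \<Longrightarrow> s < t \<Longrightarrow> t \<le> b \<Longrightarrow> n (f s t) * (t - s) powr (- \<beta>) \<le> K"
    using assms unfolding C2_def by blast
  have "n (f s t) \<le> \<bar>K\<bar> * (t - s) powr \<beta>" if "a \<le> s" "s < t" "t \<le> b" for s t
    using mult_right_mono[OF order_trans[OF K[OF that] abs_ge_self], of "(t - s) powr \<beta>"] that
    by (simp add: mult.assoc flip: powr_add)
  moreover have "f s t \<in> V" if "a \<le> s" "s \<le> t" "t \<le> b" for s t
    using assms that by (force simp: C2_def continuous_on_into_def simplex_cc_def)
  ultimately show thesis using that[of "\<bar>K\<bar>"] by simp
qed

context young_equation
begin

lemma continuous_on_into_norm: "continuous_on_into P (X 0) (N 0) f \<longleftrightarrow> continuous_on P f"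
  by (simp add: continuous_on_into_def continuous_on_def X_0 tendsto_norm_zero_iff LIM_zero_iff)

lemma continuous_on_into_add:
  assumes "continuous_on_into P (X \<alpha>) (N \<alpha>) f" "continuous_on_into P (X \<alpha>) (N \<alpha>) g"
  shows "continuous_on_into P (X \<alpha>) (N \<alpha>) (\<lambda>p. f p + g p)"
proof (rule continuous_on_into_comparison)
  fix p assume p: "p \<in> P"
  have mem: "f q \<in> X \<alpha>" "g q \<in> X \<alpha>" if "q \<in> P" for q
    using assms that unfolding continuous_on_into_def by auto
  show "f p + g p \<in> X \<alpha>" using mem[OF p] by (intro X_add[OF \<alpha>_range])
  have "((\<lambda>q. N \<alpha> (f q - f p) + N \<alpha> (g q - g p)) \<longlongrightarrow> 0 + 0) (at p within P)"
    using assms p unfolding continuous_on_into_def by (intro tendsto_add) auto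
  then show "((\<lambda>q. N \<alpha> (f q - f p) + N \<alpha> (g q - g p)) \<longlongrightarrow> 0) (at p within P)" by simp
  have "N \<alpha> (f q + g q - (f p + g p)) \<le> N \<alpha> (f q - f p) + N \<alpha> (g q - g p)" if "q \<in> P" for q
    using N_add_le[OF \<alpha>_range X_diff[OF \<alpha>_range mem(1)[OF that] mem(1)[OF p]]
        X_diff[OF \<alpha>_range mem(2)[OF that] mem(2)[OF p]]] by (simp add: algebra_simps)
  then show "\<forall>\<^sub>F q in at p within P. q \<in> P \<longrightarrow>
      N \<alpha> (f q + g q - (f p + g p)) \<le> N \<alpha> (f q - f p) + N \<alpha> (g q - g p)" by simp
qed

lemma continuous_on_into_sigma:
  assumes "continuous_on_into P (X \<alpha>) (N \<alpha>) f"
  shows "continuous_on_into P (X \<alpha>) (N \<alpha>) (\<sigma> \<circ> f)"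
proof (rule continuous_on_into_comparison)
  fix p assume p: "p \<in> P"
  have mem: "f q \<in> X \<alpha>" if "q \<in> P" for q
    using assms that unfolding continuous_on_into_def by auto
  show "(\<sigma> \<circ> f) p \<in> X \<alpha>" using mem[OF p] sigma_X by simp
  have "((\<lambda>q. N \<alpha> (f q - f p)) \<longlongrightarrow> 0) (at p within P)"
    using assms p unfolding continuous_on_into_def by auto
  then show "((\<lambda>q. L * N \<alpha> (f q - f p)) \<longlongrightarrow> 0) (at p within P)"
    by (rule tendsto_mult_right_zero)
  show "\<forall>\<^sub>F q in at p within P. q \<in> P \<longrightarrow> N \<alpha> ((\<sigma> \<circ> f) q - (\<sigma> \<circ> f) p) \<le> L * N \<alpha> (f q - f p)"
    using sigma_lip_X mem p by simp
qed

lemma delta1_continuous_norm: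
  assumes f: "continuous_on_into I (X \<alpha>) (N \<alpha>) f" and I: "I \<subseteq> {0..1}"
    and P: "\<And>s t. (s, t) \<in> P \<Longrightarrow> s \<in> I \<and> t \<in> I \<and> s \<le> t"
  shows "continuous_on P (\<lambda>(s, t). delta1 S f s t)"
proof -
  have "continuous_on P (\<lambda>p. f (snd p))"
    using P by (intro continuous_on_compose2[OF continuous_on_into_imp_norm[OF f]] continuous_intros) auto
  moreover have "continuous_on P (\<lambda>(s, t). S (t - s) (f s))"
    by (rule S_continuous_norm[OF f I]) (use P I in force)
  ultimately have "continuous_on P (\<lambda>p. f (snd p) - (case p of (s, t) \<Rightarrow> S (t - s) (f s)))"
    by (rule continuous_on_diff)
  then show ?thesis by (simp add: delta1_def case_prod_beta)
qed

lemma x_continuous: "continuous_on {0..1} x"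
  using x_holder by (intro holder_continuous_on[OF exps(1), of _ _ H]) auto

lemma delta1_orbit_add:
  assumes y: "\<And>t. 0 \<le> t \<Longrightarrow> t \<le> 1 \<Longrightarrow> y t = S t v + F t" and st: "0 \<le> s" "s \<le> t" "t \<le> 1"
  shows "delta1 S y s t = delta1 S F s t"
  using st by (simp add: delta1_def y blinfun.add_right S_S)

lemma solution_imp_mild:
  assumes y: "\<And>t. 0 \<le> t \<Longrightarrow> t \<le> 1 \<Longrightarrow> y t = S t \<psi> + F t"
    and F: "young_integral (\<sigma> \<circ> y) F" and tame: "tame 1 P (\<sigma> \<circ> y)"
  shows "mild_solution S X N \<eta> x \<sigma> \<psi> y \<and> y \<in> Y_space S X N \<alpha> \<gamma>"
proof -
  define \<phi> where "\<phi> = \<sigma> \<circ> y"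
  have F0: "F 0 = 0" using F by (simp add: young_integral_def)
  have P: "0 \<le> P" using tame_nonneg[OF tame] by simp
  note contF = young_integral_continuous[OF F tame]
  note dF = young_integral_holder[OF F tame]
  have "continuous_on_into {0<..1} (X \<alpha>) (N \<alpha>) (\<lambda>t. S t \<psi> + F t)"
    by (intro continuous_on_into_add orbit_continuous continuous_on_into_subset[OF contF(1)]) auto
  then have conty: "continuous_on_into {0<..1} (X \<alpha>) (N \<alpha>) y"
    by (rule continuous_on_into_cong) (simp add: y)
  have cont\<phi>: "continuous_on_into {0<..1} (X \<alpha>) (N \<alpha>) \<phi>"
    unfolding \<phi>_def by (rule continuous_on_into_sigma[OF conty])
  have Y: "y \<in> Y_space S X N \<alpha> \<gamma>"
    unfolding Y_space_def
  proof (intro CollectI conjI)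
    have Ft: "F t \<in> X \<alpha>" "N \<alpha> (F t) \<le> C_open * P" if "0 < t" "t \<le> 1" for t
    proof -
      show "F t \<in> X \<alpha>" using contF(1) that by (auto simp: continuous_on_into_def)
      have "N \<alpha> (F t) \<le> C_open * P * t powr \<alpha>"
        using dF[of 0 t] that F0 by (simp add: delta1_def)
      then show "N \<alpha> (F t) \<le> C_open * P" using holder_le_one[of "C_open * P" t] that C_nonneg mult_nonneg_nonneg[of C_open P] P by linarith
    qed
    have St: "S t \<psi> \<in> X \<alpha>" if "0 < t" "t \<le> 1" for t using S_smooth[of \<alpha> t \<psi>] that by auto
    show "y \<in> C1_weighted \<gamma> 0 1 (X \<alpha>) (N \<alpha>)"
      unfolding C1_weighted_def
    proof (intro CollectI conjI exI ballI conty)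
      fix t :: real assume "t \<in> {0<..1}"
      then have t: "0 < t" "t \<le> 1" by auto
      have "N \<alpha> (y t) \<le> L * t powr (- \<gamma>) + C_open * P"
        using N_add_le[OF \<alpha>_range St[OF t] Ft(1)[OF t]] psi[OF t] Ft(2)[OF t] y[of t] t by simp
      then have "t powr \<gamma> * N \<alpha> (y t) \<le> t powr \<gamma> * (L * t powr (- \<gamma>) + C_open * P)"
        by (intro mult_left_mono) auto
      also have "\<dots> = L * (t powr \<gamma> * t powr (- \<gamma>)) + C_open * P * t powr \<gamma>"
        by (simp add: algebra_simps)
      also have "t powr \<gamma> * t powr (- \<gamma>) = 1" using t by (simp flip: powr_add)
      also have "L * 1 + C_open * P * t powr \<gamma> \<le> L * 1 + C_open * P * 1"
        using t C_nonneg P exps by (intro add_left_mono mult_left_mono powr_le1) auto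
      finally show "(t - 0) powr \<gamma> * N \<alpha> (y t) \<le> L * 1 + C_open * P * 1" by simp
    qed
    show "y \<in> C1_weighted 0 0 1 (X 0) (N 0)"
      unfolding C1_weighted_def continuous_on_into_norm
    proof (intro CollectI conjI exI ballI)
      show "continuous_on {0<..1} y" by (rule continuous_on_into_imp_norm[OF conty])
      fix t :: real assume "t \<in> {0<..1}"
      then have t: "0 < t" "t \<le> 1" by auto
      have "norm (y t) \<le> norm (S t \<psi>) + norm (F t)" using y[of t] t norm_triangle_ineq by simp
      also have "\<dots> \<le> L * norm \<psi> + L * N \<alpha> (F t)" using t Ft[OF t] by (intro add_mono S_bdd embed) auto
      also have "\<dots> \<le> L * norm \<psi> + L * (C_open * P)" using L_ge Ft[OF t] by (intro add_left_mono mult_left_mono) auto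
      finally show "(t - 0) powr 0 * N 0 (y t) \<le> L * norm \<psi> + L * (C_open * P)" using t by (simp add: X_0)
    qed
    show "delta1 S y \<in> C2 \<alpha> 0 1 (X \<alpha>) (N \<alpha>)"
      unfolding C2_def
    proof (intro CollectI conjI exI ballI allI impI)
      show "continuous_on_into (simplex_cc 0 1) (X \<alpha>) (N \<alpha>) (\<lambda>(s, t). delta1 S y s t)"
        by (rule continuous_on_into_cong[OF contF(2)]) (auto simp: simplex_cc_def delta1_orbit_add[OF y])
      fix s t :: real assume st: "0 \<le> s \<and> s < t \<and> t \<le> 1"
      have "N \<alpha> (delta1 S y s t) * (t - s) powr (- \<alpha>) \<le> C_open * P * (t - s) powr \<alpha> * (t - s) powr (- \<alpha>)"
        using dF[of s t] st by (intro mult_right_mono) (auto simp: delta1_orbit_add[OF y])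
      also have "\<dots> = C_open * P * ((t - s) powr \<alpha> * (t - s) powr (- \<alpha>))" by simp
      also have "(t - s) powr \<alpha> * (t - s) powr (- \<alpha>) = 1" using st by (simp flip: powr_add)
      finally show "N \<alpha> (delta1 S y s t) * (t - s) powr (- \<alpha>) \<le> C_open * P" by simp
    qed (rule delta1_self)
  qed
  have adm: "conv_admissible S X N \<eta> 0 1 \<phi> \<alpha> 0 \<alpha> \<gamma>"
    unfolding conv_admissible_def
  proof (intro conjI)
    show "\<gamma> \<in> {0..<min \<eta> (\<alpha> + \<eta> + 0 - \<alpha>)}" using exps by auto
    show "\<phi> \<in> C1_weighted \<gamma> 0 1 (X \<alpha>) (N \<alpha>)"
      unfolding C1_weighted_def
    proof (intro CollectI conjI exI ballI cont\<phi>)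
      fix t :: real assume t: "t \<in> {0<..1}"
      have "t powr \<gamma> * N \<alpha> (\<phi> t) \<le> t powr \<gamma> * (P * t powr (- \<gamma>))"
        using tame t unfolding tame_def \<phi>_def by (intro mult_left_mono) auto
      also have "\<dots> = P" using t by (simp add: powr_minus)
      finally show "(t - 0) powr \<gamma> * N \<alpha> (\<phi> t) \<le> P" by simp
    qed
    show "delta1 S \<phi> \<in> C2_weighted \<alpha> \<gamma> 0 1 (X 0) (N 0)"
      unfolding C2_weighted_def continuous_on_into_norm
    proof (intro CollectI conjI exI ballI allI impI)
      show "continuous_on (simplex_oc 0 1) (\<lambda>(s, t). delta1 S \<phi> s t)"
        by (rule delta1_continuous_norm[OF cont\<phi>]) (auto simp: simplex_oc_def)
      fix s t :: real assume st: "0 < s \<and> s < t \<and> t \<le> 1"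
      have "(s - 0) powr \<gamma> * N 0 (delta1 S \<phi> s t) * (t - s) powr (- \<alpha>)
          \<le> s powr \<gamma> * (P * s powr (- \<gamma>) * (t - s) powr \<alpha>) * (t - s) powr (- \<alpha>)"
        using tame st P unfolding tame_def \<phi>_def by (intro mult_mono) (auto simp: X_0)
      also have "\<dots> = P" using st by (simp add: powr_minus)
      finally show "(s - 0) powr \<gamma> * N 0 (delta1 S \<phi> s t) * (t - s) powr (- \<alpha>) \<le> P" by simp
    qed (rule delta1_self)
  qed (use exps in auto)
  define M where "M s t = germ x \<phi> s t - delta1 S F s t" for s t
  have M: "norm (M s t) \<le> C_germ * P * s powr (- \<gamma>) * (t - s) powr (\<eta> + \<alpha>)" if "0 < s" "s \<le> t" "t \<le> 1" for s t
    using tame_germ_bound[OF _ chasles_delta1 _ tame that] F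
    unfolding M_def young_integral_def \<phi>_def by (simp add: norm_minus_commute)
  have rem: "conv_remainder S X N \<eta> x 0 1 \<phi> 0 \<alpha> M"
    unfolding conv_remainder_def
  proof (intro conjI ballI allI impI)
    fix \<theta> :: real assume "\<theta> \<in> {0<..<1 - 0}"
    then have \<theta>: "0 < \<theta>" "\<theta> < 1" by auto
    show "M \<in> C2 (\<eta> + \<alpha>) (0 + \<theta>) 1 (X 0) (N 0)"
      unfolding C2_def continuous_on_into_norm
    proof (intro CollectI conjI exI ballI allI impI)
      let ?D = "simplex_cc (0 + \<theta>) 1"
      have "continuous_on ?D (\<lambda>(s, t). S (t - s) (\<phi> s))"
        by (rule S_continuous_norm[OF cont\<phi>]) (use \<theta> in \<open>auto simp: simplex_cc_def\<close>)
      moreover have "continuous_on ?D (\<lambda>(s, t). delta1 S F s t)"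
        by (rule delta1_continuous_norm[OF contF(1)]) (use \<theta> in \<open>auto simp: simplex_cc_def\<close>)
      moreover have "continuous_on ?D (\<lambda>p. x (snd p))"
        "continuous_on ?D (\<lambda>p. x (fst p))"
        using \<theta> by (auto intro!: continuous_on_compose2[OF x_continuous] continuous_intros simp: simplex_cc_def)
      ultimately have "continuous_on ?D
          (\<lambda>p. (x (snd p) - x (fst p)) *\<^sub>R (case p of (s, t) \<Rightarrow> S (t - s) (\<phi> s))
            - (case p of (s, t) \<Rightarrow> delta1 S F s t))"
        by (intro continuous_intros)
      then show "continuous_on ?D (\<lambda>(s, t). M s t)"
        by (simp add: M_def germ_def case_prod_beta)
      show "M s s = 0" for s by (simp add: M_def germ_def delta1_self)
      fix s t :: real assume st: "0 + \<theta> \<le> s \<and> s < t \<and> t \<le> 1"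
      have "N 0 (M s t) * (t - s) powr (- (\<eta> + \<alpha>))
          \<le> C_germ * P * s powr (- \<gamma>) * (t - s) powr (\<eta> + \<alpha>) * (t - s) powr (- (\<eta> + \<alpha>))"
        using M[of s t] st \<theta> by (intro mult_right_mono) (auto simp: X_0)
      also have "\<dots> = C_germ * P * s powr (- \<gamma>)"
        using st by (simp add: powr_minus[of _ "\<eta> + \<alpha>"] del: minus_add_distrib)
      also have "\<dots> \<le> C_germ * P * \<theta> powr (- \<gamma>)"
        using st \<theta> exps C_nonneg P by (intro mult_left_mono powr_mono2') auto
      finally show "N 0 (M s t) * (t - s) powr (- (\<eta> + \<alpha>)) \<le> C_germ * P * \<theta> powr (- \<gamma>)" .
    qed
  next
    fix r s t :: real assume rst: "0 < r \<and> r \<le> s \<and> s \<le> t \<and> t \<le> 1"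
    have 1: "delta1 S F r t = delta1 S F s t + S (t - s) (delta1 S F r s)"
      using rst by (intro delta1_chasles) auto
    have 2: "S (t - s) (M r s) = (x s - x r) *\<^sub>R S (t - r) (\<phi> r) - S (t - s) (delta1 S F r s)"
      using rst by (simp add: M_def germ_def blinfun.diff_right blinfun.scaleR_right S_S)
    have 3: "S (t - s) (delta1 S \<phi> r s) = S (t - s) (\<phi> s) - S (t - r) (\<phi> r)"
      using rst by (simp add: delta1_def blinfun.diff_right S_S)
    show "M r t - M s t - S (t - s) (M r s) = - ((x t - x s) *\<^sub>R S (t - s) (delta1 S \<phi> r s))"
      unfolding 2 3 unfolding M_def germ_def 1 by (simp add: algebra_simps)
  qed
  have "has_conv_integral S X N \<eta> x 0 1 \<phi> (delta1 S F)"
    unfolding has_conv_integral_def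
  proof (intro conjI)
    have "\<forall>(s, t)\<in>simplex_oc 0 1. delta1 S F s t = (x t - x s) *\<^sub>R S (t - s) (\<phi> s) - M s t"
      by (auto simp: M_def germ_def)
    then show "\<exists>\<alpha>' \<beta>' \<rho> \<gamma>' M. conv_admissible S X N \<eta> 0 1 \<phi> \<alpha>' \<beta>' \<rho> \<gamma>' \<and>
        conv_remainder S X N \<eta> x 0 1 \<phi> \<beta>' \<rho> M \<and>
        (\<forall>(s, t)\<in>simplex_oc 0 1. delta1 S F s t = (x t - x s) *\<^sub>R S (t - s) (\<phi> s) - M s t)"
      using adm rem by blast
    show "continuous_on (simplex_cc 0 1) (\<lambda>(s, t). delta1 S F s t)"
      by (rule continuous_on_into_imp_norm[OF contF(2)])
  qed
  moreover have "y t = S t \<psi> + delta1 S F 0 t" if "t \<in> {0..1}" for t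
    using y[of t] that F0 by (simp add: delta1_def)
  ultimately have "mild_solution S X N \<eta> x \<sigma> \<psi> y"
    unfolding mild_solution_def conv_well_defined_def \<phi>_def[symmetric] using adm by blast
  then show ?thesis using Y by blast
qed

lemma mild_imp_solution:
  assumes z: "mild_solution S X N \<eta> x \<sigma> \<psi> z" "z \<in> Y_space S X N \<alpha> \<gamma>"
  obtains F R where "young_integral (\<sigma> \<circ> z) F" "\<And>t. 0 \<le> t \<Longrightarrow> t \<le> 1 \<Longrightarrow> z t = S t \<psi> + F t"
    "0 \<le> R" "mild_holder 1 R z"
proof -
  define \<phi> where "\<phi> = \<sigma> \<circ> z"
  obtain J where J: "has_conv_integral S X N \<eta> x 0 1 \<phi> J" "\<And>t. t \<in> {0..1} \<Longrightarrow> z t = S t \<psi> + J 0 t"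
    using z(1) unfolding mild_solution_def \<phi>_def by blast
  obtain \<alpha>' \<beta>' \<rho> \<gamma>' M where adm: "conv_admissible S X N \<eta> 0 1 \<phi> \<alpha>' \<beta>' \<rho> \<gamma>'"
    and rem: "conv_remainder S X N \<eta> x 0 1 \<phi> \<beta>' \<rho> M"
    and JM: "\<And>s t. 0 < s \<Longrightarrow> s \<le> t \<Longrightarrow> t \<le> 1 \<Longrightarrow> J s t = germ x \<phi> s t - M s t"
    using J(1) unfolding has_conv_integral_def germ_def simplex_oc_def by fast
  have contJ: "continuous_on (simplex_cc 0 1) (\<lambda>(s, t). J s t)"
    using J(1) unfolding has_conv_integral_def by blast
  have \<beta>': "0 \<le> \<beta>'" "\<beta>' < 2" and \<rho>: "1 < \<eta> + \<rho>" using adm by (auto simp: conv_admissible_def)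
  have MC2: "M \<in> C2 (\<eta> + \<rho>) a 1 (X \<beta>') (N \<beta>')" if "0 < a" "a < 1" for a
    using rem that unfolding conv_remainder_def by auto
  have Mss: "M s s = 0" if "0 < s" "s \<le> 1" for s
    using MC2[of "s / 2"] that by (auto simp: C2_def)
  have Jss: "J s s = 0" if "0 < s" "s \<le> 1" for s
    using JM[of s s] Mss[OF that] that by (simp add: germ_def)
  have add: "J r t = J s t + S (t - s) (J r s)" if "0 < r" "r \<le> s" "s \<le> t" "t \<le> 1" for r s t
  proof -
    have "M r t - M s t - S (t - s) (M r s) = - ((x t - x s) *\<^sub>R S (t - s) (delta1 S \<phi> r s))"
      using rem that unfolding conv_remainder_def by auto
    also have "S (t - s) (delta1 S \<phi> r s) = S (t - s) (\<phi> s) - S (t - r) (\<phi> r)"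
      using that by (simp add: delta1_def blinfun.diff_right S_S)
    finally have 1: "M r t = M s t + S (t - s) (M r s) - (x t - x s) *\<^sub>R (S (t - s) (\<phi> s) - S (t - r) (\<phi> r))"
      by (simp add: algebra_simps)
    have 2: "S (t - s) (J r s) = (x s - x r) *\<^sub>R S (t - r) (\<phi> r) - S (t - s) (M r s)"
      using JM[of r s] that by (simp add: germ_def blinfun.diff_right blinfun.scaleR_right S_S)
    have 3: "J r t = (x t - x r) *\<^sub>R S (t - r) (\<phi> r) - M r t" "J s t = (x t - x s) *\<^sub>R S (t - s) (\<phi> s) - M s t"
      using JM[of r t] JM[of s t] that by (auto simp: germ_def)
    show ?thesis unfolding 2 3 1 by (simp add: algebra_simps)
  qed
  have limJ: "(\<lambda>k. J (a k) (b k)) \<longlonglongrightarrow> J u v"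
    if "a \<longlonglongrightarrow> u" "b \<longlonglongrightarrow> v" "\<And>k. 0 \<le> a k \<and> a k \<le> b k \<and> b k \<le> 1" "0 \<le> u" "u \<le> v" "v \<le> 1" for a b u v
    using continuous_on_tendsto_compose[OF contJ tendsto_Pair[OF that(1,2)]] that(3-)
    by (simp add: simplex_cc_def)
  have dy: "(\<lambda>k. 1 / 2 ^ k :: real) \<longlonglongrightarrow> 0"
    using LIMSEQ_realpow_zero[of "1 / 2 :: real"] by (simp add: power_one_over)
  have J00: "J 0 0 = 0"
  proof -
    have "(\<lambda>k. J (1 / 2 ^ k) (1 / 2 ^ k)) \<longlonglongrightarrow> J 0 0"
      by (rule limJ[OF dy dy]) (auto simp: field_simps)
    moreover have "J (1 / 2 ^ k) (1 / 2 ^ k) = 0" for k by (rule Jss) (auto simp: field_simps)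
    ultimately show ?thesis by (simp add: LIMSEQ_const_iff)
  qed
  define F where "F t = J 0 t" for t
  have FJ: "delta1 S F s t = J s t" if st: "0 < s" "s \<le> t" "t \<le> 1" for s t
  proof -
    obtain m where m: "\<And>k. 1 / 2 ^ (k + m) < s" using small_dyadic[OF st(1)] by blast
    have lim: "(\<lambda>k. J (1 / 2 ^ (k + m)) u) \<longlonglongrightarrow> J 0 u" if "s \<le> u" "u \<le> 1" for u
      by (rule limJ[OF LIMSEQ_ignore_initial_segment[OF dy] tendsto_const])
        (use that m st in \<open>auto intro: less_imp_le order_trans\<close>)
    have "(\<lambda>k. J s t + S (t - s) (J (1 / 2 ^ (k + m)) s)) \<longlonglongrightarrow> J s t + S (t - s) (J 0 s)"
      using st by (intro tendsto_intros lim) auto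
    moreover have "J s t + S (t - s) (J (1 / 2 ^ (k + m)) s) = J (1 / 2 ^ (k + m)) t" for k
      using add[of "1 / 2 ^ (k + m)" s t] m[of k] st by simp
    ultimately have "J s t + S (t - s) (J 0 s) = J 0 t"
      using lim[of t] st LIMSEQ_unique by auto
    then show ?thesis by (simp add: delta1_def F_def algebra_simps)
  qed
  have "young_integral \<phi> F"
    unfolding young_integral_def
  proof (intro conjI)
    show "F 0 = 0" by (simp add: F_def J00)
    show "(\<lambda>k. F (1 / 2 ^ k)) \<longlonglongrightarrow> 0"
      unfolding F_def using limJ[OF tendsto_const[of 0] dy] J00 by (auto simp: field_simps)
    show "near_germ 1 x \<phi> (delta1 S F)"
      unfolding near_germ_def
    proof (intro allI impI)
      fix a :: real assume a: "0 < a \<and> a \<le> 1"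
      obtain E where E: "0 < E" "\<And>u. u \<in> X \<beta>' \<Longrightarrow> norm u \<le> E * N \<beta>' u"
        using X_embed_norm[OF \<beta>'] by blast
      have "M \<in> C2 (\<eta> + \<rho>) (a / 2) 1 (X \<beta>') (N \<beta>')" using a by (intro MC2) auto
      then obtain K where K: "0 \<le> K" "\<And>s t. a / 2 \<le> s \<Longrightarrow> s \<le> t \<Longrightarrow> t \<le> 1 \<Longrightarrow>
          M s t \<in> X \<beta>' \<and> (s < t \<longrightarrow> N \<beta>' (M s t) \<le> K * (t - s) powr (\<eta> + \<rho>))"
        by (rule C2D) blast
      have "norm (delta1 S F s t - germ x \<phi> s t) \<le> E * K * (t - s) powr (\<eta> + \<rho>)"
        if st: "a \<le> s \<and> s \<le> t \<and> t \<le> 1" for s t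
      proof (cases "s = t")
        case True
        then show ?thesis using FJ[of s s] Jss[of s] a st by (simp add: germ_def)
      next
        case False
        have "norm (delta1 S F s t - germ x \<phi> s t) = norm (M s t)"
          using FJ[of s t] JM[of s t] a st by simp
        also have "\<dots> \<le> E * N \<beta>' (M s t)" using a st K(2)[of s t] by (intro E) auto
        also have "\<dots> \<le> E * (K * (t - s) powr (\<eta> + \<rho>))"
          using a st E False K(2)[of s t] by (intro mult_left_mono) auto
        finally show ?thesis by (simp add: mult_ac)
      qed
      then show "\<exists>K \<rho>. 1 < \<rho> \<and> (\<forall>s t. a \<le> s \<and> s \<le> t \<and> t \<le> 1 \<longrightarrow>
          norm (delta1 S F s t - germ x \<phi> s t) \<le> K * (t - s) powr \<rho>)"
        using \<rho> by blast
    qed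
  qed
  moreover have "\<exists>R\<ge>0. mild_holder 1 R z"
  proof -
    have "delta1 S z \<in> C2 \<alpha> 0 1 (X \<alpha>) (N \<alpha>)" using z(2) by (simp add: Y_space_def)
    then obtain K where K: "0 \<le> K" "\<And>s t. 0 \<le> s \<Longrightarrow> s \<le> t \<Longrightarrow> t \<le> 1 \<Longrightarrow>
        delta1 S z s t \<in> X \<alpha> \<and> (s < t \<longrightarrow> N \<alpha> (delta1 S z s t) \<le> K * (t - s) powr \<alpha>)"
      by (rule C2D) blast
    have "N \<alpha> (delta1 S z s t) \<le> K * (t - s) powr \<alpha>" if "0 \<le> s" "s \<le> t" "t \<le> 1" for s t
      using K(2)[OF that] that by (cases "s = t") (auto simp: delta1_def S_zero N_zero[OF \<alpha>_range])
    then show ?thesis using K unfolding mild_holder_def by (intro exI[of _ K]) auto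
  qed
  ultimately show thesis using that J(2) unfolding \<phi>_def F_def by auto
qed

end

section \<open>Picard iteration\<close>

context young_equation
begin

lemma mild_holder_orbit_add:
  assumes y: "\<And>t. 0 \<le> t \<Longrightarrow> t \<le> 1 \<Longrightarrow> y t = S t v + F t" and T: "T \<le> 1"
  shows "mild_holder T Q y \<longleftrightarrow> mild_holder T Q F"
proof -
  have "delta1 S y s t = delta1 S F s t" if "0 \<le> s \<and> s \<le> t \<and> t \<le> T" for s t
    using delta1_orbit_add[OF y, of s t] that T by auto
  then show ?thesis unfolding mild_holder_def by auto
qed

lemma mild_holder_diff:
  assumes "mild_holder T Q f" "mild_holder T Q' g"
  shows "mild_holder T (Q + Q') (\<lambda>t. f t - g t)"
  unfolding mild_holder_def
proof (intro allI impI)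
  fix s t assume st: "0 \<le> s \<and> s \<le> t \<and> t \<le> T"
  have eq: "delta1 S (\<lambda>t. f t - g t) s t = delta1 S f s t - delta1 S g s t"
    by (simp add: delta1_def blinfun.diff_right)
  note f = mild_holderD[OF assms(1), of s t] and g = mild_holderD[OF assms(2), of s t]
  have "N \<alpha> (delta1 S f s t - delta1 S g s t) \<le> N \<alpha> (delta1 S f s t) + N \<alpha> (delta1 S g s t)"
    using st by (intro N_diff_le[OF \<alpha>_range] f g) auto
  also have "\<dots> \<le> Q * (t - s) powr \<alpha> + Q' * (t - s) powr \<alpha>"
    using st by (intro add_mono f g) auto
  finally show "delta1 S (\<lambda>t. f t - g t) s t \<in> X \<alpha> \<and>
      N \<alpha> (delta1 S (\<lambda>t. f t - g t) s t) \<le> (Q + Q') * (t - s) powr \<alpha>"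
    unfolding eq using st X_diff[OF \<alpha>_range f(1) g(1)] by (simp add: distrib_right)
qed

lemma mild_holder_zero_time: "0 \<le> Q \<Longrightarrow> mild_holder 0 Q f"
  unfolding mild_holder_def
proof (intro allI impI)
  fix s t :: real assume Q: "0 \<le> Q" and st: "0 \<le> s \<and> s \<le> t \<and> t \<le> 0"
  then have "s = t" by simp
  then have "delta1 S f s t = 0" by (simp add: delta1_def S_zero)
  then show "delta1 S f s t \<in> X \<alpha> \<and> N \<alpha> (delta1 S f s t) \<le> Q * (t - s) powr \<alpha>"
    using Q X_zero[OF \<alpha>_range] N_zero[OF \<alpha>_range] by simp
qed

lemma mild_holder_orbit: "mild_holder 1 0 (\<lambda>t. S t v)"
  unfolding mild_holder_def
proof (intro allI impI)
  fix s t :: real assume st: "0 \<le> s \<and> s \<le> t \<and> t \<le> 1"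
  then have "delta1 S (\<lambda>t. S t v) s t = 0" by (simp add: delta1_def S_S)
  then show "delta1 S (\<lambda>t. S t v) s t \<in> X \<alpha> \<and> N \<alpha> (delta1 S (\<lambda>t. S t v) s t) \<le> 0 * (t - s) powr \<alpha>"
    using X_zero[OF \<alpha>_range] N_zero[OF \<alpha>_range] by simp
qed

text \<open>
  The gain \<open>h powr (\<eta> - \<gamma> - \<alpha>)\<close> over the target Hoelder exponent makes the Picard map contracting
  on short intervals.
\<close>

lemma short_step:
  assumes F: "young_integral \<phi> F" "tame (T + h) (c * Q) \<phi>" and T: "0 \<le> T" "T + h \<le> 1"
    and c: "C_open * c * h powr (\<eta> - \<gamma> - \<alpha>) \<le> 1 / 2" and Q: "0 \<le> Q" and q: "0 \<le> q" "mild_holder T q F"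
  shows "mild_holder (T + h) (L * q + Q / 2) F"
proof -
  have CQ: "C_open * (c * Q) * h powr (\<eta> - \<gamma> - \<alpha>) \<le> Q / 2"
    using mult_right_mono[OF c Q] by (simp add: mult_ac)
  have short: "delta1 S F s t \<in> X \<alpha> \<and> N \<alpha> (delta1 S F s t) \<le> Q / 2 * (t - s) powr \<alpha>"
    if "0 \<le> s" "s \<le> t" "t \<le> T + h" "t - s \<le> h" for s t
    using young_integral_increment[OF F T(2) that] mult_right_mono[OF CQ, of "(t - s) powr \<alpha>"] by auto
  have "delta1 S F s t \<in> X \<alpha> \<and> N \<alpha> (delta1 S F s t) \<le> (L * q + Q / 2) * (t - s) powr \<alpha>"
    if st: "0 \<le> s" "s \<le> t" "t \<le> T + h" for s t
  proof -
    consider "t \<le> T" | "T \<le> s" | "s < T" "T < t" by linarith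
    then show ?thesis
    proof cases
      case 1
      have "1 * q \<le> L * q" using L_ge q by (intro mult_right_mono) auto
      then have "q * (t - s) powr \<alpha> \<le> (L * q + Q / 2) * (t - s) powr \<alpha>" using Q by (intro mult_right_mono) auto
      then show ?thesis using mild_holderD[OF q(2) st(1,2) 1] by auto
    next
      case 2
      have "Q / 2 * (t - s) powr \<alpha> \<le> (L * q + Q / 2) * (t - s) powr \<alpha>" using L_ge q by (intro mult_right_mono) auto
      then show ?thesis using short[of s t] st 2 by auto
    next
      case 3
      have a: "delta1 S F s T \<in> X \<alpha>" "N \<alpha> (delta1 S F s T) \<le> q * (T - s) powr \<alpha>"
        using mild_holderD[OF q(2), of s T] st 3 by auto
      have b: "delta1 S F T t \<in> X \<alpha>" "N \<alpha> (delta1 S F T t) \<le> Q / 2 * (t - T) powr \<alpha>"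
        using short[of T t] st 3 T by auto
      have c: "S (t - T) (delta1 S F s T) \<in> X \<alpha>" "N \<alpha> (S (t - T) (delta1 S F s T)) \<le> L * N \<alpha> (delta1 S F s T)"
        using S_bdd_X[of \<alpha> "t - T", OF _ _ _ a(1)] st 3 T by auto
      have eq: "delta1 S F s t = delta1 S F T t + S (t - T) (delta1 S F s T)"
        using st 3 by (intro delta1_chasles) auto
      have "N \<alpha> (delta1 S F s t) \<le> N \<alpha> (delta1 S F T t) + N \<alpha> (S (t - T) (delta1 S F s T))"
        unfolding eq by (rule N_add_le[OF \<alpha>_range b(1) c(1)])
      also have "\<dots> \<le> Q / 2 * (t - T) powr \<alpha> + L * (q * (T - s) powr \<alpha>)"
        using b c mult_left_mono[OF a(2), of L] L_ge by linarith
      also have "\<dots> \<le> Q / 2 * (t - s) powr \<alpha> + L * (q * (t - s) powr \<alpha>)"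
        using 3 Q L_ge q exps by (intro add_mono mult_left_mono powr_mono2) auto
      finally show ?thesis
        unfolding eq using X_add[OF \<alpha>_range b(1) c(1)] by (simp add: algebra_simps)
    qed
  qed
  then show ?thesis unfolding mild_holder_def by blast
qed

lemma short_grid:
  assumes "0 \<le> c"
  obtains n h where "0 < h" "C_open * c * h powr (\<eta> - \<gamma> - \<alpha>) \<le> 1 / 2" "h = 1 / real (Suc n)"
proof -
  let ?e = "\<eta> - \<gamma> - \<alpha>"
  have "(\<lambda>n. C_open * c * (1 / real (Suc n)) powr ?e) \<longlonglongrightarrow> C_open * c * 0 powr ?e"
    using exps LIMSEQ_inverse_real_of_nat by (intro tendsto_intros) (auto simp: inverse_eq_divide)
  then have "\<forall>\<^sub>F n in sequentially. C_open * c * (1 / real (Suc n)) powr ?e < 1 / 2"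
    by (intro order_tendstoD(2)[where y = "C_open * c * 0 powr ?e"]) auto
  then obtain n where "C_open * c * (1 / real (Suc n)) powr ?e < 1 / 2"
    using eventually_happens[of _ sequentially] by auto
  then show thesis using that[of "1 / real (Suc n)" n] by simp
qed

lemma grid_induct:
  assumes h: "h = 1 / real (Suc n)" and "\<Phi> 0" "\<And>T. 0 \<le> T \<Longrightarrow> T + h \<le> 1 \<Longrightarrow> \<Phi> T \<Longrightarrow> \<Phi> (T + h)"
  shows "\<Phi> (1::real)"
proof -
  have "\<Phi> (real k * h)" if "k \<le> Suc n" for k
    using that
  proof (induction k)
    case (Suc k)
    have "real (Suc k) * h \<le> 1" using Suc.prems by (simp add: h)
    then have le: "real k * h + h \<le> 1" by (simp add: distrib_right)
    have "real (Suc k) * h = real k * h + h" by (simp add: distrib_right)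
    moreover have "\<Phi> (real k * h + h)" by (rule assms(3)[OF _ le]) (use Suc in \<open>auto simp: h\<close>)
    ultimately show ?case by metis
  qed (simp add: assms(2))
  from this[of "Suc n"] show ?thesis by (simp add: h)
qed

lemma unit_step: "young_integral \<phi> F \<Longrightarrow> tame 1 P \<phi> \<Longrightarrow> mild_holder 1 (C_open * P) F"
  using young_integral_holder unfolding mild_holder_def by blast

lemma difference_step:
  assumes R: "0 \<le> R" and yz: "y 0 = \<psi>" "z 0 = \<psi>" "mild_holder 1 R y" "mild_holder 1 R z"
    and I: "young_integral (\<sigma> \<circ> y) F" "young_integral (\<sigma> \<circ> z) G" and T: "0 \<le> T" "T + h \<le> 1"
    and h: "0 < h" "C_open * C_diff R * h powr (\<eta> - \<gamma> - \<alpha>) \<le> 1 / 2"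
    and Q: "0 \<le> Q" "mild_holder (T + h) Q (\<lambda>t. y t - z t)" and q: "0 \<le> q" "mild_holder T q (\<lambda>t. F t - G t)"
  shows "mild_holder (T + h) (L * q + Q / 2) (\<lambda>t. F t - G t)"
proof (rule short_step[OF young_integral_diff[OF I] _ T h(2) Q(1) q])
  show "tame (T + h) (C_diff R * Q) (\<lambda>t. (\<sigma> \<circ> y) t - (\<sigma> \<circ> z) t)"
    using R yz T Q mild_holder_mono[OF yz(3) T(2) order_refl] mild_holder_mono[OF yz(4) T(2) order_refl]
    by (intro tame_composition_diff) auto
qed

lemma solution_unique:
  assumes y: "\<And>t. 0 \<le> t \<Longrightarrow> t \<le> 1 \<Longrightarrow> y t = S t \<psi> + F t" "young_integral (\<sigma> \<circ> y) F" "mild_holder 1 R y"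
    and z: "\<And>t. 0 \<le> t \<Longrightarrow> t \<le> 1 \<Longrightarrow> z t = S t \<psi> + G t" "young_integral (\<sigma> \<circ> z) G" "mild_holder 1 R z"
    and R: "0 \<le> R" and t: "0 \<le> t" "t \<le> 1"
  shows "y t = z t"
proof -
  have y0: "y 0 = \<psi>" "z 0 = \<psi>" using y(1)[of 0] z(1)[of 0] y(2) z(2) S_zero by (auto simp: young_integral_def)
  define d where "d t = y t - z t" for t
  have dE: "mild_holder T Q d \<longleftrightarrow> mild_holder T Q (\<lambda>t. F t - G t)" if "T \<le> 1" for T Q
    using that by (intro mild_holder_orbit_add[where v = 0]) (auto simp: d_def y(1) z(1))
  obtain n h where h: "0 < h" "C_open * C_diff R * h powr (\<eta> - \<gamma> - \<alpha>) \<le> 1 / 2" "h = 1 / real (Suc n)"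
    by (rule short_grid[OF C_diff_nonneg[OF R]])
  note step = difference_step[OF R y0 y(3) z(3) y(2) z(2) _ _ h(1,2), folded d_def]
  have "mild_holder 1 0 d"
  proof (rule grid_induct[OF h(3), of "\<lambda>T. mild_holder T 0 d"])
    fix T assume T: "0 \<le> T" "T + h \<le> 1" "mild_holder T 0 d"
    have half: "mild_holder (T + h) ((R + R) / 2 ^ n) d" for n
    proof (induction n)
      case 0
      show ?case unfolding d_def using T mild_holder_mono[OF mild_holder_diff[OF y(3) z(3)]] by simp
    next
      case (Suc n)
      then show ?case using step[of T "(R + R) / 2 ^ n" 0] dE T h(1) R by (simp add: mult.commute)
    qed
    show "mild_holder (T + h) 0 d"
      unfolding mild_holder_def
    proof (intro allI impI conjI)
      fix s t assume st: "0 \<le> s \<and> s \<le> t \<and> t \<le> T + h"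
      show "delta1 S d s t \<in> X \<alpha>" using mild_holderD(1)[OF half] st by blast
      have "N \<alpha> (delta1 S d s t) \<le> ((R + R) * (t - s) powr \<alpha>) / 2 ^ n" for n
        using mild_holderD(2)[OF half[of n], of s t] st by simp
      moreover have "(\<lambda>n. ((R + R) * (t - s) powr \<alpha>) / 2 ^ n) \<longlonglongrightarrow> 0"
        by (rule LIMSEQ_divide_realpow_zero) simp
      ultimately have "N \<alpha> (delta1 S d s t) \<le> 0"
        by (intro LIMSEQ_le_const) auto
      then show "N \<alpha> (delta1 S d s t) \<le> 0 * (t - s) powr \<alpha>" by simp
    qed
  qed (simp add: mild_holder_zero_time)
  then have "norm (d t) \<le> L * 0"
    by (rule vanishing_start_bound(3)) (use y0 t in \<open>auto simp: d_def\<close>)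
  then show ?thesis by (simp add: d_def)
qed

primrec picard :: "nat \<Rightarrow> real \<Rightarrow> 'a" where
  "picard 0 = (\<lambda>t. S t \<psi>)"
| "picard (Suc n) = (\<lambda>t. S t \<psi> + (SOME F. young_integral (\<sigma> \<circ> picard n) F) t)"

declare picard.simps [simp del]

definition picard_integral :: "nat \<Rightarrow> real \<Rightarrow> 'a" where
  "picard_integral n = (SOME F. young_integral (\<sigma> \<circ> picard n) F)"

lemma picard_Suc: "picard (Suc n) t = S t \<psi> + picard_integral n t"
  by (simp add: picard_integral_def picard.simps(2))

lemma picard_basic:
  "picard n 0 = \<psi> \<and> (\<exists>R\<ge>0. mild_holder 1 R (picard n)) \<and> young_integral (\<sigma> \<circ> picard n) (picard_integral n)"
proof -
  have I: "young_integral (\<sigma> \<circ> picard n) (picard_integral n)" if "tame 1 P (\<sigma> \<circ> picard n)" for n P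
    unfolding picard_integral_def by (metis exists_young_integral[OF that] someI_ex)
  have "picard n 0 = \<psi> \<and> (\<exists>R\<ge>0. mild_holder 1 R (picard n))"
  proof (induction n)
    case 0
    then show ?case using mild_holder_orbit[of \<psi>] S_zero by (auto simp: picard.simps(1))
  next
    case (Suc n)
    then obtain R where R: "0 \<le> R" and tame: "tame 1 (C_comp * (1 + R)) (\<sigma> \<circ> picard n)" using tame_composition[of 1] by auto
    have "mild_holder 1 (C_open * (C_comp * (1 + R))) (picard (Suc n))"
      using mild_holder_orbit_add[OF picard_Suc, of 1] unit_step[OF I[OF tame] tame] by simp
    moreover have "0 \<le> C_open * (C_comp * (1 + R))" using C_nonneg C_comp_nonneg R by simp
    moreover have "picard (Suc n) 0 = \<psi>"
      using I[OF tame] S_zero unfolding picard_Suc young_integral_def by simp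
    ultimately show ?case by blast
  qed
  then show ?thesis using I tame_composition[of 1] by blast
qed

lemma picard_integral: "young_integral (\<sigma> \<circ> picard n) (picard_integral n)"
  using picard_basic by blast

lemma picard_bounded: obtains R where "0 \<le> R" "\<And>n. mild_holder 1 R (picard n)"
proof -
  obtain n h where h: "0 < h" "C_open * C_comp * h powr (\<eta> - \<gamma> - \<alpha>) \<le> 1 / 2" "h = 1 / real (Suc n)"
    by (rule short_grid[OF C_comp_nonneg])
  have "\<exists>B\<ge>0. \<forall>n. mild_holder 1 B (picard n)"
  proof (rule grid_induct[OF h(3), of "\<lambda>T. \<exists>B\<ge>0. \<forall>n. mild_holder T B (picard n)"])
    fix T assume T: "0 \<le> T" "T + h \<le> 1" and "\<exists>B\<ge>0. \<forall>n. mild_holder T B (picard n)"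
    then obtain B where B: "0 \<le> B" "\<And>n. mild_holder T B (picard n)" by auto
    define B' where "B' = 2 * L * B + 1"
    have B': "0 \<le> B'" "L * B + (1 + B') / 2 = B'" using B L_ge by (auto simp: B'_def field_simps)
    have "mild_holder (T + h) B' (picard n)" for n
    proof (induction n)
      case 0
      then show ?case using mild_holder_mono[OF mild_holder_orbit] T B' by (simp add: picard.simps(1))
    next
      case (Suc n)
      have "mild_holder T B (picard_integral n)"
        using B(2)[of "Suc n"] mild_holder_orbit_add[OF picard_Suc] T h(1) by auto
      moreover have "tame (T + h) (C_comp * (1 + B')) (\<sigma> \<circ> picard n)"
        using Suc T B' picard_basic by (intro tame_composition) auto
      ultimately have "mild_holder (T + h) (L * B + (1 + B') / 2) (picard_integral n)"
        using T B B' picard_integral h(2) by (intro short_step[where c = C_comp]) auto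
      then show ?case using mild_holder_orbit_add[OF picard_Suc] T B'(2) by simp
    qed
    then show "\<exists>B\<ge>0. \<forall>n. mild_holder (T + h) B (picard n)" using B' by blast
  qed (use mild_holder_zero_time in auto)
  then show thesis using that by blast
qed

lemma picard_contraction:
  obtains c where "0 \<le> c" "\<And>n. mild_holder 1 (c * (3 / 4) ^ n) (\<lambda>t. picard (Suc n) t - picard n t)"
proof -
  obtain R where R: "0 \<le> R" "\<And>n. mild_holder 1 R (picard n)" using picard_bounded by blast
  define d where "d n t = picard (Suc n) t - picard n t" for n t
  define E where "E n t = picard_integral (Suc n) t - picard_integral n t" for n t
  have dE: "mild_holder T Q (d (Suc n)) \<longleftrightarrow> mild_holder T Q (E n)" if "T \<le> 1" for T Q n
    using that by (intro mild_holder_orbit_add[where v = 0]) (auto simp: d_def E_def picard_Suc)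
  obtain n h where h: "0 < h" "C_open * C_diff R * h powr (\<eta> - \<gamma> - \<alpha>) \<le> 1 / 2" "h = 1 / real (Suc n)"
    by (rule short_grid[OF C_diff_nonneg[OF R(1)]])
  have "\<exists>c\<ge>0. \<forall>n. mild_holder 1 (c * (3 / 4) ^ n) (d n)"
  proof (rule grid_induct[OF h(3), of "\<lambda>T. \<exists>c\<ge>0. \<forall>n. mild_holder T (c * (3 / 4) ^ n) (d n)"])
    fix T assume T: "0 \<le> T" "T + h \<le> 1" and "\<exists>c\<ge>0. \<forall>n. mild_holder T (c * (3 / 4) ^ n) (d n)"
    then obtain c where c: "0 \<le> c" "\<And>n. mild_holder T (c * (3 / 4) ^ n) (d n)" by auto
    define c' where "c' = 3 * L * c + (R + R)"
    have c': "0 \<le> c'" "R + R \<le> c'" "3 * L * c \<le> c'" using c(1) L_ge R by (auto simp: c'_def)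
    have "mild_holder (T + h) (c' * (3 / 4) ^ n) (d n)" for n
    proof (induction n)
      case 0
      show ?case
        unfolding d_def using mild_holder_mono[OF mild_holder_diff[OF R(2) R(2)]] T c' by simp
    next
      case (Suc n)
      note step = difference_step[OF R(1) _ _ R(2) R(2) picard_integral[of "Suc n"] picard_integral[of n]
          _ _ h(1,2), folded d_def E_def]
      have "mild_holder T (c * (3 / 4) ^ Suc n) (E n)" using c(2)[of "Suc n"] dE T h(1) by auto
      then have "mild_holder (T + h) (L * (c * (3 / 4) ^ Suc n) + c' * (3 / 4) ^ n / 2) (E n)"
        using T c(1) c' Suc picard_basic by (intro step) auto
      moreover have "L * (c * (3 / 4) ^ Suc n) + c' * (3 / 4) ^ n / 2 \<le> c' * (3 / 4) ^ Suc n"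
        using mult_right_mono[OF c'(3), of "(3 / 4) ^ n"] by (simp add: algebra_simps)
      ultimately have "mild_holder (T + h) (c' * (3 / 4) ^ Suc n) (E n)" using mild_holder_mono by blast
      then show ?case using dE T by simp
    qed
    then show "\<exists>c\<ge>0. \<forall>n. mild_holder (T + h) (c * (3 / 4) ^ n) (d n)" using c' by blast
  qed (use mild_holder_zero_time[of 0] in \<open>auto intro: exI[of _ 0]\<close>)
  then show thesis using that unfolding d_def by blast
qed

lemma solution_exists:
  obtains y F P where "\<And>t. 0 \<le> t \<Longrightarrow> t \<le> 1 \<Longrightarrow> y t = S t \<psi> + F t" "young_integral (\<sigma> \<circ> y) F"
    "tame 1 P (\<sigma> \<circ> y)"
proof -
  define d where "d n t = picard (Suc n) t - picard n t" for n t
  obtain c where c: "0 \<le> c" "\<And>n. mild_holder 1 (c * (3 / 4) ^ n) (d n)"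
    using picard_contraction unfolding d_def by blast
  obtain R0 where R0: "0 \<le> R0" "\<And>n. mild_holder 1 R0 (picard n)" using picard_bounded by blast
  have p0: "picard n 0 = \<psi>" for n using picard_basic by blast
  define y where "y t = S t \<psi> + (\<Sum>n. d n t)" for t
  have dn: "norm (d n t) \<le> L * (c * (3 / 4) ^ n)" if "0 \<le> t" "t \<le> 1" for n t
    by (rule vanishing_start_bound(3)[OF c(2)]) (use that c(1) p0 in \<open>auto simp: d_def\<close>)
  have geo: "summable (\<lambda>n. K * (c * (3 / 4) ^ n))" for K :: real
    by (intro summable_mult summable_geometric) auto
  have psum: "(\<Sum>i<n. d i t) = picard n t - S t \<psi>" for n t
    unfolding d_def using sum_lessThan_telescope[of "\<lambda>i. picard i t" n] by (simp add: picard.simps(1))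
  have sums: "(\<lambda>i. d (i + n) t) sums (y t - picard n t)" if t: "0 \<le> t" "t \<le> 1" for n t
  proof -
    have "summable (\<lambda>n. d n t)"
      by (rule summable_comparison_test'[OF geo[of L], where N = 0]) (rule dn[OF t])
    then have "(\<lambda>n. d n t) sums (y t - S t \<psi>)" by (simp add: y_def summable_sums)
    then have "(\<lambda>i. d (i + n) t) sums (y t - S t \<psi> - (\<Sum>i<n. d i t))"
      by (rule sums_split_initial_segment)
    then show ?thesis by (simp add: psum)
  qed
  have yn: "mild_holder 1 (4 * c * (3 / 4) ^ n) (\<lambda>t. y t - picard n t)" for n
    unfolding mild_holder_def
  proof (intro allI impI)
    fix s t :: real assume st: "0 \<le> s \<and> s \<le> t \<and> t \<le> 1"
    have "(\<lambda>i. d (i + n) t - S (t - s) (d (i + n) s)) sums ((y t - picard n t) - S (t - s) (y s - picard n s))"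
      using st by (intro sums_diff sums bounded_linear.sums[OF blinfun.bounded_linear_right]) auto
    then have "(\<lambda>i. delta1 S (d (i + n)) s t) sums delta1 S (\<lambda>t. y t - picard n t) s t"
      by (simp add: delta1_def)
    moreover have "delta1 S (d (i + n)) s t \<in> X \<alpha>" for i using mild_holderD(1)[OF c(2)] st by blast
    moreover have "N \<alpha> (delta1 S (d (i + n)) s t) \<le> (c * (3 / 4) ^ n * (t - s) powr \<alpha>) * (3 / 4) ^ i" for i
      using mild_holderD(2)[OF c(2)[of "i + n"], of s t] st by (simp add: power_add mult_ac)
    ultimately have "delta1 S (\<lambda>t. y t - picard n t) s t \<in> X \<alpha> \<and>
        N \<alpha> (delta1 S (\<lambda>t. y t - picard n t) s t) \<le> (c * (3 / 4) ^ n * (t - s) powr \<alpha>) / (1 - 3 / 4)"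
      by (intro N_sums[OF \<alpha>_range]) auto
    then show "delta1 S (\<lambda>t. y t - picard n t) s t \<in> X \<alpha> \<and>
        N \<alpha> (delta1 S (\<lambda>t. y t - picard n t) s t) \<le> 4 * c * (3 / 4) ^ n * (t - s) powr \<alpha>"
      by simp
  qed
  define R where "R = R0 + 4 * c"
  have R: "0 \<le> R" using R0 c by (simp add: R_def)
  have yR: "mild_holder 1 R y"
  proof -
    have "mild_holder 1 (4 * c) (\<lambda>t. y t - picard 0 t)" using yn[of 0] by simp
    then have "mild_holder 1 (4 * c) y"
      using mild_holder_orbit_add[of y \<psi> "\<lambda>t. y t - picard 0 t" 1 "4 * c"] by (simp add: picard.simps(1))
    then show ?thesis using mild_holder_mono R0(1) by (simp add: R_def)
  qed
  have pR: "mild_holder 1 R (picard n)" for n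
    using mild_holder_mono[OF R0(2)] c(1) by (simp add: R_def)
  have y0: "y 0 = \<psi>" using S_zero by (simp add: y_def d_def p0)
  have tame: "tame 1 (C_comp * (1 + R)) (\<sigma> \<circ> y)" using tame_composition[of 1 R y] R y0 yR by simp
  obtain F where F: "young_integral (\<sigma> \<circ> y) F" using exists_young_integral[OF tame] by blast
  have Fn: "norm (F t - picard_integral n t) \<le> L * (C_open * C_diff R * 4) * (c * (3 / 4) ^ n)" if t: "0 \<le> t" "t \<le> 1" for n t
  proof -
    have "tame 1 (C_diff R * (4 * c * (3 / 4) ^ n)) (\<lambda>t. (\<sigma> \<circ> y) t - (\<sigma> \<circ> picard n) t)"
      using tame_composition_diff[OF R _ _ y0 p0 yR pR yn] c(1) by simp
    moreover have I: "young_integral (\<lambda>t. (\<sigma> \<circ> y) t - (\<sigma> \<circ> picard n) t) (\<lambda>t. F t - picard_integral n t)"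
      by (rule young_integral_diff[OF F picard_integral])
    ultimately have "mild_holder 1 (C_open * (C_diff R * (4 * c * (3 / 4) ^ n))) (\<lambda>t. F t - picard_integral n t)"
      by (intro unit_step)
    then have "norm (F t - picard_integral n t) \<le> L * (C_open * (C_diff R * (4 * c * (3 / 4) ^ n)))"
      using I t C_nonneg C_diff_nonneg[OF R] c(1)
      by (intro vanishing_start_bound(3)[of 1]) (auto simp: young_integral_def)
    then show ?thesis by (simp add: mult_ac)
  qed
  have "y t = S t \<psi> + F t" if t: "0 \<le> t" "t \<le> 1" for t
  proof -
    have null: "(\<lambda>n. K * (c * (3 / 4) ^ n)) \<longlonglongrightarrow> 0" for K :: real
      using summable_LIMSEQ_zero[OF geo] .
    have "(\<lambda>n. F t - picard_integral n t) \<longlonglongrightarrow> 0"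
      by (rule Lim_null_comparison[OF _ null[of "L * (C_open * C_diff R * 4)"]]) (use Fn[OF t] in auto)
    then have "(\<lambda>n. S t \<psi> + (F t - (F t - picard_integral n t))) \<longlonglongrightarrow> S t \<psi> + (F t - 0)"
      by (intro tendsto_intros)
    then have 1: "(\<lambda>n. picard (Suc n) t) \<longlonglongrightarrow> S t \<psi> + F t" by (simp add: picard_Suc)
    have "norm (y t - picard n t) \<le> L * 4 * (c * (3 / 4) ^ n)" for n
    proof -
      have "norm (y t - picard n t) \<le> L * (4 * c * (3 / 4) ^ n)"
        using t c(1) y0 p0 by (intro vanishing_start_bound(3)[OF yn[of n]]) auto
      then show ?thesis by simp
    qed
    then have "(\<lambda>n. y t - picard n t) \<longlonglongrightarrow> 0"
      by (intro Lim_null_comparison[OF _ null[of "L * 4"]]) auto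
    then have "(\<lambda>n. y t - (y t - picard n t)) \<longlonglongrightarrow> y t - 0" by (intro tendsto_intros)
    then have "(\<lambda>n. picard n t) \<longlonglongrightarrow> y t" by simp
    then have "(\<lambda>n. picard (Suc n) t) \<longlonglongrightarrow> y t" by (rule LIMSEQ_Suc)
    then show ?thesis using 1 LIMSEQ_unique by blast
  qed
  then show thesis using that F tame by blast
qed

lemma mild_solution_exists_unique:
  "\<exists>y. mild_solution S X N \<eta> x \<sigma> \<psi> y \<and> y \<in> Y_space S X N \<alpha> \<gamma> \<and>
    (\<forall>z. mild_solution S X N \<eta> x \<sigma> \<psi> z \<and> z \<in> Y_space S X N \<alpha> \<gamma> \<longrightarrow> (\<forall>t\<in>{0..1}. z t = y t))"
proof -
  obtain y F P where y: "\<And>t. 0 \<le> t \<Longrightarrow> t \<le> 1 \<Longrightarrow> y t = S t \<psi> + F t" "young_integral (\<sigma> \<circ> y) F"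
    "tame 1 P (\<sigma> \<circ> y)" using solution_exists by blast
  have Y: "mild_solution S X N \<eta> x \<sigma> \<psi> y" "y \<in> Y_space S X N \<alpha> \<gamma>"
    using solution_imp_mild[OF y] by auto
  have "z t = y t" if z: "mild_solution S X N \<eta> x \<sigma> \<psi> z" "z \<in> Y_space S X N \<alpha> \<gamma>" and t: "t \<in> {0..1}" for z t
  proof -
    obtain G R where G: "young_integral (\<sigma> \<circ> z) G" "\<And>t. 0 \<le> t \<Longrightarrow> t \<le> 1 \<Longrightarrow> z t = S t \<psi> + G t"
      "0 \<le> R" "mild_holder 1 R z" using mild_imp_solution[OF z] by metis
    obtain R' where R': "0 \<le> R'" "mild_holder 1 R' y" using mild_imp_solution[OF Y] by metis
    show ?thesis
      using t G(3) R'(1) mild_holder_mono[OF G(4), of 1 "R + R'"] mild_holder_mono[OF R'(2), of 1 "R + R'"]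
      by (intro solution_unique[OF G(2,1) _ y(1,2), of "R + R'"]) auto
  qed
  then show ?thesis using Y by blast
qed

end

section \<open>The Gateaux derivative along segments\<close>

lemma gateaux_line:
  assumes "\<And>u. has_gateaux_derivative f (f' u) u"
  shows "((\<lambda>r. f (u + r *\<^sub>R h)) has_vector_derivative f' (u + r *\<^sub>R h) h) (at r)"
  unfolding has_vector_derivative_def has_derivative_at
proof
  show "bounded_linear (\<lambda>e. e *\<^sub>R f' (u + r *\<^sub>R h) h)" by (rule bounded_linear_scaleR_left)
  let ?q = "\<lambda>e. (f ((u + r *\<^sub>R h) + e *\<^sub>R h) - f (u + r *\<^sub>R h)) /\<^sub>R e"
  have "(?q \<longlongrightarrow> f' (u + r *\<^sub>R h) h) (at 0)"
    using assms unfolding has_gateaux_derivative_def by blast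
  then have "((\<lambda>e. norm (?q e - f' (u + r *\<^sub>R h) h)) \<longlongrightarrow> 0) (at 0)"
    by (intro tendsto_norm_zero LIM_zero)
  moreover have "\<forall>\<^sub>F e in at 0. norm (?q e - f' (u + r *\<^sub>R h) h) =
      norm (f (u + (r + e) *\<^sub>R h) - f (u + r *\<^sub>R h) - e *\<^sub>R f' (u + r *\<^sub>R h) h) / norm e"
    unfolding eventually_at_filter
  proof (intro always_eventually allI impI)
    fix e :: real assume e: "e \<noteq> 0"
    have "f (u + (r + e) *\<^sub>R h) - f (u + r *\<^sub>R h) - e *\<^sub>R f' (u + r *\<^sub>R h) h
        = e *\<^sub>R (?q e - f' (u + r *\<^sub>R h) h)"
      using e by (simp add: scaleR_diff_right scaleR_add_left add.assoc)
    then show "norm (?q e - f' (u + r *\<^sub>R h) h) =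
      norm (f (u + (r + e) *\<^sub>R h) - f (u + r *\<^sub>R h) - e *\<^sub>R f' (u + r *\<^sub>R h) h) / norm e"
      using e by simp
  qed
  ultimately show "((\<lambda>e. norm (f (u + (r + e) *\<^sub>R h) - f (u + r *\<^sub>R h) - e *\<^sub>R f' (u + r *\<^sub>R h) h) / norm e)
      \<longlongrightarrow> 0) (at 0)"
    using tendsto_cong by fast
qed

lemma unit_interval_mean_value:
  fixes g :: "real \<Rightarrow> 'b::real_normed_vector"
  assumes "\<And>r. (g has_vector_derivative D r) (at r)" "\<And>r. r \<in> {0..1} \<Longrightarrow> norm (D r) \<le> B"
  shows "norm (g 1 - g 0) \<le> B"
proof -
  have "norm (g 1 - g 0) \<le> B * norm (1 - 0 :: real)"
  proof (rule differentiable_bound[where S = "{0..1}" and f' = "\<lambda>r e. e *\<^sub>R D r"])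
    show "(g has_derivative (\<lambda>e. e *\<^sub>R D r)) (at r within {0..1})" for r
      using assms(1)[of r] unfolding has_vector_derivative_def by (rule has_derivative_at_withinI)
    show "onorm (\<lambda>e. e *\<^sub>R D r) \<le> B" if "r \<in> {0..1}" for r
      by (rule onorm_le) (simp add: mult.commute[of B] mult_left_mono assms(2)[OF that])
  qed auto
  then show ?thesis by simp
qed

lemma gateaux_lipschitz:
  assumes f: "\<And>u. has_gateaux_derivative f (f' u) u" and B: "\<And>u. norm (f' u) \<le> B"
  shows "norm (f u - f v) \<le> B * norm (u - v)"
proof -
  have "norm (f (v + 1 *\<^sub>R (u - v)) - f (v + 0 *\<^sub>R (u - v))) \<le> B * norm (u - v)"
  proof (rule unit_interval_mean_value[OF gateaux_line[OF f]])
    fix r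
    show "norm (f' (v + r *\<^sub>R (u - v)) (u - v)) \<le> B * norm (u - v)"
      using norm_blinfun[of "f' (v + r *\<^sub>R (u - v))" "u - v"] mult_right_mono[OF B, of "norm (u - v)"]
      by (meson norm_ge_zero order_trans)
  qed
  then show ?thesis by simp
qed

lemma norm_convex_combination:
  fixes u v :: "'b::real_normed_vector"
  assumes "0 \<le> r" "r \<le> 1"
  shows "norm ((1 - r) *\<^sub>R u + r *\<^sub>R v) \<le> (1 - r) * norm u + r * norm v"
  using norm_triangle_ineq[of "(1 - r) *\<^sub>R u" "r *\<^sub>R v"] assms by simp

lemma gateaux_second_difference:
  assumes f: "\<And>u. has_gateaux_derivative f (f' u) u" and B: "\<And>u. norm (f' u) \<le> B"
    and K: "\<And>u v. norm u \<le> R \<Longrightarrow> norm v \<le> R \<Longrightarrow> norm (f' u - f' v) \<le> K * norm (u - v)" "0 \<le> K"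
    and R: "norm u \<le> R" "norm u' \<le> R" "norm v \<le> R" "norm v' \<le> R"
  shows "norm ((f u' - f u) - (f v' - f v))
    \<le> B * norm ((u' - u) - (v' - v)) + K * (norm (u - v) + norm (u' - v')) * norm (v' - v)"
proof -
  define a where "a r = u + r *\<^sub>R (u' - u)" for r
  define b where "b r = v + r *\<^sub>R (v' - v)" for r
  have "norm ((f (u + 1 *\<^sub>R (u' - u)) - f (v + 1 *\<^sub>R (v' - v))) - (f (u + 0 *\<^sub>R (u' - u)) - f (v + 0 *\<^sub>R (v' - v))))
      \<le> B * norm ((u' - u) - (v' - v)) + K * (norm (u - v) + norm (u' - v')) * norm (v' - v)"
  proof (rule unit_interval_mean_value[OF has_vector_derivative_diff[OF gateaux_line[OF f] gateaux_line[OF f]]])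
    fix r :: real assume r: "r \<in> {0..1}"
    have conv: "a r = (1 - r) *\<^sub>R u + r *\<^sub>R u'" "b r = (1 - r) *\<^sub>R v + r *\<^sub>R v'"
      "a r - b r = (1 - r) *\<^sub>R (u - v) + r *\<^sub>R (u' - v')"
      by (simp_all add: a_def b_def algebra_simps)
    have "norm ((1 - r) *\<^sub>R p + r *\<^sub>R p') \<le> R" if "norm p \<le> R" "norm p' \<le> R" for p p' :: 'a
    proof -
      have "(1 - r) * norm p + r * norm p' \<le> (1 - r) * R + r * R"
        using r that by (intro add_mono mult_left_mono) auto
      then show ?thesis using norm_convex_combination[of r p p'] r by (simp add: algebra_simps)
    qed
    then have in_ball: "norm (a r) \<le> R" "norm (b r) \<le> R" unfolding conv using R by auto
    have "norm (a r - b r) \<le> (1 - r) * norm (u - v) + r * norm (u' - v')"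
      unfolding conv(3) using r by (intro norm_convex_combination) auto
    also have "\<dots> \<le> 1 * norm (u - v) + 1 * norm (u' - v')"
      using r by (intro add_mono mult_right_mono) auto
    finally have ab: "norm (a r - b r) \<le> norm (u - v) + norm (u' - v')" by simp
    have "f' (a r) (u' - u) - f' (b r) (v' - v)
        = f' (a r) ((u' - u) - (v' - v)) + (f' (a r) - f' (b r)) (v' - v)"
      by (simp add: blinfun.diff_right blinfun.diff_left)
    also have "norm \<dots> \<le> norm (f' (a r) ((u' - u) - (v' - v))) + norm ((f' (a r) - f' (b r)) (v' - v))"
      by (rule norm_triangle_ineq)
    also have "\<dots> \<le> norm (f' (a r)) * norm ((u' - u) - (v' - v)) + norm (f' (a r) - f' (b r)) * norm (v' - v)"
      by (intro add_mono norm_blinfun)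
    also have "\<dots> \<le> B * norm ((u' - u) - (v' - v)) + (K * norm (a r - b r)) * norm (v' - v)"
      by (intro add_mono mult_right_mono B K in_ball) auto
    also have "\<dots> \<le> B * norm ((u' - u) - (v' - v)) + (K * (norm (u - v) + norm (u' - v'))) * norm (v' - v)"
      by (intro add_left_mono mult_right_mono mult_left_mono ab K) auto
    finally show "norm (f' (u + r *\<^sub>R (u' - u)) (u' - u) - f' (v + r *\<^sub>R (v' - v)) (v' - v))
        \<le> B * norm ((u' - u) - (v' - v)) + K * (norm (u - v) + norm (u' - v')) * norm (v' - v)"
      by (simp add: a_def b_def)
  qed
  then show ?thesis by (simp add: algebra_simps)
qed

lemma le_mult_enlarge:
  fixes a c L :: real
  shows "a \<le> c * b \<Longrightarrow> c \<le> L \<Longrightarrow> 0 \<le> b \<Longrightarrow> a \<le> L * b"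
  by (meson mult_right_mono order_trans)

theorem theorem3p5:
  fixes S :: "real \<Rightarrow> 'a::banach \<Rightarrow>\<^sub>L 'a"
    and D :: "'a set" and A :: "'a \<Rightarrow> 'a"
    and X :: "real \<Rightarrow> 'a set" and N :: "real \<Rightarrow> 'a \<Rightarrow> real"
    and \<eta> \<alpha> \<theta> :: real and x :: "real \<Rightarrow> real"
    and \<sigma> :: "'a \<Rightarrow> 'a" and \<sigma>' :: "'a \<Rightarrow> 'a \<Rightarrow>\<^sub>L 'a" and \<psi> :: 'a
  assumes scale: "semigroup_scale S D A X N"
    and eta: "1/2 < \<eta>" "\<eta> < 1"
    and x: "holder_on \<eta> {0..1} x"
    and sigma_gateaux: "\<And>u. has_gateaux_derivative \<sigma> (\<sigma>' u) u"
    and sigma'_bounded: "bounded (range \<sigma>')"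
    and sigma'_lipschitz: "\<And>R. 0 < R \<Longrightarrow> \<exists>K. K-lipschitz_on {z. norm z \<le> R} \<sigma>'"
    and alpha: "0 < \<alpha>" "\<alpha> < 1" "\<eta> + \<alpha> > 1"
    and sigma_alpha: "\<sigma> ` X \<alpha> \<subseteq> X \<alpha>"
      "\<exists>K. \<forall>u\<in>X \<alpha>. \<forall>v\<in>X \<alpha>. N \<alpha> (\<sigma> u - \<sigma> v) \<le> K * N \<alpha> (u - v)"
    and theta: "0 \<le> \<theta>" "\<theta> \<le> \<alpha>" "\<eta> > 2 * \<alpha> - \<theta>"
    and psi: "\<psi> \<in> X \<theta>"
  shows "\<exists>y. mild_solution S X N \<eta> x \<sigma> \<psi> y \<and> y \<in> Y_space S X N \<alpha> (\<alpha> - \<theta>) \<and>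
    (\<forall>z. mild_solution S X N \<eta> x \<sigma> \<psi> z \<and> z \<in> Y_space S X N \<alpha> (\<alpha> - \<theta>)
       \<longrightarrow> (\<forall>t\<in>{0..1}. z t = y t))"
proof -
  interpret semigroup_scale S D A X N by (rule scale)
  define \<gamma> where "\<gamma> = \<alpha> - \<theta>"
  define \<kappa> where "\<kappa> = (\<alpha> + min 1 (\<eta> + \<alpha> - \<gamma>)) / 2"
  have exps: "0 < \<eta>" "\<eta> < 1" "0 < \<alpha>" "\<alpha> < \<kappa>" "\<kappa> < 1" "1 < \<eta> + \<alpha>" "0 \<le> \<gamma>" "\<kappa> + \<gamma> < \<eta> + \<alpha>" "\<gamma> + \<alpha> < \<eta>"
    using eta alpha theta by (auto simp: \<gamma>_def \<kappa>_def min_def field_simps)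
  have \<alpha>02: "0 \<le> \<alpha>" "\<alpha> < 2" and \<kappa>02: "0 \<le> \<kappa>" "\<kappa> < 2" and \<theta>02: "0 \<le> \<theta>" "\<theta> < 2"
    using exps theta by auto
  have smoothing: "\<exists>L>0. \<forall>t u. 0 < t \<and> t \<le> 1 \<and> u \<in> X z \<longrightarrow> S t u \<in> X l \<and> N l (S t u) \<le> L * (t powr (- l + z) * N z u)"
    if "0 \<le> z" "z \<le> l" "l < 2" for z l
    using S_smoothing[of 1 z l] that by (auto simp: mult.assoc)
  have near_id: "\<exists>C>0. \<forall>t u. 0 < t \<and> t \<le> 1 \<and> u \<in> X m \<longrightarrow> N n (S t u - u) \<le> C * (t powr (m - n) * N m u)"
    if "0 \<le> n" "n < m" "m \<le> 1" for m n
    using S_minus_id[of 1 n m] that by (auto simp: mult.assoc)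
  obtain L1 where L1: "\<And>t u. 0 < t \<Longrightarrow> t \<le> 1 \<Longrightarrow> norm (S t u) \<le> L1 * norm u"
    using smoothing[of 0 0] X_0 by auto meson
  obtain L2 where L2: "\<And>t u. 0 < t \<Longrightarrow> t \<le> 1 \<Longrightarrow> u \<in> X \<alpha> \<Longrightarrow> S t u \<in> X \<alpha> \<and> N \<alpha> (S t u) \<le> L2 * N \<alpha> u"
    using smoothing[of \<alpha> \<alpha>] \<alpha>02 by auto
  obtain L3 where L3: "\<And>t u. 0 < t \<Longrightarrow> t \<le> 1 \<Longrightarrow> u \<in> X \<kappa> \<Longrightarrow> S t u \<in> X \<kappa> \<and> N \<kappa> (S t u) \<le> L3 * N \<kappa> u"
    using smoothing[of \<kappa> \<kappa>] \<kappa>02 by auto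
  obtain L4 where L4: "\<And>t u. 0 < t \<Longrightarrow> t \<le> 1 \<Longrightarrow> S t u \<in> X \<alpha> \<and> N \<alpha> (S t u) \<le> L4 * (t powr (- \<alpha>) * norm u)"
    using smoothing[of 0 \<alpha>] \<alpha>02 X_0 by auto meson
  obtain L5 where L5: "\<And>t u. 0 < t \<Longrightarrow> t \<le> 1 \<Longrightarrow> S t u \<in> X \<kappa> \<and> N \<kappa> (S t u) \<le> L5 * (t powr (- \<kappa>) * norm u)"
    using smoothing[of 0 \<kappa>] \<kappa>02 X_0 by auto meson
  obtain L6 where L6: "\<And>t u. 0 < t \<Longrightarrow> t \<le> 1 \<Longrightarrow> u \<in> X \<alpha> \<Longrightarrow> N \<kappa> (S t u) \<le> L6 * (t powr (\<alpha> - \<kappa>) * N \<alpha> u)"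
    using smoothing[of \<alpha> \<kappa>] \<alpha>02 \<kappa>02 exps(4) by (auto simp: add.commute)
  obtain L7 where L7: "\<And>t u. 0 < t \<Longrightarrow> t \<le> 1 \<Longrightarrow> u \<in> X \<alpha> \<Longrightarrow> norm (S t u - u) \<le> L7 * (t powr \<alpha> * N \<alpha> u)"
    using near_id[of 0 \<alpha>] alpha X_0 by auto meson
  obtain L8 where L8: "\<And>t u. 0 < t \<Longrightarrow> t \<le> 1 \<Longrightarrow> u \<in> X \<kappa> \<Longrightarrow> N \<alpha> (S t u - u) \<le> L8 * (t powr (\<kappa> - \<alpha>) * N \<kappa> u)"
    using near_id[of \<alpha> \<kappa>] exps by auto
  obtain L9 where L9: "\<And>u. u \<in> X \<alpha> \<Longrightarrow> norm u \<le> L9 * N \<alpha> u"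
    using X_embed_norm[OF \<alpha>02] by blast
  obtain L10 where L10: "\<And>t. 0 < t \<Longrightarrow> t \<le> 1 \<Longrightarrow> N \<alpha> (S t \<psi>) \<le> L10 * t powr (- \<gamma>)"
  proof -
    obtain c where "\<And>t u. 0 < t \<Longrightarrow> t \<le> 1 \<Longrightarrow> u \<in> X \<theta> \<Longrightarrow> N \<alpha> (S t u) \<le> c * (t powr (- \<alpha> + \<theta>) * N \<theta> u)"
      using smoothing[of \<theta> \<alpha>] theta \<alpha>02 by auto
    from this[OF _ _ psi] show thesis
      by (intro that[of "c * N \<theta> \<psi>"]) (simp add: \<gamma>_def mult_ac)
  qed
  obtain L11 where L11: "\<And>u v. u \<in> X \<alpha> \<Longrightarrow> v \<in> X \<alpha> \<Longrightarrow> N \<alpha> (\<sigma> u - \<sigma> v) \<le> L11 * N \<alpha> (u - v)"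
    using sigma_alpha(2) by blast
  obtain L12 where L12: "\<And>u. norm (\<sigma>' u) \<le> L12"
    using sigma'_bounded unfolding bounded_iff by blast
  obtain c where c: "\<And>s t. s \<in> {0..1} \<Longrightarrow> t \<in> {0..1} \<Longrightarrow> \<bar>x t - x s\<bar> \<le> c * \<bar>t - s\<bar> powr \<eta>"
    using x unfolding holder_on_def by blast
  define L where "L = Max {1, L1, L2, L3, L4, L5, L6, L7, L8, L9, L10, L11, L12}"
  have L: "1 \<le> L" "L1 \<le> L" "L2 \<le> L" "L3 \<le> L" "L4 \<le> L" "L5 \<le> L" "L6 \<le> L" "L7 \<le> L" "L8 \<le> L" "L9 \<le> L"
    "L10 \<le> L" "L11 \<le> L" "L12 \<le> L"
    unfolding L_def by (intro Max_ge; simp)+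
  have X_\<kappa>_\<alpha>: "u \<in> X \<alpha>" if "u \<in> X \<kappa>" for u
    using X_embed[of \<alpha> \<kappa>] exps \<alpha>02 \<kappa>02 that by blast
  have one: "v \<le> L * v" if "0 \<le> v" for v using mult_right_mono[OF L(1) that] by simp
  have B: "norm (\<sigma>' u) \<le> L" for u using L12 L(13) by (rule order_trans)
  have "\<exists>K\<ge>0. \<forall>u v. norm u \<le> R \<longrightarrow> norm v \<le> R \<longrightarrow> norm (\<sigma>' u - \<sigma>' v) \<le> K * norm (u - v)" for R
  proof -
    obtain K where K: "K-lipschitz_on {z. norm z \<le> \<bar>R\<bar> + 1} \<sigma>'"
      using sigma'_lipschitz[OF abs_add_one_gt_zero[of R]] by (auto simp: add.commute)
    show ?thesis
      using lipschitz_onD[OF K] lipschitz_on_nonneg[OF K] by (intro exI[of _ K]) (auto simp: dist_norm)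
  qed
  then obtain K where K: "\<And>R. 0 \<le> K R"
    "\<And>R u v. norm u \<le> R \<Longrightarrow> norm v \<le> R \<Longrightarrow> norm (\<sigma>' u - \<sigma>' v) \<le> K R * norm (u - v)"
    by metis
  interpret young_equation S D A X N \<eta> \<alpha> \<gamma> \<kappa> L "\<bar>c\<bar>" x \<sigma> K \<psi>
  proof unfold_locales
    show "\<bar>x t - x s\<bar> \<le> \<bar>c\<bar> * (t - s) powr \<eta>" if "0 \<le> s" "s \<le> t" "t \<le> 1" for s t
      using le_mult_enlarge[OF c[of s t], of "\<bar>c\<bar>"] that by auto
    show "norm (S t u) \<le> L * norm u" if "0 \<le> t" "t \<le> 1" for t u
      using le_mult_enlarge[OF L1 L(2)] one[of "norm u"] S_zero that by (cases "t = 0") auto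
    show "S t u \<in> X l \<and> N l (S t u) \<le> L * N l u"
      if "l \<in> {\<alpha>, \<kappa>}" "0 \<le> t" "t \<le> 1" "u \<in> X l" for l t u
      using L2[of t u] L3[of t u] le_mult_enlarge[OF _ L(3), of "N \<alpha> (S t u)" "N \<alpha> u"]
        le_mult_enlarge[OF _ L(4), of "N \<kappa> (S t u)" "N \<kappa> u"] one[of "N l u"] S_zero that
        N_nonneg[OF \<alpha>02, of u] N_nonneg[OF \<kappa>02, of u]
      by (cases "t = 0") auto
    show "S t u \<in> X l \<and> N l (S t u) \<le> L * t powr (- l) * norm u" if "l \<in> {\<alpha>, \<kappa>}" "0 < t" "t \<le> 1" for l t u
      using L4[of t u] L5[of t u] le_mult_enlarge[OF _ L(5), of "N \<alpha> (S t u)" "t powr (- \<alpha>) * norm u"]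
        le_mult_enlarge[OF _ L(6), of "N \<kappa> (S t u)" "t powr (- \<kappa>) * norm u"] that
      by (auto simp: mult.assoc)
    show "N l (S t u) \<le> L * t powr (\<alpha> - l) * N \<alpha> u" if "l \<in> {\<alpha>, \<kappa>}" "0 < t" "t \<le> 1" "u \<in> X \<alpha>" for l t u
      using L2[of t u] L6[of t u] le_mult_enlarge[OF _ L(3), of "N \<alpha> (S t u)" "N \<alpha> u"]
        le_mult_enlarge[OF _ L(7), of "N \<kappa> (S t u)" "t powr (\<alpha> - \<kappa>) * N \<alpha> u"] that
        N_nonneg[OF \<alpha>02, of u]
      by (auto simp: mult.assoc)
    show "norm (S t u - u) \<le> L * t powr \<alpha> * N \<alpha> u" if "0 \<le> t" "t \<le> 1" "u \<in> X \<alpha>" for t u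
      using le_mult_enlarge[OF L7 L(8), of t u] S_zero that N_nonneg[OF \<alpha>02, of u] alpha
      by (cases "t = 0") (auto simp: mult.assoc)
    show "u \<in> X \<alpha> \<and> N \<alpha> (S t u - u) \<le> L * t powr (\<kappa> - \<alpha>) * N \<kappa> u" if "0 \<le> t" "t \<le> 1" "u \<in> X \<kappa>" for t u
      using le_mult_enlarge[OF L8 L(9), of t u] S_zero that N_nonneg[OF \<kappa>02, of u] exps X_\<kappa>_\<alpha> N_zero[OF \<alpha>02]
      by (cases "t = 0") (auto simp: mult.assoc)
    show "norm u \<le> L * N \<alpha> u" if "u \<in> X \<alpha>" for u
      using le_mult_enlarge[OF L9 L(10)] N_nonneg[OF \<alpha>02] that by blast
    show "\<sigma> u \<in> X \<alpha>" if "u \<in> X \<alpha>" for u using sigma_alpha(1) that by blast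
    show "N \<alpha> (\<sigma> u - \<sigma> v) \<le> L * N \<alpha> (u - v)" if "u \<in> X \<alpha>" "v \<in> X \<alpha>" for u v
      using le_mult_enlarge[OF L11 L(12)] N_nonneg[OF \<alpha>02] X_diff[OF \<alpha>02] that by blast
    show "norm (\<sigma> u - \<sigma> v) \<le> L * norm (u - v)" for u v
      by (rule gateaux_lipschitz[OF sigma_gateaux B])
    show "0 \<le> K R" for R using K by blast
    show "norm ((\<sigma> u' - \<sigma> u) - (\<sigma> v' - \<sigma> v))
        \<le> L * norm ((u' - u) - (v' - v)) + K R * (norm (u - v) + norm (u' - v')) * norm (v' - v)"
      if "norm u \<le> R" "norm u' \<le> R" "norm v \<le> R" "norm v' \<le> R" for R u u' v v'
      using gateaux_second_difference[OF sigma_gateaux B] K that by blast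
    show "N \<alpha> (S t \<psi>) \<le> L * t powr (- \<gamma>)" if "0 < t" "t \<le> 1" for t
      using le_mult_enlarge[OF L10 L(11)] that by simp
  qed (use exps L in auto)
  show ?thesis using mild_solution_exists_unique unfolding \<gamma>_def .
qed

end
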